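(* Let $n\ge 1$. For any tree $\Gamma_{n+1}$ on $[n+1]$ and all indices $i$ in the respective ranges: 1) $\gamma_i(As^n)\le\gamma_i(P_{\Gamma_{n+1}})\le\gamma_i(St^n)$ for $0\le i\le\lfloor n/2\rfloor$; 2) $g_i(As^n)\le g_i(P_{\Gamma_{n+1}})\le g_i(St^n)$ for $0\le i\le\lfloor n/2\rfloor$; 3) $h_i(As^n)\le h_i(P_{\Gamma_{n+1}})\le h_i(St^n)$ for $0\le i\le n$; 4) $f_i(As^n)\le f_i(P_{\Gamma_{n+1}})\le f_i(St^n)$ for $0\le i\le n$.
   Context: Notation: $[m]=\{1,\ldots,m\}$. Graphs are finite, with no loops or multiple edges. For a graph $\Gamma$ on $[n+1]$, the graphical building set $B(\Gamma)$ is the collection of nonempty $S\subseteq[n+1]$ such that the induced subgraph $\Gamma|_S$ is connected. The graph-associahedron is the Minkowski sum $P_\Gamma=\sum_{S\in B(\Gamma)}\Delta^S\subset\mathbb{R}^{n+1}$, where $\Delta^S=\mathrm{conv}\{e_i : i\in S\}$ and $e_1,\ldots,e_{n+1}$ are the standard basis vectors of $\mathbb{R}^{n+1}$. For connected $\Gamma$ on $[n+1]$, $P_\Gamma$ is a simple polytope of dimension $n$ (a polytope of dimension $n$ is simple if every vertex lies in exactly $n$ facets). Special series: $As^n=P_{L_{n+1}}$ (associahedron), $L_{n+1}$ the path graph on $[n+1]$; $St^n=P_{K_{1,n}}$ (stellohedron), $K_{1,n}$ the star graph on $[n+1]$ (one node adjacent to the other $n$ nodes, no other edges). For an $n$-dimensional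 simple polytope $P$, let $f_i=f_i(P)$ be the number of its $i$-dimensional faces ($f_n=1$), $F(P)(\alpha,t)=\sum_{i=0}^n f_i\alpha^i t^{n-i}$ and $H(P)(\alpha,t)=F(P)(\alpha-t,t)=\sum_{i=0}^n h_i\alpha^{n-i}t^i$, which defines $h_i=h_i(P)$. Put $g_0=1$ and $g_i=h_i-h_{i-1}$ for $1\le i\le\lfloor n/2\rfloor$. By the Dehn–Sommerville equations $H(P)$ is symmetric in $\alpha,t$, so it is uniquely written as $H(P)=\sum_{i=0}^{\lfloor n/2\rfloor}\gamma_i(\alpha t)^i(\alpha+t)^{n-2i}$, which defines $\gamma_i=\gamma_i(P)$. *)

theory Defs
  imports "HOL-Analysis.Analysis" "HOL-Computational_Algebra.Polynomial"
begin

section \<open>Finite simple graphs\<close>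

text \<open>
  A graph is a vertex set together with a set of two-element edges.  The predicate for trees in
  the AFP entry Graph-Theory speaks about directed cycles and counts a pair of opposite arcs as
  a cycle, so it does not describe undirected trees; hence the elementary definitions here.
\<close>

definition simple_graph :: "'v set \<Rightarrow> 'v set set \<Rightarrow> bool" where
  "simple_graph V E \<longleftrightarrow> finite V \<and> (\<forall>e\<in>E. e \<subseteq> V \<and> card e = 2)"

definition induced_edges :: "'v set set \<Rightarrow> 'v set \<Rightarrow> 'v set set" where
  "induced_edges E S = {e \<in> E. e \<subseteq> S}"

definition connected_graph :: "'v set \<Rightarrow> 'v set set \<Rightarrow> bool" where
  "connected_graph V E \<longleftrightarrow> V \<noteq> {} \<and> (\<forall>u\<in>V. \<forall>v\<in>V. (u, v) \<in> {(x, y). {x, y} \<in> E}\<^sup>*)"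

definition is_cycle :: "'v set set \<Rightarrow> 'v list \<Rightarrow> bool" where
  "is_cycle E vs \<longleftrightarrow> length vs \<ge> 3 \<and> distinct vs \<and>
     (\<forall>i<length vs. {vs ! i, vs ! (Suc i mod length vs)} \<in> E)"

definition tree :: "'v set \<Rightarrow> 'v set set \<Rightarrow> bool" where
  "tree V E \<longleftrightarrow> simple_graph V E \<and> connected_graph V E \<and> (\<nexists>vs. is_cycle E vs)"

definition path_edges :: "nat \<Rightarrow> nat set set" where
  "path_edges n = {{i, i + 1} |i. i \<in> {1..n}}"

text \<open>The centre of the star on \<open>{1..n+1}\<close> is the node 1.\<close>

definition star_edges :: "nat \<Rightarrow> nat set set" where
  "star_edges n = {{1, i} |i. i \<in> {2..n + 1}}"

section \<open>Graph-associahedra\<close>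

definition graphical_building_set :: "'v set \<Rightarrow> 'v set set \<Rightarrow> 'v set set" where
  "graphical_building_set V E =
     {S. S \<noteq> {} \<and> S \<subseteq> V \<and> connected_graph S (induced_edges E S)}"

text \<open>
  \<open>e v\<close> is the standard basis vector belonging to the vertex \<open>v\<close>.  The sum is the Minkowski
  sum of sets from HOL-Library.Set-Algebras.
\<close>

definition graph_associahedron ::
    "('v \<Rightarrow> 'a::real_vector) \<Rightarrow> 'v set \<Rightarrow> 'v set set \<Rightarrow> 'a set" where
  "graph_associahedron e V E = (\<Sum>S\<in>graphical_building_set V E. convex hull (e ` S))"

definition associahedron :: "(nat \<Rightarrow> 'a::real_vector) \<Rightarrow> nat \<Rightarrow> 'a set" where
  "associahedron e n = graph_associahedron e {1..n + 1} (path_edges n)"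

definition stellohedron :: "(nat \<Rightarrow> 'a::real_vector) \<Rightarrow> nat \<Rightarrow> 'a set" where
  "stellohedron e n = graph_associahedron e {1..n + 1} (star_edges n)"

section \<open>Face numbers and the derived invariants\<close>

definition pdim :: "'a::euclidean_space set \<Rightarrow> nat" where
  "pdim P = nat (aff_dim P)"

definition f_num :: "'a::euclidean_space set \<Rightarrow> nat \<Rightarrow> nat" where
  "f_num P i = card {F. F face_of P \<and> aff_dim F = int i}"

text \<open>
  Polynomials in \<open>\<alpha>\<close> and \<open>t\<close> are elements of \<open>int poly poly\<close>: the outer variable is \<open>\<alpha>\<close>,
  the inner one (of the coefficients) is \<open>t\<close>.
\<close>

definition var_alpha :: "int poly poly" where
  "var_alpha = [:0, 1:]"

definition var_t :: "int poly poly" where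
  "var_t = [:[:0, 1:]:]"

definition F_poly :: "'a::euclidean_space set \<Rightarrow> int poly poly" where
  "F_poly P = (\<Sum>i\<le>pdim P. of_nat (f_num P i) * var_alpha ^ i * var_t ^ (pdim P - i))"

text \<open>Composition substitutes \<open>\<alpha> - t\<close> for the outer variable \<open>\<alpha>\<close> and leaves \<open>t\<close> alone.\<close>

definition H_poly :: "'a::euclidean_space set \<Rightarrow> int poly poly" where
  "H_poly P = pcompose (F_poly P) (var_alpha - var_t)"

text \<open>The coefficient of \<open>\<alpha> ^ (n - i) * t ^ i\<close> in \<open>H_poly P\<close>, where \<open>n = pdim P\<close>.\<close>

definition h_num :: "'a::euclidean_space set \<Rightarrow> nat \<Rightarrow> int" where
  "h_num P i = coeff (coeff (H_poly P) (pdim P - i)) i"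

definition g_num :: "'a::euclidean_space set \<Rightarrow> nat \<Rightarrow> int" where
  "g_num P i = (if i = 0 then 1 else h_num P i - h_num P (i - 1))"

text \<open>
  The coefficients beyond \<open>pdim P div 2\<close> are set to 0, so that the sequence is determined
  uniquely.  For simple polytopes it exists by the Dehn-Sommerville equations.
\<close>

definition gamma_num :: "'a::euclidean_space set \<Rightarrow> nat \<Rightarrow> int" where
  "gamma_num P = (THE c. (\<forall>i>pdim P div 2. c i = 0) \<and>
     H_poly P = (\<Sum>i\<le>pdim P div 2.
       of_int (c i) * (var_alpha * var_t) ^ i * (var_alpha + var_t) ^ (pdim P - 2 * i)))"

end

theory Submission
  imports Defs
begin

text \<open>
  A face of a Minkowski sum is the set on which some linear functional is maximal, and the
  functional picks from each summand \<open>\<Delta>\<^sup>S\<close> the face spanned by the vertices of \<open>S\<close> of maximal weight.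
  All these choices are encoded by the family of those connected \<open>S\<close> whose maximal weight goes up
  as soon as \<open>S\<close> is enlarged.  The families that occur are the nested sets, and a nested set \<open>N\<close>
  belongs to a face of dimension \<open>|V| - |N|\<close> (\<open>nest_of_from_face\<close>, \<open>nest_of_surj\<close>,
  \<open>aff_dim_face\<close>).  So the face polynomial counts nested sets by their size.

  Let \<open>v\<close> be a leaf of a tree \<open>\<Gamma>\<close>, or more generally a vertex whose deletion keeps connected sets
  connected.  A nested set of \<open>\<Gamma>\<close> is obtained from one of \<open>\<Gamma> - v\<close> by inserting \<open>v\<close> somewhere along
  the chain of those members \<open>T\<close> for which \<open>T + v\<close> is connected.  Counting the positions gives
    \<open>H(\<Gamma>) = (\<alpha> + t) H(\<Gamma> - v) + \<alpha> t (\<Sum>T. H(\<Gamma>|T) H((\<Gamma> - v)/T))\<close>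
  (\<open>face_sum_delete\<close>), where \<open>T\<close> runs over the connected proper subsets of \<open>\<Gamma> - v\<close> with \<open>T + v\<close>
  connected and \<open>/\<close> denotes contraction.  The two coefficients are exactly the variables of the
  \<open>\<gamma>\<close>-expansion.  Hence \<open>H\<close> lies in the cone of non-negative combinations of
  \<open>(\<alpha> t)^i (\<alpha> + t)^(n - 2 i)\<close>.  This cone is closed under products, so the recursion can be
  compared term by term in the order which the cone defines, and an inequality in this order implies
  those for \<open>\<gamma>\<close>, \<open>g\<close>, \<open>h\<close> and \<open>f\<close> (\<open>gamma_le_invariants\<close>).

  The contraction of a tree need not be a tree.  The induction therefore runs over building sets on a
  vertex set with an elimination order: initial segments of members are members.  This class is
  closed under restriction and contraction.  In the recursion there is at least one \<open>T\<close> of every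
  possible size, because a connected set can be grown one vertex at a time, and a path has exactly
  one; this is the lower bound.  For the upper bound, let \<open>\<Gamma>\<close> have \<open>m + 2\<close> vertices.  There are at most \<open>m + 1 choose k\<close> sets \<open>T\<close> of
  size \<open>k\<close> in general, which bounds the contractions, but if \<open>v\<close> is a leaf then every \<open>T\<close> contains
  the neighbour of \<open>v\<close>, which leaves at most \<open>m choose (k - 1)\<close>.  The star attains this number, and
  its contractions are complete graphs, which attain the general bound.
\<close>

section \<open>Accessible building sets and nested sets\<close>

text \<open>
  The family of connected vertex sets of a connected graph, with the graph forgotten.  Contractions of
  trees stay in this class although they are no longer trees.  The axiom \<open>grow\<close> is what remains of
  adjacency: inside a larger connected set, a connected set can be extended by a single vertex.
\<close>
locale accessible_building_set =
  fixes V :: "'v set" and B :: "'v set set"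
  assumes finite_V: "finite V"
    and top_mem: "V \<in> B"
    and subset_V: "S \<in> B \<Longrightarrow> S \<subseteq> V"
    and nonempty: "S \<in> B \<Longrightarrow> S \<noteq> {}"
    and singleton_mem: "v \<in> V \<Longrightarrow> {v} \<in> B"
    and union_mem: "S \<in> B \<Longrightarrow> T \<in> B \<Longrightarrow> S \<inter> T \<noteq> {} \<Longrightarrow> S \<union> T \<in> B"
    and grow: "S \<in> B \<Longrightarrow> S' \<in> B \<Longrightarrow> S \<subset> S' \<Longrightarrow> \<exists>u\<in>S' - S. insert u S \<in> B"

text \<open>
  Nested sets of a building set are usually also required not to contain several disjoint members
  whose union is in \<open>B\<close>.  Under the axiom \<open>grow\<close> the condition on pairs implies this, because inside
  such a union one of the members could be extended by a vertex of another one, and then the union of these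
  two would be in \<open>B\<close>.  The top set \<open>V\<close> is a member by convention.
\<close>
definition nested_sets :: "'v set \<Rightarrow> 'v set set \<Rightarrow> 'v set set set" where
  "nested_sets V B =
     {N. N \<subseteq> B \<and> V \<in> N \<and> (\<forall>S\<in>N. \<forall>T\<in>N. S \<union> T \<in> B \<longrightarrow> S \<subseteq> T \<or> T \<subseteq> S)}"

definition restriction :: "'v set set \<Rightarrow> 'v set \<Rightarrow> 'v set set" where
  "restriction B T = {S \<in> B. S \<subseteq> T}"

text \<open>
  For a graph, this is the graph on \<open>V - T\<close> in which two vertices are joined if they are adjacent or
  both adjacent to \<open>T\<close>.
\<close>
definition contraction :: "'v set \<Rightarrow> 'v set set \<Rightarrow> 'v set \<Rightarrow> 'v set set" where
  "contraction V B T = {U. U \<noteq> {} \<and> U \<subseteq> V - T \<and> (U \<in> B \<or> U \<union> T \<in> B)}"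

lemma nested_setsD:
  assumes "N \<in> nested_sets V B"
  shows "N \<subseteq> B" "V \<in> N"
    "\<And>S T. S \<in> N \<Longrightarrow> T \<in> N \<Longrightarrow> S \<union> T \<in> B \<Longrightarrow> S \<subseteq> T \<or> T \<subseteq> S"
  using assms by (auto simp: nested_sets_def)

lemma nested_setsI:
  assumes "N \<subseteq> B" "V \<in> N"
    "\<And>S T. S \<in> N \<Longrightarrow> T \<in> N \<Longrightarrow> S \<union> T \<in> B \<Longrightarrow> S \<subseteq> T \<or> T \<subseteq> S"
  shows "N \<in> nested_sets V B"
  using assms by (auto simp: nested_sets_def)

context accessible_building_set
begin

lemma finite_B: "finite B"
  by (rule finite_subset[of _ "Pow V"]) (use subset_V finite_V in auto)

lemma finite_mem: "S \<in> B \<Longrightarrow> finite S"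
  using finite_subset[OF subset_V finite_V] .

lemma finite_nested_sets: "finite (nested_sets V B)"
proof -
  have "nested_sets V B \<subseteq> Pow B" by (auto simp: nested_sets_def)
  then show ?thesis using finite_B by (simp add: finite_subset)
qed

lemma finite_nested: "N \<in> nested_sets V B \<Longrightarrow> finite N"
  using finite_subset[OF nested_setsD(1) finite_B] .

lemma nested_comparable:
  assumes "N \<in> nested_sets V B" "S \<in> N" "T \<in> N" "S \<inter> T \<noteq> {}"
  shows "S \<subseteq> T \<or> T \<subseteq> S"
proof -
  have "S \<in> B" "T \<in> B" using nested_setsD(1)[OF assms(1)] assms by auto
  then show ?thesis using union_mem assms nested_setsD(3)[OF assms(1)] by auto
qed

lemma union_absorb:
  assumes "S \<in> B" "T \<in> B" "u \<in> S" "insert u T \<in> B"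
  shows "S \<union> T \<in> B"
proof -
  have "S \<union> insert u T \<in> B" using assms by (intro union_mem) auto
  moreover have "S \<union> insert u T = S \<union> T" using assms by auto
  ultimately show ?thesis by simp
qed

text \<open>
  A member of \<open>B\<close> is not covered by members of \<open>N\<close> that fail to contain it.  Otherwise take a maximal
  such \<open>T\<close> among those that meet \<open>S\<close> and grow it inside \<open>S \<union> T\<close> by a vertex \<open>u\<close>.  Another covering member
  contains \<open>u\<close>; its union with \<open>T\<close> is in \<open>B\<close>, so the two are comparable, against maximality.
\<close>
lemma nested_witness:
  assumes N: "N \<in> nested_sets V B" and S: "S \<in> B"
  shows "\<exists>i\<in>S. \<forall>T\<in>N. i \<in> T \<longrightarrow> S \<subseteq> T"
proof (rule ccontr)
  assume "\<not> ?thesis"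
  then have cov: "\<exists>T\<in>N. i \<in> T \<and> \<not> S \<subseteq> T" if "i \<in> S" for i using that by auto
  define M where "M = {T \<in> N. T \<inter> S \<noteq> {} \<and> \<not> S \<subseteq> T}"
  have finM: "finite M" using finite_nested[OF N] by (auto simp: M_def)
  have "M \<noteq> {}" using cov nonempty[OF S] by (fastforce simp: M_def)
  then obtain T where T: "T \<in> M" and Tmax: "\<And>T'. T' \<in> M \<Longrightarrow> T \<subseteq> T' \<Longrightarrow> T = T'"
    using finite_has_maximal[OF finM] by metis
  have TB: "T \<in> B" and TN: "T \<in> N" using T nested_setsD(1)[OF N] by (auto simp: M_def)
  have "S \<union> T \<in> B" using T TB S by (intro union_mem) (auto simp: M_def)
  moreover have "T \<subset> S \<union> T" using T by (auto simp: M_def)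
  ultimately obtain u where u: "u \<in> S \<union> T - T" "insert u T \<in> B" using grow TB by blast
  then have "u \<in> S" "u \<notin> T" by auto
  obtain T' where T': "T' \<in> N" "u \<in> T'" "\<not> S \<subseteq> T'" using cov[OF \<open>u \<in> S\<close>] by auto
  have "T' \<in> M" using T' \<open>u \<in> S\<close> by (auto simp: M_def)
  have "T' \<union> T \<in> B" using union_absorb T' TB u nested_setsD(1)[OF N] by blast
  then have "T' \<subseteq> T \<or> T \<subseteq> T'" using nested_setsD(3)[OF N] T' TN by blast
  then show False using Tmax[OF \<open>T' \<in> M\<close>] \<open>u \<notin> T\<close> T' by blast
qed

lemma card_nested_le:
  assumes N: "N \<in> nested_sets V B"
  shows "card N \<le> card V"
proof -
  have "\<forall>S\<in>N. \<exists>i\<in>S. \<forall>T\<in>N. i \<in> T \<longrightarrow> S \<subseteq> T"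
    using nested_witness[OF N] nested_setsD(1)[OF N] by blast
  then obtain f where f: "\<And>S. S \<in> N \<Longrightarrow> f S \<in> S"
    "\<And>S T. S \<in> N \<Longrightarrow> T \<in> N \<Longrightarrow> f S \<in> T \<Longrightarrow> S \<subseteq> T" by metis
  have "inj_on f N"
  proof (rule inj_onI)
    fix S T assume "S \<in> N" "T \<in> N" "f S = f T"
    then show "S = T" using f(1)[of S] f(1)[of T] f(2)[of S T] f(2)[of T S] by auto
  qed
  moreover have "f ` N \<subseteq> V" using f(1) nested_setsD(1)[OF N] subset_V by blast
  ultimately show ?thesis using finite_V card_inj_on_le by blast
qed

lemma restrict_accessible:
  assumes "T \<in> B"
  shows "accessible_building_set T (restriction B T)"
proof
  show "finite T" using finite_mem assms .
  show "T \<in> restriction B T" using assms by (auto simp: restriction_def)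
  fix v assume "v \<in> T" then show "{v} \<in> restriction B T"
    using subset_V[OF assms] singleton_mem by (auto simp: restriction_def)
next
  fix S S' assume "S \<in> restriction B T" "S' \<in> restriction B T" "S \<subset> S'"
  then show "\<exists>u\<in>S' - S. insert u S \<in> restriction B T"
    using grow[of S S'] by (auto simp: restriction_def)
qed (auto simp: restriction_def nonempty union_mem)

text \<open>
  Each axiom is checked by distinguishing whether the sets involved become members with or without
  adding \<open>T\<close>.
\<close>
lemma contract_accessible:
  assumes T: "T \<in> B" "T \<noteq> V"
  shows "accessible_building_set (V - T) (contraction V B T)"
proof
  show "finite (V - T)" using finite_V by auto
  have "V - T \<union> T = V" using subset_V[OF T(1)] by auto
  then show "V - T \<in> contraction V B T"
    using T subset_V[OF T(1)] top_mem by (auto simp: contraction_def)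
  show "{v} \<in> contraction V B T" if "v \<in> V - T" for v
    using that singleton_mem by (auto simp: contraction_def)
next
  fix S S' assume S: "S \<in> contraction V B T" "S' \<in> contraction V B T"
    and i: "S \<inter> S' \<noteq> {}"
  have "S \<union> S' \<in> B \<or> S \<union> S' \<union> T \<in> B"
  proof -
    have "S \<in> B \<or> S \<union> T \<in> B" "S' \<in> B \<or> S' \<union> T \<in> B"
      using S by (auto simp: contraction_def)
    moreover have "S \<union> S' \<in> B" if "S \<in> B" "S' \<in> B" using that i union_mem by blast
    moreover have "S \<union> S' \<union> T \<in> B" if "S \<union> T \<in> B" "S' \<in> B"
    proof -
      have "(S \<union> T) \<union> S' \<in> B" using union_mem[OF that] i by blast
      then show ?thesis by (simp add: Un_ac)
    qed
    moreover have "S \<union> S' \<union> T \<in> B" if "S \<in> B" "S' \<union> T \<in> B"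
    proof -
      have "S \<union> (S' \<union> T) \<in> B" using union_mem[OF that] i by blast
      then show ?thesis by (simp add: Un_ac)
    qed
    moreover have "S \<union> S' \<union> T \<in> B" if "S \<union> T \<in> B" "S' \<union> T \<in> B"
    proof -
      have "(S \<union> T) \<union> (S' \<union> T) \<in> B" using union_mem[OF that] i by blast
      moreover have "(S \<union> T) \<union> (S' \<union> T) = S \<union> S' \<union> T" by auto
      ultimately show ?thesis by simp
    qed
    ultimately show ?thesis by blast
  qed
  then show "S \<union> S' \<in> contraction V B T"
    using S by (auto simp: contraction_def)
next
  fix S S' assume S: "S \<in> contraction V B T" "S' \<in> contraction V B T"
    and sub: "S \<subset> S'"
  have ne: "S \<noteq> {}" "S \<inter> T = {}" "S' \<inter> T = {}" "S' \<subseteq> V"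
    using S by (auto simp: contraction_def)
  have *: "\<exists>u\<in>S' - S. insert u S \<in> B \<or> insert u S \<union> T \<in> B"
  proof (cases "S \<union> T \<in> B")
    case True
    have "S' \<union> T \<in> B"
    proof (cases "S' \<in> B")
      case True
      have "S' \<union> (S \<union> T) \<in> B" using union_mem[OF True \<open>S \<union> T \<in> B\<close>] ne sub by blast
      moreover have "S' \<union> (S \<union> T) = S' \<union> T" using sub by auto
      ultimately show ?thesis by simp
    qed (use S in \<open>auto simp: contraction_def\<close>)
    moreover have "S \<union> T \<subset> S' \<union> T" using sub ne by blast
    ultimately obtain u where "u \<in> (S' \<union> T) - (S \<union> T)" "insert u (S \<union> T) \<in> B"
      using grow[OF True] by blast
    then show ?thesis by (intro bexI[of _ u]) auto
  next
    case False
    then have SB: "S \<in> B" using S by (auto simp: contraction_def)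
    show ?thesis
    proof (cases "S' \<in> B")
      case True
      then show ?thesis using grow[OF SB True sub] by auto
    next
      case F: False
      then have "S' \<union> T \<in> B" using S by (auto simp: contraction_def)
      moreover have "S \<subset> S' \<union> T" using sub by auto
      ultimately obtain u where u: "u \<in> (S' \<union> T) - S" "insert u S \<in> B" using grow[OF SB] by blast
      have "u \<notin> T"
      proof
        assume "u \<in> T"
        then have "T \<union> S \<in> B" using union_absorb[OF T(1) SB _ u(2)] by blast
        then show False using False by (simp add: Un_commute)
      qed
      then show ?thesis using u by auto
    qed
  qed
  then obtain u where u: "u \<in> S' - S" "insert u S \<in> B \<or> insert u S \<union> T \<in> B" by blast
  then have "insert u S \<subseteq> V - T" using S ne sub by blast
  then have "insert u S \<in> contraction V B T" using u by (simp add: contraction_def)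
  then show "\<exists>u\<in>S' - S. insert u S \<in> contraction V B T" using u by blast
qed (auto simp: contraction_def)

end

section \<open>Nested sets through a fixed member\<close>

text \<open>
  The homogeneous face polynomial: a nested set \<open>N\<close> stands for a face of dimension
  \<open>card V - card N\<close>.  With \<open>a = \<alpha>\<close> this is the polynomial \<open>F\<close>, with \<open>a = \<alpha> - t\<close> it is \<open>H\<close>; the
  recursion is proved once for both.
\<close>
definition face_sum :: "'a::comm_ring_1 \<Rightarrow> 'a \<Rightarrow> 'v set \<Rightarrow> 'v set set \<Rightarrow> 'a" where
  "face_sum a t V B = (\<Sum>N\<in>nested_sets V B. a ^ (card V - card N) * t ^ (card N - 1))"

text \<open>
  The inverse of \<open>S \<mapsto> S - T\<close> on the members of a nested set through \<open>T\<close> that are not contained in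
  \<open>T\<close>: such a member either contains \<open>T\<close> or is far from it, and \<open>B\<close> tells which.
\<close>
definition uncontract :: "'v set set \<Rightarrow> 'v set \<Rightarrow> 'v set \<Rightarrow> 'v set" where
  "uncontract B T U = (if U \<union> T \<in> B then U \<union> T else U)"

context accessible_building_set
begin

lemma nested_trace_restrict:
  assumes N: "N \<in> nested_sets V B" and T: "T \<in> N"
  shows "N \<inter> Pow T \<in> nested_sets T (restriction B T)"
proof (rule nested_setsI)
  show "N \<inter> Pow T \<subseteq> restriction B T"
    using nested_setsD(1)[OF N] by (auto simp: restriction_def)
  show "T \<in> N \<inter> Pow T" using T by auto
next
  fix S S' assume "S \<in> N \<inter> Pow T" "S' \<in> N \<inter> Pow T" "S \<union> S' \<in> restriction B T"
  then show "S \<subseteq> S' \<or> S' \<subseteq> S"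
    using nested_setsD(3)[OF N, of S S'] by (auto simp: restriction_def)
qed

lemma nested_beside:
  assumes N: "N \<in> nested_sets V B" and T: "T \<in> N" and S: "S \<in> N" "\<not> S \<subseteq> T"
  shows "T \<subseteq> S \<or> (S \<inter> T = {} \<and> S \<union> T \<notin> B)"
  using nested_setsD(3)[OF N S(1) T] nested_comparable[OF N S(1) T] S(2) by blast

lemma uncontract_diff:
  assumes N: "N \<in> nested_sets V B" and T: "T \<in> N" and S: "S \<in> N" "\<not> S \<subseteq> T"
  shows "uncontract B T (S - T) = S"
proof -
  have "S \<in> B" using nested_setsD(1)[OF N] S by auto
  consider "T \<subseteq> S" | "S \<inter> T = {}" "S \<union> T \<notin> B" using nested_beside[OF assms] by auto
  then show ?thesis
  proof cases
    case 1
    then have "S - T \<union> T = S" by auto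
    then show ?thesis using \<open>S \<in> B\<close> by (simp add: uncontract_def)
  next
    case 2
    then have "S - T = S" by auto
    then show ?thesis using 2 by (simp add: uncontract_def)
  qed
qed

text \<open>
  The delicate case of nestedness is that of two members apart from \<open>T\<close> whose union together with \<open>T\<close>
  is in \<open>B\<close>.  Then \<open>grow\<close> extends \<open>T\<close> by a vertex of one of them, which therefore is not apart from
  \<open>T\<close>.
\<close>
lemma nested_trace_contract:
  assumes N: "N \<in> nested_sets V B" and T: "T \<in> N" "T \<noteq> V"
  shows "(\<lambda>S. S - T) ` (N - Pow T) \<in> nested_sets (V - T) (contraction V B T)"
proof (rule nested_setsI)
  have NB: "\<And>S. S \<in> N \<Longrightarrow> S \<in> B" using nested_setsD(1)[OF N] by auto
  have TB: "T \<in> B" using NB T by auto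
  show "(\<lambda>S. S - T) ` (N - Pow T) \<subseteq> contraction V B T"
  proof
    fix U assume "U \<in> (\<lambda>S. S - T) ` (N - Pow T)"
    then obtain S where S: "S \<in> N" "\<not> S \<subseteq> T" "U = S - T" by auto
    have "uncontract B T U \<in> B" using uncontract_diff[OF N T(1) S(1,2)] S NB by auto
    then have "U \<in> B \<or> U \<union> T \<in> B" by (auto simp: uncontract_def split: if_splits)
    moreover have "U \<noteq> {}" "U \<subseteq> V - T" using S subset_V[OF NB[OF S(1)]] by auto
    ultimately show "U \<in> contraction V B T" by (simp add: contraction_def)
  qed
  show "V - T \<in> (\<lambda>S. S - T) ` (N - Pow T)"
    using nested_setsD(2)[OF N] T subset_V[OF TB] by auto
next
  have NB: "\<And>S. S \<in> N \<Longrightarrow> S \<in> B" using nested_setsD(1)[OF N] by auto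
  have TB: "T \<in> B" using NB T by auto
  fix U U' assume "U \<in> (\<lambda>S. S - T) ` (N - Pow T)" "U' \<in> (\<lambda>S. S - T) ` (N - Pow T)"
    and un: "U \<union> U' \<in> contraction V B T"
  then obtain S S' where S: "S \<in> N" "\<not> S \<subseteq> T" "U = S - T"
    and S': "S' \<in> N" "\<not> S' \<subseteq> T" "U' = S' - T" by auto
  have "S \<union> S' \<in> B"
  proof (cases "T \<subseteq> S \<or> T \<subseteq> S'")
    case True
    have *: "R \<union> R' \<in> B"
      if R: "T \<subseteq> R" "R \<in> B" "\<not> R \<subseteq> T" and u: "(R - T) \<union> (R' - T) \<in> B \<or> (R - T) \<union> (R' - T) \<union> T \<in> B"
        and R': "R' \<in> B" for R R'
      using u
    proof
      assume "(R - T) \<union> (R' - T) \<in> B"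
      then have "R \<union> ((R - T) \<union> (R' - T)) \<in> B"
        using R \<open>(R - T) \<union> (R' - T) \<in> B\<close> by (intro union_mem[of R]) auto
      moreover have "R \<union> ((R - T) \<union> (R' - T)) = R \<union> R'" using R by auto
      ultimately show ?thesis by simp
    next
      assume "(R - T) \<union> (R' - T) \<union> T \<in> B"
      moreover have "(R - T) \<union> (R' - T) \<union> T = R \<union> R'" using R by auto
      ultimately show ?thesis by simp
    qed
    have u: "(S - T) \<union> (S' - T) \<in> B \<or> (S - T) \<union> (S' - T) \<union> T \<in> B"
      using un S S' by (simp add: contraction_def)
    then have u': "(S' - T) \<union> (S - T) \<in> B \<or> (S' - T) \<union> (S - T) \<union> T \<in> B"
      by (simp add: Un_commute)
    show ?thesis using True *[of S S'] *[of S' S] u u' S S' NB by (auto simp: Un_commute)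
  next
    case False
    then have d: "S \<inter> T = {}" "S \<union> T \<notin> B" "S' \<inter> T = {}" "S' \<union> T \<notin> B"
      using nested_beside[OF N T(1) S(1,2)] nested_beside[OF N T(1) S'(1,2)] by auto
    then have "U = S" "U' = S'" using S S' by auto
    then have "S \<union> S' \<in> B \<or> S \<union> S' \<union> T \<in> B" using un by (simp add: contraction_def)
    moreover have "S \<union> S' \<union> T \<notin> B"
    proof
      assume "S \<union> S' \<union> T \<in> B"
      moreover have "T \<subset> S \<union> S' \<union> T" using d S by auto
      ultimately obtain u where u: "u \<in> S \<union> S' \<union> T - T" "insert u T \<in> B" using grow[OF TB] by blast
      then consider "u \<in> S" | "u \<in> S'" by auto
      then show False
        using d union_absorb[OF NB[OF S(1)] TB _ u(2)] union_absorb[OF NB[OF S'(1)] TB _ u(2)]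
        by cases auto
    qed
    ultimately show ?thesis by auto
  qed
  then have "S \<subseteq> S' \<or> S' \<subseteq> S" using nested_setsD(3)[OF N S(1) S'(1)] by auto
  then show "U \<subseteq> U' \<or> U' \<subseteq> U" using S S' by auto
qed

lemma nested_glue:
  assumes T: "T \<in> B" "T \<noteq> V"
    and N1: "N1 \<in> nested_sets T (restriction B T)"
    and N2: "N2 \<in> nested_sets (V - T) (contraction V B T)"
  shows "N1 \<union> uncontract B T ` N2 \<in> nested_sets V B"
proof (rule nested_setsI)
  have N2': "U \<noteq> {}" "U \<subseteq> V - T" "U \<in> B \<or> U \<union> T \<in> B" "uncontract B T U \<in> B"
    if "U \<in> N2" for U
    using nested_setsD(1)[OF N2] that by (auto simp: contraction_def uncontract_def)
  have N1': "S \<in> B" "S \<subseteq> T" if "S \<in> N1" for S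
    using nested_setsD(1)[OF N1] that by (auto simp: restriction_def)
  show "N1 \<union> uncontract B T ` N2 \<subseteq> B" using N1' N2' by auto
  have "V - T \<union> T = V" using subset_V[OF T(1)] by auto
  then have "uncontract B T (V - T) = V" using top_mem by (simp add: uncontract_def)
  then show "V \<in> N1 \<union> uncontract B T ` N2" using nested_setsD(2)[OF N2] by (auto simp: image_iff intro!: bexI[of _ "V - T"])
  have mono: "uncontract B T U \<subseteq> uncontract B T U'" if U: "U \<in> N2" "U' \<in> N2" "U \<subseteq> U'" for U U'
  proof (cases "U \<union> T \<in> B")
    case True
    have "U' \<union> T \<in> B"
    proof (cases "U' \<in> B")
      case t: True
      have "U' \<union> (U \<union> T) \<in> B" using union_mem[OF t True] U N2'[of U] by blast
      moreover have "U' \<union> (U \<union> T) = U' \<union> T" using U by auto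
      ultimately show ?thesis by simp
    qed (use N2'(3)[OF U(2)] in auto)
    then show ?thesis using U by (auto simp: uncontract_def)
  qed (use U in \<open>auto simp: uncontract_def\<close>)
  have mixed: "S \<subseteq> uncontract B T U" if "S \<in> N1" "U \<in> N2" "S \<union> uncontract B T U \<in> B" for S U
  proof (cases "U \<union> T \<in> B")
    case True
    then show ?thesis using N1'[OF that(1)] by (auto simp: uncontract_def)
  next
    case False
    then have "S \<union> U \<in> B" using that by (simp add: uncontract_def)
    then have "S \<union> U \<union> T \<in> B" using T N1'[OF that(1)] nonempty[of S] by (intro union_mem[of "S \<union> U"]) auto
    moreover have "S \<union> U \<union> T = U \<union> T" using N1'[OF that(1)] by auto
    ultimately show ?thesis using False by simp
  qed
  have top: "U \<subseteq> U' \<or> U' \<subseteq> U"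
    if U: "U \<in> N2" "U' \<in> N2" "uncontract B T U \<union> uncontract B T U' \<in> B" for U U'
  proof -
    have "uncontract B T U \<union> uncontract B T U' = U \<union> U' \<or>
          uncontract B T U \<union> uncontract B T U' = U \<union> U' \<union> T"
      by (auto simp: uncontract_def)
    then have "U \<union> U' \<in> B \<or> U \<union> U' \<union> T \<in> B" using U(3) by metis
    then have "U \<union> U' \<in> contraction V B T"
      using N2'[OF U(1)] N2'[OF U(2)] by (auto simp: contraction_def)
    then show ?thesis using nested_setsD(3)[OF N2 U(1,2)] by simp
  qed
  fix S S' assume S: "S \<in> N1 \<union> uncontract B T ` N2" "S' \<in> N1 \<union> uncontract B T ` N2"
    and un: "S \<union> S' \<in> B"
  from S consider "S \<in> N1" "S' \<in> N1" | U where "S \<in> N1" "U \<in> N2" "S' = uncontract B T U"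
    | U where "S' \<in> N1" "U \<in> N2" "S = uncontract B T U"
    | U U' where "U \<in> N2" "U' \<in> N2" "S = uncontract B T U" "S' = uncontract B T U'" by blast
  then show "S \<subseteq> S' \<or> S' \<subseteq> S"
  proof cases
    case 1
    then have "S \<union> S' \<in> restriction B T" using N1' un by (auto simp: restriction_def)
    then show ?thesis using nested_setsD(3)[OF N1 1] by simp
  next
    case 2 then show ?thesis using mixed un by auto
  next
    case 3 then show ?thesis using mixed[of S' U] un by (auto simp: Un_commute)
  next
    case 4 then show ?thesis using top[of U U'] mono[of U U'] mono[of U' U] un by auto
  qed
qed

text \<open>
  The faces in the facet of \<open>T\<close>: this facet is the product of the polytopes of the restriction to \<open>T\<close>
  and of the contraction by \<open>T\<close>.  The factor \<open>t\<close> accounts for the codimension of the facet.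
\<close>
lemma face_sum_through:
  fixes a t :: "'a::comm_ring_1"
  assumes T: "T \<in> B" "T \<noteq> V"
  shows "(\<Sum>N\<in>{N \<in> nested_sets V B. T \<in> N}. a ^ (card V - card N) * t ^ (card N - 1)) =
    t * face_sum a t T (restriction B T) * face_sum a t (V - T) (contraction V B T)"
proof -
  interpret R: accessible_building_set T "restriction B T" using restrict_accessible T by simp
  interpret C: accessible_building_set "V - T" "contraction V B T" using contract_accessible T by simp
  let ?NR = "nested_sets T (restriction B T)"
  let ?NC = "nested_sets (V - T) (contraction V B T)"
  define glue where "glue = (\<lambda>(N1, N2). N1 \<union> uncontract B T ` N2)"
  define split where "split = (\<lambda>N. (N \<inter> Pow T, (\<lambda>S. S - T) ` (N - Pow T)))"
  have lower: "N1 \<subseteq> Pow T" if "N1 \<in> ?NR" for N1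
    using nested_setsD(1)[OF that] by (auto simp: restriction_def)
  have upper: "U - T = U" "\<not> uncontract B T U \<subseteq> T" "uncontract B T U - T = U"
    if "N2 \<in> ?NC" "U \<in> N2" for U N2
    using nested_setsD(1)[OF that(1)] that(2) by (auto simp: contraction_def uncontract_def)
  have sg: "split (glue p) = p" if "p \<in> ?NR \<times> ?NC" for p
  proof -
    obtain N1 N2 where p: "p = (N1, N2)" "N1 \<in> ?NR" "N2 \<in> ?NC" using \<open>p \<in> ?NR \<times> ?NC\<close> by (cases p) auto
    have "(N1 \<union> uncontract B T ` N2) \<inter> Pow T = N1" using lower[OF p(2)] upper(2)[OF p(3)] by auto
    moreover have "(N1 \<union> uncontract B T ` N2) - Pow T = uncontract B T ` N2"
      using lower[OF p(2)] upper(2)[OF p(3)] by auto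
    moreover have "(\<lambda>S. S - T) ` uncontract B T ` N2 = N2"
      using upper(3)[OF p(3)] by (simp add: image_comp)
    ultimately show ?thesis by (simp add: split_def glue_def p)
  qed
  have card_glue: "card (glue p) = card (fst p) + card (snd p)" if "p \<in> ?NR \<times> ?NC" for p
  proof -
    obtain N1 N2 where p: "p = (N1, N2)" "N1 \<in> ?NR" "N2 \<in> ?NC" using \<open>p \<in> ?NR \<times> ?NC\<close> by (cases p) auto
    have "inj_on (uncontract B T) N2" by (rule inj_on_inverseI[where g = "\<lambda>S. S - T"]) (rule upper(3)[OF p(3)])
    then have "card (uncontract B T ` N2) = card N2" by (rule card_image)
    moreover have "N1 \<inter> uncontract B T ` N2 = {}" using lower[OF p(2)] upper(2)[OF p(3)] by auto
    ultimately show ?thesis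
      using R.finite_nested[OF p(2)] C.finite_nested[OF p(3)] by (simp add: glue_def p card_Un_disjoint)
  qed
  have "(\<Sum>N\<in>{N \<in> nested_sets V B. T \<in> N}. a ^ (card V - card N) * t ^ (card N - 1)) =
    (\<Sum>p\<in>?NR \<times> ?NC. t * ((a ^ (card T - card (fst p)) * t ^ (card (fst p) - 1)) *
       (a ^ (card (V - T) - card (snd p)) * t ^ (card (snd p) - 1))))"
  proof (rule sum.reindex_bij_witness[where i = glue and j = split])
    fix N assume "N \<in> {N \<in> nested_sets V B. T \<in> N}"
    then have N: "N \<in> nested_sets V B" "T \<in> N" by auto
    have "(\<lambda>S. uncontract B T (S - T)) ` (N - Pow T) = (\<lambda>S. S) ` (N - Pow T)"
      by (rule image_cong[OF refl]) (use uncontract_diff[OF N] in auto)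
    then show gs: "glue (split N) = N" by (auto simp: glue_def split_def image_comp comp_def)
    show sp: "split N \<in> ?NR \<times> ?NC"
      using nested_trace_restrict[OF N] nested_trace_contract[OF N T(2)] by (simp add: split_def)
    let ?N1 = "fst (split N)" and ?N2 = "snd (split N)"
    have s: "?N1 \<in> ?NR" "?N2 \<in> ?NC" using sp by auto
    have c: "card N = card ?N1 + card ?N2" using card_glue[OF sp] gs by simp
    have l1: "card ?N1 \<le> card T" and l2: "card ?N2 \<le> card (V - T)"
      using R.card_nested_le[OF s(1)] C.card_nested_le[OF s(2)] by auto
    have p1: "card ?N1 > 0" "card ?N2 > 0"
      using R.finite_nested[OF s(1)] C.finite_nested[OF s(2)] nested_setsD(2)[OF s(1)] nested_setsD(2)[OF s(2)]
      by (auto simp: card_gt_0_iff)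
    have "card V = card T + card (V - T)"
      using finite_V subset_V[OF T(1)] by (metis card_Diff_subset card_mono finite_subset le_add_diff_inverse)
    then have e1: "card V - card N = (card T - card ?N1) + (card (V - T) - card ?N2)"
      and e2: "card N - 1 = Suc ((card ?N1 - 1) + (card ?N2 - 1))" using c l1 l2 p1 by auto
    show "t * ((a ^ (card T - card ?N1) * t ^ (card ?N1 - 1)) *
       (a ^ (card (V - T) - card ?N2) * t ^ (card ?N2 - 1))) = a ^ (card V - card N) * t ^ (card N - 1)"
      unfolding e1 e2 by (simp add: power_add algebra_simps)
  next
    fix p assume p: "p \<in> ?NR \<times> ?NC"
    show "split (glue p) = p" using sg p by simp
    have "T \<in> glue p" using nested_setsD(2)[of "fst p"] p by (auto simp: glue_def)
    then show "glue p \<in> {N \<in> nested_sets V B. T \<in> N}" using nested_glue[OF T] p by (auto simp: glue_def)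
  qed
  also have "\<dots> = t * face_sum a t T (restriction B T) * face_sum a t (V - T) (contraction V B T)"
    unfolding face_sum_def mult.assoc sum_product sum.cartesian_product
    by (simp only: sum_distrib_left case_prod_beta mult.assoc)
  finally show ?thesis .
qed

end

section \<open>Deleting a vertex\<close>

text \<open>
  A simplicial vertex of a graph has the property \<open>delete_mem\<close>.
\<close>
locale deletable_vertex = accessible_building_set V B for V :: "'v set" and B +
  fixes v :: 'v
  assumes v_mem: "v \<in> V" and V_not_single: "V \<noteq> {v}"
    and delete_mem: "S \<in> B \<Longrightarrow> S \<noteq> {v} \<Longrightarrow> S - {v} \<in> B"
begin

abbreviation B' :: "'v set set" where
  "B' \<equiv> restriction B (V - {v})"

definition remove :: "'v set set \<Rightarrow> 'v set set" where
  "remove N = (\<lambda>S. S - {v}) ` N - {{}}"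

text \<open>
  The least member of \<open>N\<close> that contains \<open>v\<close>, without \<open>v\<close>.  It marks the place of \<open>v\<close> in the chain of those
  members \<open>T\<close> of \<open>remove N\<close> for which \<open>insert v T\<close> is in \<open>B\<close>.
\<close>
definition core :: "'v set set \<Rightarrow> 'v set" where
  "core N = \<Inter>{S \<in> N. v \<in> S} - {v}"

text \<open>
  The three ways to insert \<open>v\<close> into a nested set of \<open>V - {v}\<close>: below the whole chain, so that \<open>{v}\<close>
  becomes a member; into the part of \<open>T\<close>, so that the number of members is kept and the
  dimension of the face increases; or directly above \<open>T\<close>, so that \<open>T\<close> stays a member next to
  \<open>insert v T\<close>.
\<close>
definition add_bottom :: "'v set set \<Rightarrow> 'v set set" where
  "add_bottom N = insert {v} ((\<lambda>S. if insert v S \<in> B then insert v S else S) ` N)"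

definition add_merged :: "'v set set \<Rightarrow> 'v set \<Rightarrow> 'v set set" where
  "add_merged N T = (\<lambda>S. if T \<subseteq> S then insert v S else S) ` N"

definition add_above :: "'v set set \<Rightarrow> 'v set \<Rightarrow> 'v set set" where
  "add_above N T = insert T (add_merged N T)"

lemma insert_top: "insert v (V - {v}) = V"
  using v_mem by auto

lemma top': "V - {v} \<in> B"
  using delete_mem[OF top_mem V_not_single] .

sublocale del: accessible_building_set "V - {v}" "B'"
  by (rule restrict_accessible[OF top'])

lemma B'_iff: "S \<in> B' \<longleftrightarrow> S \<in> B \<and> v \<notin> S"
  using subset_V by (auto simp: restriction_def)

lemma delete_B': "S \<in> B \<Longrightarrow> S \<noteq> {v} \<Longrightarrow> S - {v} \<in> B'"
  using delete_mem by (simp add: B'_iff)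

lemma insert_union_mem:
  assumes "S \<in> B" "insert v T \<in> B" "T \<subseteq> S" "T \<noteq> {}"
  shows "insert v S \<in> B"
proof -
  have "S \<union> insert v T \<in> B" using assms by (intro union_mem) auto
  moreover have "S \<union> insert v T = insert v S" using assms by auto
  ultimately show ?thesis by simp
qed

text \<open>
  If the union of two trimmed members is in \<open>B\<close>, it meets both original members, so that the union of
  the originals is in \<open>B\<close> as well.
\<close>
lemma remove_nested:
  assumes N: "N \<in> nested_sets V B"
  shows "remove N \<in> nested_sets (V - {v}) B'"
proof (rule nested_setsI)
  have NB: "\<And>S. S \<in> N \<Longrightarrow> S \<in> B" using nested_setsD(1)[OF N] by auto
  have mem: "\<exists>S\<in>N. U = S - {v} \<and> S \<noteq> {v} \<and> U \<noteq> {}" if "U \<in> remove N" for U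
    using that by (auto simp: remove_def)
  show "remove N \<subseteq> B'"
  proof
    fix U assume "U \<in> remove N"
    then obtain S where "S \<in> N" "U = S - {v}" "S \<noteq> {v}" using mem by blast
    then show "U \<in> B'" using delete_B' NB by auto
  qed
  show "V - {v} \<in> remove N"
    using nested_setsD(2)[OF N] nonempty[OF top'] by (auto simp: remove_def)
  fix U U' assume U: "U \<in> remove N" "U' \<in> remove N" and un: "U \<union> U' \<in> B'"
  obtain S where S: "S \<in> N" "U = S - {v}" "U \<noteq> {}" using mem[OF U(1)] by blast
  obtain S' where S': "S' \<in> N" "U' = S' - {v}" "U' \<noteq> {}" using mem[OF U(2)] by blast
  have UU: "U \<union> U' \<in> B" using un by (simp add: B'_iff)
  have "S \<union> (U \<union> U') \<in> B" using S NB[OF S(1)] UU by (intro union_mem[of S]) auto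
  moreover have "S' \<union> (U \<union> U') \<in> B" using S' NB[OF S'(1)] UU by (intro union_mem[of S']) auto
  moreover have "S \<union> S' = S \<union> (U \<union> U') \<or> S \<union> S' = S' \<union> (U \<union> U')" using S S' by blast
  ultimately have "S \<union> S' \<in> B" by metis
  then show "U \<subseteq> U' \<or> U' \<subseteq> U" using nested_setsD(3)[OF N S(1) S'(1)] S S' by blast
qed

context
  fixes N' assumes N': "N' \<in> nested_sets (V - {v}) B'"
begin

lemma N'_mem: "S \<in> N' \<Longrightarrow> S \<in> B \<and> v \<notin> S \<and> S \<noteq> {}"
  using nested_setsD(1)[OF N'] B'_iff nonempty by auto

lemma N'_comparable: "S \<in> N' \<Longrightarrow> S' \<in> N' \<Longrightarrow> S \<union> S' \<in> B \<Longrightarrow> S \<subseteq> S' \<or> S' \<subseteq> S"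
  using nested_setsD(3)[OF N', of S S'] N'_mem[of S] N'_mem[of S'] by (simp add: B'_iff)

lemma remove_add_bottom: "remove (add_bottom N') = N'"
proof -
  have "(\<lambda>S. S - {v}) ` (\<lambda>S. if insert v S \<in> B then insert v S else S) ` N' = (\<lambda>S. S) ` N'"
    unfolding image_image by (rule image_cong[OF refl]) (use N'_mem in auto)
  then show ?thesis using N'_mem by (auto simp: remove_def add_bottom_def)
qed

lemma remove_add_merged: "remove (add_merged N' T) = N'"
proof -
  have "(\<lambda>S. S - {v}) ` (\<lambda>S. if T \<subseteq> S then insert v S else S) ` N' = (\<lambda>S. S) ` N'"
    unfolding image_image by (rule image_cong[OF refl]) (use N'_mem in auto)
  then show ?thesis using N'_mem by (auto simp: remove_def add_merged_def)
qed

lemma remove_add_above: "T \<in> N' \<Longrightarrow> remove (add_above N' T) = N'"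
proof -
  assume T: "T \<in> N'"
  have "remove (add_above N' T) = remove {T} \<union> remove (add_merged N' T)"
    by (auto simp: remove_def add_above_def)
  also have "\<dots> = N'" using T N'_mem[OF T] by (auto simp: remove_add_merged) (auto simp: remove_def)
  finally show ?thesis .
qed

lemma add_bottom_nested: "add_bottom N' \<in> nested_sets V B"
proof (rule nested_setsI)
  show "add_bottom N' \<subseteq> B" using N'_mem singleton_mem[OF v_mem] by (auto simp: add_bottom_def)
  show "V \<in> add_bottom N'"
    using nested_setsD(2)[OF N'] insert_top top_mem
    by (auto simp: add_bottom_def image_iff intro!: bexI[of _ "V - {v}"])
  define f where "f = (\<lambda>S. if insert v S \<in> B then insert v S else S)"
  have pair: "f S \<subseteq> f S' \<or> f S' \<subseteq> f S" if S: "S \<in> N'" "S' \<in> N'" and un: "f S \<union> f S' \<in> B" for S S'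
  proof -
    have "(f S \<union> f S') - {v} = S \<union> S'" using N'_mem S by (auto simp: f_def)
    moreover have "f S \<union> f S' \<noteq> {v}" using N'_mem S by (auto simp: f_def split: if_splits)
    ultimately have "S \<union> S' \<in> B" using delete_mem[OF un] by simp
    then have "S \<subseteq> S' \<or> S' \<subseteq> S" using N'_comparable S by blast
    moreover have "f R \<subseteq> f R'" if "R \<in> N'" "R' \<in> N'" "R \<subseteq> R'" for R R'
      using insert_union_mem[of R' R] N'_mem that by (auto simp: f_def)
    ultimately show ?thesis using S by blast
  qed
  have bottom: "{v} \<subseteq> f S" if "S \<in> N'" "{v} \<union> f S \<in> B" for S
    using that by (auto simp: f_def split: if_splits)
  fix S S' assume "S \<in> add_bottom N'" "S' \<in> add_bottom N'" and un: "S \<union> S' \<in> B"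
  then consider "S = {v}" "S' = {v}" | R where "S = {v}" "R \<in> N'" "S' = f R"
    | R where "S' = {v}" "R \<in> N'" "S = f R" | R R' where "R \<in> N'" "R' \<in> N'" "S = f R" "S' = f R'"
    unfolding add_bottom_def f_def by blast
  then show "S \<subseteq> S' \<or> S' \<subseteq> S"
  proof cases
    case 2 then show ?thesis using bottom[of R] un by auto
  next
    case 3 then show ?thesis using bottom[of R] un by (auto simp: Un_commute)
  next
    case 4 then show ?thesis using pair un by auto
  qed auto
qed

lemma add_above_merged_nested:
  assumes T: "T \<in> N'" "insert v T \<in> B"
  shows "add_above N' T \<in> nested_sets V B" and "add_merged N' T \<in> nested_sets V B"
proof -
  define f where "f = (\<lambda>S. if T \<subseteq> S then insert v S else S)"
  have fB: "f S \<in> B" if "S \<in> N'" for S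
    using insert_union_mem[of S T] T N'_mem[OF that] N'_mem[OF T(1)] by (auto simp: f_def)
  have top: "V \<in> add_merged N' T"
  proof -
    have "T \<subseteq> V - {v}" using N'_mem[OF T(1)] subset_V[of T] by auto
    then have "f (V - {v}) = V" using insert_top by (simp add: f_def)
    moreover have "f (V - {v}) \<in> f ` N'" using nested_setsD(2)[OF N'] by (rule imageI)
    ultimately show ?thesis by (simp add: add_merged_def f_def)
  qed
  have pair: "f S \<subseteq> f S' \<or> f S' \<subseteq> f S" if S: "S \<in> N'" "S' \<in> N'" and un: "f S \<union> f S' \<in> B" for S S'
  proof -
    have "(f S \<union> f S') - {v} = S \<union> S'" using N'_mem S by (auto simp: f_def)
    moreover have "f S \<union> f S' \<noteq> {v}" using N'_mem[OF S(1)] by (auto simp: f_def split: if_splits)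
    ultimately have "S \<union> S' \<in> B" using delete_mem[OF un] by simp
    then have "S \<subseteq> S' \<or> S' \<subseteq> S" using N'_comparable S by blast
    then show ?thesis by (auto simp: f_def)
  qed
  have low: "T \<subseteq> f S \<or> f S \<subseteq> T" if S: "S \<in> N'" and un: "T \<union> f S \<in> B" for S
  proof (cases "T \<subseteq> S")
    case False
    then show ?thesis using N'_comparable[of T S] T S un by (auto simp: f_def)
  qed (auto simp: f_def)
  show "add_above N' T \<in> nested_sets V B"
  proof (rule nested_setsI)
    show "add_above N' T \<subseteq> B"
      using fB N'_mem[OF T(1)] unfolding add_above_def add_merged_def f_def[symmetric] by blast
    show "V \<in> add_above N' T" using top by (auto simp: add_above_def)
    fix S S' assume "S \<in> add_above N' T" "S' \<in> add_above N' T" and un: "S \<union> S' \<in> B"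
    then consider "S = T" "S' = T" | R where "S = T" "R \<in> N'" "S' = f R"
      | R where "S' = T" "R \<in> N'" "S = f R" | R R' where "R \<in> N'" "R' \<in> N'" "S = f R" "S' = f R'"
      unfolding add_above_def add_merged_def f_def by blast
    then show "S \<subseteq> S' \<or> S' \<subseteq> S"
    proof cases
      case 2 then show ?thesis using low[of R] un by auto
    next
      case 3 then show ?thesis using low[of R] un by (auto simp: Un_commute)
    next
      case 4 then show ?thesis using pair un by auto
    qed auto
  qed
  then show "add_merged N' T \<in> nested_sets V B"
    using top by (auto simp: add_above_def nested_sets_def)
qed

lemma core_add_merged:
  assumes T: "T \<in> N'"
  shows "core (add_merged N' T) = T" "core (add_above N' T) = T"
proof -
  have a: "{S \<in> add_merged N' T. v \<in> S} = insert v ` {S \<in> N'. T \<subseteq> S}"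
    using N'_mem by (auto simp: add_merged_def)
  have b: "{S \<in> add_above N' T. v \<in> S} = {S \<in> add_merged N' T. v \<in> S}"
    using N'_mem[OF T] by (auto simp: add_above_def)
  have "\<Inter>(insert v ` {S \<in> N'. T \<subseteq> S}) = insert v T" using T by auto
  then show "core (add_merged N' T) = T" "core (add_above N' T) = T"
    using N'_mem[OF T] by (auto simp: core_def a b)
qed

lemma card_adds:
  shows "card (add_bottom N') = Suc (card N')"
    and "card (add_merged N' T) = card N'"
    and "T \<in> N' \<Longrightarrow> card (add_above N' T) = Suc (card N')"
proof -
  have fin: "finite N'" using del.finite_nested[OF N'] .
  have "card ((\<lambda>S. if insert v S \<in> B then insert v S else S) ` N') = card N'"
    by (rule card_image, rule inj_on_inverseI[where g = "\<lambda>S. S - {v}"]) (use N'_mem in auto)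
  moreover have "{v} \<notin> (\<lambda>S. if insert v S \<in> B then insert v S else S) ` N'"
    using N'_mem by (auto split: if_splits)
  ultimately show "card (add_bottom N') = Suc (card N')" using fin by (simp add: add_bottom_def)
  show m: "card (add_merged N' T) = card N'" unfolding add_merged_def
    by (rule card_image, rule inj_on_inverseI[where g = "\<lambda>S. S - {v}"]) (use N'_mem in auto)
  assume T: "T \<in> N'"
  have "T \<notin> add_merged N' T" using N'_mem[OF T] by (auto simp: add_merged_def)
  moreover have "finite (add_merged N' T)" using fin by (simp add: add_merged_def)
  ultimately show "card (add_above N' T) = Suc (card N')" using m by (simp add: add_above_def)
qed

lemma singleton_adds:
  shows "{v} \<in> add_bottom N'"
    and "{v} \<notin> add_merged N' T"
    and "T \<in> N' \<Longrightarrow> T \<notin> add_merged N' T"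
    and "T \<in> N' \<Longrightarrow> {v} \<notin> add_above N' T"
    and "T \<in> add_above N' T"
  using N'_mem by (auto simp: add_bottom_def add_merged_def add_above_def)

end

lemma add_bottom_remove:
  assumes N: "N \<in> nested_sets V B" and v: "{v} \<in> N"
  shows "add_bottom (remove N) = N"
proof -
  have NB: "\<And>S. S \<in> N \<Longrightarrow> S \<in> B" using nested_setsD(1)[OF N] by auto
  have r: "(if insert v (S - {v}) \<in> B then insert v (S - {v}) else S - {v}) = S" if S: "S \<in> N" "S \<noteq> {v}" for S
  proof (cases "v \<in> S")
    case True
    then have "insert v (S - {v}) = S" by auto
    then show ?thesis using NB[OF S(1)] by simp
  next
    case False
    have "insert v S \<notin> B"
    proof
      assume "insert v S \<in> B"
      then have "{v} \<subseteq> S \<or> S \<subseteq> {v}" using nested_setsD(3)[OF N v S(1)] by auto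
      then show False using False S(2) nonempty[OF NB[OF S(1)]] by auto
    qed
    then show ?thesis using False by simp
  qed
  have "remove N = (\<lambda>S. S - {v}) ` (N - {{v}})"
    using NB nonempty by (auto simp: remove_def)
  then have "(\<lambda>S. if insert v S \<in> B then insert v S else S) ` remove N = (\<lambda>S. S) ` (N - {{v}})"
    by (simp only: image_image) (rule image_cong[OF refl], use r in auto)
  then show ?thesis using v by (auto simp: add_bottom_def)
qed

text \<open>
  The members of \<open>N\<close> that contain \<open>v\<close> form a chain, so the intersection in the definition of \<open>core\<close> is
  one of them.
\<close>
lemma core_props:
  assumes N: "N \<in> nested_sets V B" and v: "{v} \<notin> N"
  shows "insert v (core N) \<in> N" "core N \<in> remove N" "v \<notin> core N"
    "\<And>S. S \<in> N \<Longrightarrow> v \<in> S \<Longrightarrow> insert v (core N) \<subseteq> S"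
proof -
  let ?C = "{S \<in> N. v \<in> S}"
  have "finite ?C" using finite_nested[OF N] by simp
  moreover have "?C \<noteq> {}" using nested_setsD(2)[OF N] v_mem by blast
  ultimately have "\<exists>S\<in>?C. \<forall>S'\<in>?C. S' \<subseteq> S \<longrightarrow> S = S'" by (rule finite_has_minimal)
  then obtain S where S: "S \<in> ?C" "\<And>S'. S' \<in> ?C \<Longrightarrow> S' \<subseteq> S \<Longrightarrow> S = S'" by blast
  have "S \<subseteq> S'" if "S' \<in> ?C" for S'
  proof -
    have "S \<subseteq> S' \<or> S' \<subseteq> S" by (rule nested_comparable[OF N]) (use S(1) that in auto)
    then show ?thesis using S(2)[OF that] by auto
  qed
  then have I: "\<Inter>?C = S" using S(1) by blast
  have ins: "insert v (core N) = S" using S(1) by (auto simp: core_def I)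
  show "insert v (core N) \<in> N" using ins S by simp
  show "v \<notin> core N" by (simp add: core_def)
  have "core N = S - {v}" by (simp add: core_def I)
  moreover have "S \<noteq> {v}" using S v by auto
  ultimately show "core N \<in> remove N" using S(1) by (auto simp: remove_def)
  show "insert v (core N) \<subseteq> S'" if "S' \<in> N" "v \<in> S'" for S' using ins I that by blast
qed

text \<open>
  Apart from the core itself, a member that contains the core without \<open>v\<close> must contain \<open>v\<close>: otherwise
  its union with the least member through \<open>v\<close> would be in \<open>B\<close>.  So \<open>N\<close> can be recovered
  from \<open>remove N\<close>, its core, and the information whether the core is a member.
\<close>
lemma add_merged_remove:
  assumes N: "N \<in> nested_sets V B" and v: "{v} \<notin> N"
  shows "add_merged (remove N) (core N) \<union> (N \<inter> {core N}) = N" "core N \<notin> add_merged (remove N) (core N)"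
proof -
  note c = core_props[OF N v]
  have NB: "\<And>S. S \<in> N \<Longrightarrow> S \<in> B" using nested_setsD(1)[OF N] by auto
  have r: "(if core N \<subseteq> S - {v} then insert v (S - {v}) else S - {v}) = S" if S: "S \<in> N" "S \<noteq> core N" for S
  proof (cases "v \<in> S")
    case True
    then show ?thesis using c(4)[OF S(1) True] c(3) by auto
  next
    case False
    have "\<not> core N \<subseteq> S"
    proof
      assume sub: "core N \<subseteq> S"
      have "core N \<noteq> {}" using c(1) v by auto
      then have "S \<union> insert v (core N) \<in> B" using NB[OF S(1)] NB[OF c(1)] sub by (intro union_mem) auto
      then have "S \<subseteq> insert v (core N) \<or> insert v (core N) \<subseteq> S"
        using nested_setsD(3)[OF N S(1) c(1)] by blast
      then show False using sub False S(2) by blast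
    qed
    then show ?thesis using False by auto
  qed
  have rem: "remove N = (\<lambda>S. S - {v}) ` (N - {core N})"
  proof -
    have "S - {v} \<noteq> {}" if "S \<in> N" for S
      using that v nonempty[OF NB[OF that]] by (metis Diff_eq_empty_iff subset_singletonD)
    then have "remove N = (\<lambda>S. S - {v}) ` N" unfolding remove_def by blast
    moreover have "core N \<in> (\<lambda>S. S - {v}) ` (N - {core N})"
      using c(1,3) by (intro image_eqI[of _ _ "insert v (core N)"]) auto
    moreover have "core N - {v} = core N" using c(3) by simp
    ultimately have "S - {v} \<in> (\<lambda>S. S - {v}) ` (N - {core N})" if "S \<in> N" for S
      using that by (cases "S = core N") (simp, blast)
    then show ?thesis unfolding \<open>remove N = (\<lambda>S. S - {v}) ` N\<close> by blast
  qed
  have "(\<lambda>S. if core N \<subseteq> S then insert v S else S) ` remove N = (\<lambda>S. S) ` (N - {core N})"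
    unfolding rem by (simp only: image_image) (rule image_cong[OF refl], use r in auto)
  then have e: "add_merged (remove N) (core N) = N - {core N}" by (simp add: add_merged_def)
  show "add_merged (remove N) (core N) \<union> (N \<inter> {core N}) = N" "core N \<notin> add_merged (remove N) (core N)"
    unfolding e by auto
qed

text \<open>
  The nested sets of \<open>V\<close> fall into three classes according to the way in which \<open>v\<close> was inserted.  Each
  class is in bijection with nested sets of \<open>V - {v}\<close>, for the last two together with a place \<open>T\<close> in the
  chain.
\<close>
lemma face_sum_delete_chain:
  fixes a t :: "'a::comm_ring_1"
  shows "face_sum a t V B = t * face_sum a t (V - {v}) B' +
    (a + t) * (\<Sum>T\<in>{T \<in> B'. insert v T \<in> B}. \<Sum>N\<in>{N \<in> nested_sets (V - {v}) B'. T \<in> N}.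
      a ^ (card (V - {v}) - card N) * t ^ (card N - 1))"
proof -
  let ?NV = "nested_sets V B" and ?N' = "nested_sets (V - {v}) B'"
  define w where "w = (\<lambda>N :: 'v set set. a ^ (card V - card N) * t ^ (card N - 1))"
  define w' where "w' = (\<lambda>N :: 'v set set. a ^ (card (V - {v}) - card N) * t ^ (card N - 1))"
  define P where "P = (SIGMA T:{T \<in> B'. insert v T \<in> B}. {N \<in> ?N'. T \<in> N})"
  define X0 where "X0 = {N \<in> ?NV. {v} \<in> N}"
  define X1 where "X1 = {N \<in> ?NV. {v} \<notin> N \<and> core N \<notin> N}"
  define X2 where "X2 = {N \<in> ?NV. {v} \<notin> N \<and> core N \<in> N}"
  have cV: "card V = Suc (card (V - {v}))" using card.remove[OF finite_V v_mem] .
  have pos: "card N > 0" if "N \<in> ?N'" for N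
    using del.finite_nested[OF that] nested_setsD(2)[OF that] by (auto simp: card_gt_0_iff)
  have le: "card N \<le> card (V - {v})" if "N \<in> ?N'" for N using del.card_nested_le[OF that] .
  have t_w': "a ^ (card (V - {v}) - card N) * t ^ card N = t * w' N" if "N \<in> ?N'" for N
  proof -
    obtain k where "card N = Suc k" using pos[OF \<open>N \<in> ?N'\<close>] gr0_implies_Suc by blast
    then show ?thesis by (simp add: w'_def algebra_simps)
  qed
  have a_w': "a ^ (Suc (card (V - {v})) - card N) * t ^ (card N - 1) = a * w' N" if "N \<in> ?N'" for N
    using le[OF that] by (simp add: w'_def Suc_diff_le algebra_simps)
  have s0: "sum w X0 = (\<Sum>N\<in>?N'. t * w' N)"
  proof (rule sum.reindex_bij_witness[where i = add_bottom and j = remove])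
    fix N assume "N \<in> X0" then have N: "N \<in> ?NV" "{v} \<in> N" by (auto simp: X0_def)
    show "add_bottom (remove N) = N" using add_bottom_remove N by simp
    show r: "remove N \<in> ?N'" using remove_nested N by simp
    have "card N = Suc (card (remove N))" using card_adds(1)[OF r] add_bottom_remove[OF N] by simp
    then show "t * w' (remove N) = w N" by (simp add: w_def cV t_w'[OF r])
  next
    fix N assume N: "N \<in> ?N'"
    show "remove (add_bottom N) = N" using remove_add_bottom[OF N] .
    show "add_bottom N \<in> X0" using add_bottom_nested[OF N] singleton_adds(1)[OF N] by (simp add: X0_def)
  qed
  have Pmem: "(core N, remove N) \<in> P" if "N \<in> ?NV" "{v} \<notin> N" for N
  proof -
    note c = core_props[OF that]
    have r: "remove N \<in> ?N'" using remove_nested that by simp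
    have "core N \<in> B'" using nested_setsD(1)[OF r] c(2) by blast
    moreover have "insert v (core N) \<in> B" using nested_setsD(1)[OF that(1)] c(1) by blast
    ultimately show ?thesis using c r by (auto simp: P_def)
  qed
  have s1: "sum w X1 = (\<Sum>p\<in>P. a * w' (snd p))"
  proof (rule sum.reindex_bij_witness[where i = "\<lambda>p. add_merged (snd p) (fst p)" and j = "\<lambda>N. (core N, remove N)"])
    fix N assume "N \<in> X1" then have N: "N \<in> ?NV" "{v} \<notin> N" "core N \<notin> N" by (auto simp: X1_def)
    show e: "add_merged (snd (core N, remove N)) (fst (core N, remove N)) = N"
      using add_merged_remove(1)[OF N(1,2)] N(3) by auto
    show "(core N, remove N) \<in> P" using Pmem N by simp
    have r: "remove N \<in> ?N'" using remove_nested N by simp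
    have "card N = card (remove N)" using card_adds(2)[OF r, of "core N"] e by simp
    then show "a * w' (snd (core N, remove N)) = w N" using a_w'[OF r] by (simp add: w_def cV)
  next
    fix p assume p: "p \<in> P"
    then have q: "snd p \<in> ?N'" "fst p \<in> snd p" "insert v (fst p) \<in> B" by (auto simp: P_def)
    show "(core (add_merged (snd p) (fst p)), remove (add_merged (snd p) (fst p))) = p"
      using core_add_merged(1)[OF q(1,2)] remove_add_merged[OF q(1)] by simp
    show "add_merged (snd p) (fst p) \<in> X1"
      using add_above_merged_nested(2)[OF q] singleton_adds[OF q(1)] core_add_merged(1)[OF q(1,2)] q
      by (simp add: X1_def)
  qed
  have s2: "sum w X2 = (\<Sum>p\<in>P. t * w' (snd p))"
  proof (rule sum.reindex_bij_witness[where i = "\<lambda>p. add_above (snd p) (fst p)" and j = "\<lambda>N. (core N, remove N)"])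
    fix N assume "N \<in> X2" then have N: "N \<in> ?NV" "{v} \<notin> N" "core N \<in> N" by (auto simp: X2_def)
    show e: "add_above (snd (core N, remove N)) (fst (core N, remove N)) = N"
      using add_merged_remove(1)[OF N(1,2)] N(3) by (auto simp: add_above_def)
    show "(core N, remove N) \<in> P" using Pmem N by simp
    have r: "remove N \<in> ?N'" using remove_nested N by simp
    have "card N = Suc (card (remove N))" using card_adds(3)[OF r core_props(2)[OF N(1,2)]] e by simp
    then show "t * w' (snd (core N, remove N)) = w N" using t_w'[OF r] by (simp add: w_def cV)
  next
    fix p assume p: "p \<in> P"
    then have q: "snd p \<in> ?N'" "fst p \<in> snd p" "insert v (fst p) \<in> B" by (auto simp: P_def)
    show "(core (add_above (snd p) (fst p)), remove (add_above (snd p) (fst p))) = p"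
      using core_add_merged(2)[OF q(1,2)] remove_add_above[OF q(1,2)] by simp
    show "add_above (snd p) (fst p) \<in> X2"
      using add_above_merged_nested(1)[OF q] singleton_adds[OF q(1)] core_add_merged(2)[OF q(1,2)] q
      by (simp add: X2_def)
  qed
  have fin: "finite ?NV" by (rule finite_nested_sets)
  have "?NV = X0 \<union> (X1 \<union> X2)" "X0 \<inter> (X1 \<union> X2) = {}" "X1 \<inter> X2 = {}" by (auto simp: X0_def X1_def X2_def)
  moreover have "finite X0" "finite X1" "finite X2" using fin by (auto simp: X0_def X1_def X2_def)
  ultimately have "sum w ?NV = sum w X0 + (sum w X1 + sum w X2)" by (simp add: sum.union_disjoint)
  moreover have "sum w ?NV = face_sum a t V B" by (simp add: face_sum_def w_def)
  moreover have "(\<Sum>N\<in>?N'. t * w' N) = t * face_sum a t (V - {v}) B'" by (simp add: face_sum_def w'_def sum_distrib_left)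
  moreover have "(\<Sum>p\<in>P. a * w' (snd p)) + (\<Sum>p\<in>P. t * w' (snd p)) = (a + t) * (\<Sum>p\<in>P. w' (snd p))"
    by (simp add: sum_distrib_left distrib_right sum.distrib)
  moreover have "(\<Sum>p\<in>P. w' (snd p)) = (\<Sum>T\<in>{T \<in> B'. insert v T \<in> B}. \<Sum>N\<in>{N \<in> ?N'. T \<in> N}. w' N)"
    unfolding P_def using del.finite_B del.finite_nested_sets by (subst sum.Sigma) (auto simp: case_prod_beta)
  ultimately show ?thesis using s0 s1 s2 by (simp add: w'_def)
qed

text \<open>
  The term \<open>T = V - {v}\<close> of the preceding sum runs over all nested sets, which turns the coefficient \<open>t\<close> into
  \<open>a + 2 t\<close>.  For \<open>a = \<alpha> - t\<close> the coefficients are \<open>\<alpha> + t\<close> and \<open>\<alpha> t\<close>.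
\<close>
theorem face_sum_delete:
  fixes a t :: "'a::comm_ring_1"
  shows "face_sum a t V B = (a + 2 * t) * face_sum a t (V - {v}) B' +
    (a + t) * t * (\<Sum>T\<in>{T \<in> B'. insert v T \<in> B \<and> T \<noteq> V - {v}}.
      face_sum a t T (restriction B' T) * face_sum a t (V - {v} - T) (contraction (V - {v}) B' T))"
proof -
  let ?w = "\<lambda>N. a ^ (card (V - {v}) - card N) * t ^ (card N - 1)"
  let ?g = "\<lambda>T. \<Sum>N\<in>{N \<in> nested_sets (V - {v}) B'. T \<in> N}. ?w N"
  let ?I = "{T \<in> B'. insert v T \<in> B \<and> T \<noteq> V - {v}}"
  have I: "{T \<in> B'. insert v T \<in> B} = insert (V - {v}) ?I"
    using del.top_mem insert_top top_mem by auto
  have "finite ?I" using del.finite_B by auto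
  then have "(\<Sum>T\<in>{T \<in> B'. insert v T \<in> B}. ?g T) = ?g (V - {v}) + (\<Sum>T\<in>?I. ?g T)"
    unfolding I by (subst sum.insert) auto
  moreover have "{N \<in> nested_sets (V - {v}) B'. V - {v} \<in> N} = nested_sets (V - {v}) B'"
    by (auto simp: nested_sets_def)
  moreover have "(\<Sum>T\<in>?I. ?g T) = t * (\<Sum>T\<in>?I. face_sum a t T (restriction B' T) *
      face_sum a t (V - {v} - T) (contraction (V - {v}) B' T))"
    unfolding sum_distrib_left mult.assoc[symmetric]
    by (rule sum.cong[OF refl], rule del.face_sum_through) auto
  ultimately show ?thesis
    unfolding face_sum_delete_chain by (simp add: algebra_simps face_sum_def)
qed

end

section \<open>The cone of non-negative gamma-vectors\<close>

text \<open>
  The elements of degree \<open>n\<close> with a non-negative \<open>\<gamma>\<close>-vector.  Generating the cone avoids choosing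
  coefficients until the very end.
\<close>
inductive_set gamma_cone :: "'a::comm_ring_1 \<Rightarrow> 'a \<Rightarrow> nat \<Rightarrow> 'a set" for s d n where
  gamma_cone_zero: "0 \<in> gamma_cone s d n"
| gamma_cone_step: "p \<in> gamma_cone s d n \<Longrightarrow> 2 * i + j = n \<Longrightarrow> p + s ^ i * d ^ j \<in> gamma_cone s d n"

lemma gamma_cone_add:
  assumes "p \<in> gamma_cone s d n" "q \<in> gamma_cone s d n"
  shows "p + q \<in> gamma_cone s d n"
  using assms(2,1) by induction (auto intro: gamma_cone.intros simp: add.assoc[symmetric])

lemma gamma_cone_monom: "2 * i + j = n \<Longrightarrow> s ^ i * d ^ j \<in> gamma_cone s d n"
  using gamma_cone_step[OF gamma_cone_zero, of i j n s d] by simp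

lemma gamma_cone_mult_monom:
  assumes "p \<in> gamma_cone s d n" "2 * i + j = m"
  shows "p * (s ^ i * d ^ j) \<in> gamma_cone s d (n + m)"
  using assms(1)
proof induction
  case (gamma_cone_step p i' j')
  have "s ^ i' * d ^ j' * (s ^ i * d ^ j) = s ^ (i' + i) * d ^ (j' + j)" by (simp add: power_add algebra_simps)
  moreover have "2 * (i' + i) + (j' + j) = n + m" using gamma_cone_step assms by simp
  ultimately show ?case
    using gamma_cone_step.IH gamma_cone.gamma_cone_step[of "p * (s ^ i * d ^ j)" s d "n + m" "i' + i" "j' + j"]
    by (simp add: distrib_right)
qed (simp add: gamma_cone_zero)

lemma gamma_cone_mult:
  assumes "p \<in> gamma_cone s d n" "q \<in> gamma_cone s d m"
  shows "p * q \<in> gamma_cone s d (n + m)"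
  using assms(2)
proof induction
  case (gamma_cone_step q i j)
  then show ?case
    using gamma_cone_add gamma_cone_mult_monom[OF assms(1) gamma_cone_step(2)] by (simp add: distrib_left)
qed (simp add: gamma_cone_zero)

text \<open>
  The smaller side is required to lie in the cone, so that the order is compatible with
  products.
\<close>
definition gamma_le :: "'a::comm_ring_1 \<Rightarrow> 'a \<Rightarrow> nat \<Rightarrow> 'a \<Rightarrow> 'a \<Rightarrow> bool" where
  "gamma_le s d n p q \<longleftrightarrow> p \<in> gamma_cone s d n \<and> q - p \<in> gamma_cone s d n"

lemma gamma_le_refl: "p \<in> gamma_cone s d n \<Longrightarrow> gamma_le s d n p p"
  by (simp add: gamma_le_def gamma_cone_zero)

lemma gamma_le_cone: "gamma_le s d n p q \<Longrightarrow> p \<in> gamma_cone s d n \<and> q \<in> gamma_cone s d n"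
  using gamma_cone_add[of p s d n "q - p"] by (simp add: gamma_le_def)

lemma gamma_le_trans:
  assumes "gamma_le s d n p q" "gamma_le s d n q u"
  shows "gamma_le s d n p u"
  using gamma_cone_add[of "q - p" s d n "u - q"] assms by (simp add: gamma_le_def)

lemma gamma_le_add:
  assumes "gamma_le s d n p q" "gamma_le s d n p' q'"
  shows "gamma_le s d n (p + p') (q + q')"
proof -
  have "(q + q') - (p + p') = (q - p) + (q' - p')" by simp
  then show ?thesis using assms gamma_cone_add unfolding gamma_le_def by metis
qed

lemma gamma_le_mult:
  assumes "gamma_le s d n p q" "gamma_le s d m p' q'"
  shows "gamma_le s d (n + m) (p * p') (q * q')"
proof -
  have "q * q' - p * p' = (q - p) * q' + p * (q' - p')" by (simp add: algebra_simps)
  moreover have "q' \<in> gamma_cone s d m" using gamma_le_cone assms(2) by blast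
  ultimately show ?thesis
    using assms gamma_cone_add gamma_cone_mult unfolding gamma_le_def by metis
qed

lemma gamma_le_sum:
  assumes "\<And>x. x \<in> A \<Longrightarrow> gamma_le s d n (f x) (g x)"
  shows "gamma_le s d n (sum f A) (sum g A)"
proof (cases "finite A")
  case True
  then show ?thesis using assms
    by (induction A) (auto intro: gamma_le_add simp: gamma_le_refl gamma_cone_zero)
qed (simp add: gamma_le_refl gamma_cone_zero)

lemma gamma_cone_of_nat: "p \<in> gamma_cone s d n \<Longrightarrow> of_nat k * p \<in> gamma_cone s d n"
  by (induction k) (auto simp: gamma_cone_zero distrib_right intro: gamma_cone_add)

lemma gamma_le_of_nat:
  assumes "k \<le> l" "p \<in> gamma_cone s d n"
  shows "gamma_le s d n (of_nat k * p) (of_nat l * p)"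
proof -
  have "of_nat l * p - of_nat k * p = of_nat (l - k) * p" using assms(1) by (simp add: of_nat_diff algebra_simps)
  then show ?thesis using gamma_cone_of_nat[OF assms(2)] by (simp add: gamma_le_def)
qed

lemma gamma_le_base:
  shows "gamma_le s d 2 s s" "gamma_le s d 1 d d" "gamma_le s d 0 1 1"
  using gamma_cone_monom[of 1 0 2 s d] gamma_cone_monom[of 0 1 1 s d] gamma_cone_monom[of 0 0 0 s d]
  by (simp_all add: gamma_le_refl)

text \<open>
  The recursion of \<open>face_sum_delete\<close> is monotone.  For \<open>m = 0\<close> the truncated degree \<open>m - 1\<close> is wrong for the sum,
  but then the sum is empty.
\<close>
lemma gamma_le_recursion:
  assumes "gamma_le s d m p q" "gamma_le s d (m - 1) p' q'" "m = 0 \<Longrightarrow> p' = 0 \<and> q' = 0"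
  shows "gamma_le s d (Suc m) (d * p + s * p') (d * q + s * q')"
proof (cases m)
  case 0
  then show ?thesis using assms gamma_le_mult[OF gamma_le_base(2) assms(1)] by simp
next
  case (Suc k)
  then show ?thesis
    using gamma_le_add[OF gamma_le_mult[OF gamma_le_base(2)[of s d] assms(1)]]
      gamma_le_mult[OF gamma_le_base(1)[of s d] assms(2)] by simp
qed

text \<open>
  The solutions of the recursion of \<open>face_sum_delete\<close> for the path, the complete graph and the star
  with the given number of vertices: a product for each size \<open>k\<close> of \<open>T\<close>, multiplied by the number of sets \<open>T\<close> of
  this size.
\<close>
fun path_poly :: "'a::comm_ring_1 \<Rightarrow> 'a \<Rightarrow> nat \<Rightarrow> 'a" where
  "path_poly s d 0 = 1"
| "path_poly s d (Suc 0) = 1"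
| "path_poly s d (Suc (Suc m)) = d * path_poly s d (Suc m) +
     s * (\<Sum>k=1..m. path_poly s d k * path_poly s d (Suc m - k))"

fun complete_poly :: "'a::comm_ring_1 \<Rightarrow> 'a \<Rightarrow> nat \<Rightarrow> 'a" where
  "complete_poly s d 0 = 1"
| "complete_poly s d (Suc 0) = 1"
| "complete_poly s d (Suc (Suc m)) = d * complete_poly s d (Suc m) +
     s * (\<Sum>k=1..m. of_nat (Suc m choose k) * (complete_poly s d k * complete_poly s d (Suc m - k)))"

fun star_poly :: "'a::comm_ring_1 \<Rightarrow> 'a \<Rightarrow> nat \<Rightarrow> 'a" where
  "star_poly s d 0 = 1"
| "star_poly s d (Suc 0) = 1"
| "star_poly s d (Suc (Suc m)) = d * star_poly s d (Suc m) +
     s * (\<Sum>k=1..m. of_nat (m choose (k - 1)) * (star_poly s d k * complete_poly s d (Suc m - k)))"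

lemma sum_by_card:
  fixes g :: "nat \<Rightarrow> 'a::comm_ring_1"
  assumes "finite I" "\<And>T. T \<in> I \<Longrightarrow> card T \<in> K" "finite K"
  shows "(\<Sum>T\<in>I. g (card T)) = (\<Sum>k\<in>K. of_nat (card {T \<in> I. card T = k}) * g k)"
proof -
  have "(\<Sum>T\<in>I. g (card T)) = (\<Sum>k\<in>K. \<Sum>T\<in>{T \<in> I. card T = k}. g (card T))"
    by (rule sum.group[OF assms(1,3), symmetric]) (use assms(2) in blast)
  also have "\<dots> = (\<Sum>k\<in>K. of_nat (card {T \<in> I. card T = k}) * g k)"
    by (rule sum.cong) auto
  finally show ?thesis .
qed

section \<open>Building sets with an elimination order\<close>

text \<open>
  For a graph, \<open>r\<close> is a perfect elimination order read backwards: each vertex is simplicial among the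
  earlier ones.
\<close>
locale ordered_building_set = accessible_building_set V B for V :: "'v set" and B +
  fixes r :: "'v \<Rightarrow> nat"
  assumes inj_rank: "inj_on r V"
    and prefix_mem: "S \<in> B \<Longrightarrow> x \<in> S \<Longrightarrow> {y \<in> S. r y \<le> r x} \<in> B"
begin

lemma restrict_ordered:
  assumes "T \<in> B"
  shows "ordered_building_set T (restriction B T) r"
proof -
  interpret R: accessible_building_set T "restriction B T" using restrict_accessible assms .
  show ?thesis
  proof
    show "inj_on r T" using inj_rank subset_V[OF assms] inj_on_subset by blast
    fix S x assume "S \<in> restriction B T" "x \<in> S"
    then show "{y \<in> S. r y \<le> r x} \<in> restriction B T"
      using prefix_mem by (auto simp: restriction_def)
  qed
qed

text \<open>
  The initial segment of \<open>U\<close> up to \<open>x\<close> is seen in \<open>B\<close> through a member \<open>A\<close>, which may also contain the part of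
  \<open>T\<close> before \<open>x\<close>.  If this part is not empty, \<open>A \<union> T\<close> is in \<open>B\<close>.
\<close>
lemma prefix_uncontract:
  assumes T: "T \<in> B" and U: "U \<in> contraction V B T" and x: "x \<in> U"
  obtains A where "A \<in> B" "A - T = {y \<in> U. r y \<le> r x}" "\<And>y. y \<in> A \<Longrightarrow> r y \<le> r x" "x \<in> A"
    "A \<inter> T \<noteq> {} \<Longrightarrow> {y \<in> U. r y \<le> r x} \<union> T \<in> B"
proof -
  have UT: "U \<inter> T = {}" using U by (auto simp: contraction_def)
  show ?thesis
  proof (cases "U \<in> B")
    case True
    show ?thesis
      by (rule that[of "{y \<in> U. r y \<le> r x}"]) (use True prefix_mem x UT in auto)
  next
    case False
    then have P: "{y \<in> U \<union> T. r y \<le> r x} \<in> B" (is "?P \<in> B")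
      using U x prefix_mem[of "U \<union> T" x] by (auto simp: contraction_def)
    show ?thesis
    proof (rule that[OF P])
      assume "?P \<inter> T \<noteq> {}"
      then have "?P \<union> T \<in> B" using P T by (intro union_mem[of ?P]) auto
      moreover have "?P \<union> T = {y \<in> U. r y \<le> r x} \<union> T" by auto
      ultimately show "{y \<in> U. r y \<le> r x} \<union> T \<in> B" by simp
    qed (use x UT in auto)
  qed
qed

lemma contract_ordered:
  assumes T: "T \<in> B" "T \<noteq> V"
  shows "ordered_building_set (V - T) (contraction V B T) r"
proof -
  interpret C: accessible_building_set "V - T" "contraction V B T" using contract_accessible T .
  show ?thesis
  proof
    show "inj_on r (V - T)" using inj_rank inj_on_subset by blast
    fix U x assume U: "U \<in> contraction V B T" "x \<in> U"
    obtain A where A: "A \<in> B" "A - T = {y \<in> U. r y \<le> r x}" "A \<inter> T \<noteq> {} \<Longrightarrow> {y \<in> U. r y \<le> r x} \<union> T \<in> B"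
      by (rule prefix_uncontract[OF T(1) U]) blast
    have "{y \<in> U. r y \<le> r x} \<in> B \<or> {y \<in> U. r y \<le> r x} \<union> T \<in> B"
    proof (cases "A \<inter> T = {}")
      case True
      then have "A - T = A" by auto
      then show ?thesis using A by simp
    qed (use A(3) in simp)
    then show "{y \<in> U. r y \<le> r x} \<in> contraction V B T"
      using U by (auto simp: contraction_def)
  qed
qed

lemma max_exists:
  assumes "S \<in> B"
  obtains x where "x \<in> S" "\<And>y. y \<in> S \<Longrightarrow> r y \<le> r x"
proof -
  have "finite (r ` S)" "r ` S \<noteq> {}" using finite_mem nonempty assms by auto
  then have "Max (r ` S) \<in> r ` S" by (rule Max_in)
  then obtain x where x: "x \<in> S" "Max (r ` S) = r x" by auto
  show ?thesis
  proof (rule that[OF x(1)])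
    fix y assume "y \<in> S"
    then show "r y \<le> r x" unfolding x(2)[symmetric] using \<open>finite (r ` S)\<close> by simp
  qed
qed

text \<open>
  Without its last vertex, a set is one of its own initial segments.
\<close>
lemma max_deletable:
  assumes v: "v \<in> V" "\<And>y. y \<in> V \<Longrightarrow> r y \<le> r v" and V: "V \<noteq> {v}"
  shows "deletable_vertex V B v"
proof
  show "v \<in> V" "V \<noteq> {v}" using v V by auto
  fix S assume S: "S \<in> B" "S \<noteq> {v}"
  show "S - {v} \<in> B"
  proof (cases "v \<in> S")
    case True
    have "finite (S - {v})" "S - {v} \<noteq> {}" using S finite_mem nonempty by auto
    then have "finite (r ` (S - {v}))" "r ` (S - {v}) \<noteq> {}" by auto
    then have "Max (r ` (S - {v})) \<in> r ` (S - {v})" "\<And>y. y \<in> S - {v} \<Longrightarrow> r y \<le> Max (r ` (S - {v}))"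
      by (rule Max_in, simp)
    then obtain x where x: "x \<in> S - {v}" "\<And>y. y \<in> S - {v} \<Longrightarrow> r y \<le> r x"
      by (metis (no_types, lifting) imageE)
    have "r x \<noteq> r v" using x(1) v(1) subset_V[OF S(1)] inj_onD[OF inj_rank, of x v] by blast
    moreover have "r x \<le> r v" using v(2) x(1) subset_V[OF S(1)] by blast
    ultimately have "\<not> r v \<le> r x" by linarith
    then have "{y \<in> S. r y \<le> r x} = S - {v}" using x(2) by auto
    moreover have "{y \<in> S. r y \<le> r x} \<in> B" using prefix_mem S(1) x(1) by blast
    ultimately show ?thesis by simp
  qed (use S in simp)
qed

end

lemma face_sum_single:
  assumes "accessible_building_set V B" "card V = Suc 0"
  shows "face_sum a t V B = 1"
proof -
  interpret accessible_building_set V B by fact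
  obtain v where V: "V = {v}" using assms(2) card_1_singletonE by (metis One_nat_def)
  have "B = {V}" using subset_V nonempty top_mem V by blast
  then have "nested_sets V B = {{V}}" by (auto simp: nested_sets_def)
  then show ?thesis by (simp add: face_sum_def V)
qed

text \<open>
  The index set of the sum in \<open>face_sum_delete\<close>.
\<close>
definition link_sets :: "'v set set \<Rightarrow> 'v set \<Rightarrow> 'v \<Rightarrow> 'v set set" where
  "link_sets B V v = {T \<in> restriction B (V - {v}). insert v T \<in> B \<and> T \<noteq> V - {v}}"

text \<open>
  One step of the inductions: \<open>v\<close> is the last of \<open>m + 2\<close> vertices, so the sets \<open>T\<close> of \<open>face_sum_delete\<close>
  have between 1 and \<open>m\<close> elements.
\<close>
locale deletion_step = ordered_building_set V B r for V :: "'v set" and B and r :: "'v \<Rightarrow> nat" +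
  fixes v :: 'v and m :: nat
  assumes last_mem: "v \<in> V" and last_max: "y \<in> V \<Longrightarrow> r y \<le> r v" and card_V: "card V = Suc (Suc m)"
begin

sublocale deletable_vertex V B v
proof -
  have "V \<noteq> {v}" using card_V by auto
  then show "deletable_vertex V B v" using max_deletable last_mem last_max by blast
qed

lemma ordered_V': "ordered_building_set (V - {v}) B' r"
  using restrict_ordered top' .

lemma card_V': "card (V - {v}) = Suc m"
  using card_V last_mem by simp

lemma finite_links: "finite (link_sets B V v)"
  using del.finite_B by (simp add: link_sets_def)

lemma
  assumes "T \<in> link_sets B V v"
  shows link_B': "T \<in> B'" and link_insert: "insert v T \<in> B" and link_subset: "T \<subset> V - {v}"
    and link_card: "card T \<in> {1..m}" "card (V - {v} - T) = Suc m - card T"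
    and link_ordered: "ordered_building_set T (restriction B' T) r"
      "ordered_building_set (V - {v} - T) (contraction (V - {v}) B' T) r"
proof -
  show T: "T \<in> B'" "insert v T \<in> B" using assms by (auto simp: link_sets_def)
  have "T \<noteq> V - {v}" using assms by (auto simp: link_sets_def)
  then show sub: "T \<subset> V - {v}" using del.subset_V[OF T(1)] by auto
  have "card T > 0" using del.finite_mem[OF T(1)] del.nonempty[OF T(1)] by (simp add: card_gt_0_iff)
  moreover have "card T < Suc m" using psubset_card_mono[OF del.finite_V sub] card_V' by simp
  ultimately show "card T \<in> {1..m}" by simp
  show "card (V - {v} - T) = Suc m - card T"
    using card_Diff_subset[of T "V - {v}"] del.finite_mem[OF T(1)] sub card_V' by auto
  interpret O: ordered_building_set "V - {v}" B' r by (rule ordered_V')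
  show "ordered_building_set T (restriction B' T) r"
    "ordered_building_set (V - {v} - T) (contraction (V - {v}) B' T) r"
    using O.restrict_ordered[OF T(1)] O.contract_ordered[OF T(1) \<open>T \<noteq> V - {v}\<close>] by auto
qed

lemma link_sizes:
  assumes "T \<in> link_sets B V v"
  obtains i j where "card T = Suc i" "Suc m - card T = Suc j" "card (V - {v} - T) = Suc j"
    "i \<le> m" "j \<le> m" "i + j = m - 1"
  using link_card[OF assms] by (intro that[of "card T - 1" "m - card T"]) auto

lemma face_sum_step:
  fixes a t :: "'a::comm_ring_1"
  shows "face_sum a t V B = (a + 2 * t) * face_sum a t (V - {v}) B' +
    (a + t) * t * (\<Sum>T\<in>link_sets B V v. face_sum a t T (restriction B' T) *
      face_sum a t (V - {v} - T) (contraction (V - {v}) B' T))"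
  unfolding link_sets_def by (rule face_sum_delete)

lemma sum_links_by_card:
  fixes g :: "nat \<Rightarrow> 'a::comm_ring_1"
  shows "(\<Sum>T\<in>link_sets B V v. g (card T)) =
    (\<Sum>k=1..m. of_nat (card {T \<in> link_sets B V v. card T = k}) * g k)"
  by (rule sum_by_card[OF finite_links link_card(1) finite_atLeastAtMost])

text \<open>
  Growing \<open>{v}\<close> one vertex at a time inside \<open>V\<close> passes through every size; then \<open>v\<close> is
  removed.
\<close>
lemma link_of_card:
  assumes k: "k \<in> {1..m}"
  obtains T where "T \<in> link_sets B V v" "card T = k"
proof -
  have grown: "j \<le> Suc m \<Longrightarrow> \<exists>S\<in>B. v \<in> S \<and> card S = Suc j" for j
  proof (induction j)
    case 0
    show ?case using singleton_mem[OF last_mem] by (intro bexI[of _ "{v}"]) auto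
  next
    case (Suc j)
    then obtain S where S: "S \<in> B" "v \<in> S" "card S = Suc j" by auto
    have "S \<noteq> V" using S Suc card_V by auto
    then have "S \<subset> V" using subset_V[OF S(1)] by auto
    then obtain u where u: "u \<in> V - S" "insert u S \<in> B" using grow[OF S(1) top_mem] by blast
    then show ?case using S finite_mem[OF S(1)] by (intro bexI[of _ "insert u S"]) auto
  qed
  from grown[of k] obtain S where S: "S \<in> B" "v \<in> S" "card S = Suc k" using k by auto
  have c: "card (S - {v}) = k" using S by simp
  have "S \<noteq> {v}" using S k by auto
  then have "S - {v} \<in> B'" using delete_B' S by simp
  moreover have "insert v (S - {v}) \<in> B" using S by (simp add: insert_absorb)
  moreover have "S - {v} \<noteq> V - {v}"
  proof
    assume "S - {v} = V - {v}"
    then have "k = Suc m" using c card_V' by simp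
    then show False using k by simp
  qed
  ultimately have "S - {v} \<in> link_sets B V v" by (simp add: link_sets_def)
  then show ?thesis using c that by blast
qed

lemma links_card_ge:
  assumes "k \<in> {1..m}"
  shows "1 \<le> card {T \<in> link_sets B V v. card T = k}"
proof -
  obtain T where "T \<in> link_sets B V v" "card T = k" using link_of_card[OF assms] .
  then have "{T \<in> link_sets B V v. card T = k} \<noteq> {}" by blast
  then show ?thesis using finite_links by (simp add: Suc_le_eq card_gt_0_iff)
qed

lemma links_card_le: "card {T \<in> link_sets B V v. card T = k} \<le> Suc m choose k"
proof -
  have "card {T \<in> link_sets B V v. card T = k} \<le> card {T. T \<subseteq> V - {v} \<and> card T = k}"
    using link_subset finite_V by (intro card_mono) auto
  then show ?thesis using n_subsets[of "V - {v}" k] finite_V card_V' by simp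
qed

text \<open>
  Comparing first the summands and then the numbers of sets of each size.  The second step needs
  \<open>g k\<close> to lie in the cone, which is known because every size \<open>k\<close> occurs.
\<close>
lemma links_sum_le:
  fixes f :: "'v set \<Rightarrow> 'a::comm_ring_1"
  assumes f: "\<And>T. T \<in> link_sets B V v \<Longrightarrow> gamma_le s d n (f T) (g (card T))"
    and b: "\<And>k. k \<in> {1..m} \<Longrightarrow> card {T \<in> link_sets B V v. card T = k} \<le> b k"
  shows "gamma_le s d n (sum f (link_sets B V v)) (\<Sum>k=1..m. of_nat (b k) * g k)"
proof -
  have "g k \<in> gamma_cone s d n" if k: "k \<in> {1..m}" for k
  proof -
    obtain T where T: "T \<in> link_sets B V v" "card T = k" using link_of_card[OF k] .
    then show ?thesis using gamma_le_cone[OF f[OF T(1)]] by simp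
  qed
  then have "gamma_le s d n (\<Sum>k=1..m. of_nat (card {T \<in> link_sets B V v. card T = k}) * g k) (\<Sum>k=1..m. of_nat (b k) * g k)"
    using b by (intro gamma_le_sum gamma_le_of_nat)
  moreover have "gamma_le s d n (sum f (link_sets B V v)) (\<Sum>T\<in>link_sets B V v. g (card T))"
    using f by (rule gamma_le_sum)
  ultimately show ?thesis using gamma_le_trans sum_links_by_card[of g] by metis
qed

lemma links_sum_ge:
  fixes f :: "'v set \<Rightarrow> 'a::comm_ring_1"
  assumes f: "\<And>T. T \<in> link_sets B V v \<Longrightarrow> gamma_le s d n (g (card T)) (f T)"
  shows "gamma_le s d n (\<Sum>k=1..m. g k) (sum f (link_sets B V v))"
proof -
  have "g k \<in> gamma_cone s d n" if k: "k \<in> {1..m}" for k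
  proof -
    obtain T where T: "T \<in> link_sets B V v" "card T = k" using link_of_card[OF k] .
    then show ?thesis using gamma_le_cone[OF f[OF T(1)]] by simp
  qed
  then have "gamma_le s d n (\<Sum>k=1..m. of_nat 1 * g k) (\<Sum>k=1..m. of_nat (card {T \<in> link_sets B V v. card T = k}) * g k)"
    using links_card_ge by (intro gamma_le_sum gamma_le_of_nat)
  moreover have "gamma_le s d n (\<Sum>T\<in>link_sets B V v. g (card T)) (sum f (link_sets B V v))"
    using f by (rule gamma_le_sum)
  ultimately show ?thesis using gamma_le_trans sum_links_by_card[of g] by simp
qed

lemma no_links: "m = 0 \<Longrightarrow> link_sets B V v = {}"
  using link_card(1) by fastforce

end

lemma (in ordered_building_set) deletion_step_exists:
  assumes "card V = Suc (Suc m)"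
  obtains v where "deletion_step V B r v m"
proof -
  obtain v where v: "v \<in> V" "\<And>y. y \<in> V \<Longrightarrow> r y \<le> r v" using max_exists[OF top_mem] by blast
  have "deletion_step V B r v m" by unfold_locales (use v assms in auto)
  then show ?thesis using that by blast
qed

context
  fixes a t s d :: "'a::comm_ring_1"
  assumes s: "s = (a + t) * t" and d: "d = a + 2 * t"
begin

text \<open>
  In the recursion, the sets \<open>T\<close> of a given size number at least one and at most all subsets of that size.
  The lower bound holds for every ordered building set, so it applies to the contractions, too.
\<close>
theorem face_sum_bounds:
  assumes "ordered_building_set V B r" "card V = Suc n"
  shows "gamma_le s d n (path_poly s d (Suc n)) (face_sum a t V B) \<and>
         gamma_le s d n (face_sum a t V B) (complete_poly s d (Suc n))"
  using assms
proof (induction n arbitrary: V B rule: less_induct)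
  case (less n)
  interpret ordered_building_set V B r by fact
  show ?case
  proof (cases n)
    case 0
    then have "face_sum a t V B = 1" using face_sum_single accessible_building_set_axioms less by simp
    then show ?thesis using 0 gamma_le_base by simp
  next
    case (Suc m)
    then obtain v where "deletion_step V B r v m" using deletion_step_exists less.prems(2) by metis
    then interpret D: deletion_step V B r v m .
    note IH = less.IH[OF _ D.ordered_V' D.card_V']
    let ?f = "\<lambda>T. face_sum a t T (restriction D.B' T) *
      face_sum a t (V - {v} - T) (contraction (V - {v}) D.B' T)"
    have T: "gamma_le s d (m - 1) (path_poly s d (card T) * path_poly s d (Suc m - card T)) (?f T) \<and>
        gamma_le s d (m - 1) (?f T) (complete_poly s d (card T) * complete_poly s d (Suc m - card T))"
      if "T \<in> link_sets B V v" for T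
    proof -
      obtain i j where ij: "card T = Suc i" "Suc m - card T = Suc j" "card (V - {v} - T) = Suc j"
        "i \<le> m" "j \<le> m" "i + j = m - 1"
        by (rule D.link_sizes[OF \<open>T \<in> link_sets B V v\<close>])
      \<comment> \<open>\<open>ij(2)\<close> mentions \<open>card T\<close>, so it has to be rewritten before \<open>ij(1)\<close> is.\<close>
      show ?thesis unfolding ij(2) unfolding ij(1) ij(6)[symmetric]
        using less.IH[of i, OF _ D.link_ordered(1)[OF that] ij(1)]
          less.IH[of j, OF _ D.link_ordered(2)[OF that] ij(3)] ij(4,5) Suc gamma_le_mult[of s d i _ _ j]
        by auto
    qed
    show ?thesis
      using gamma_le_recursion[OF conjunct1[OF IH] D.links_sum_ge[where f = ?f, OF conjunct1[OF T]]]
        gamma_le_recursion[OF conjunct2[OF IH] D.links_sum_le[where f = ?f, OF conjunct2[OF T] D.links_card_le]]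
        D.no_links
      unfolding Suc D.face_sum_step s d by simp
  qed
qed

end

section \<open>Paths, stars and trees\<close>

text \<open>
  This singles out paths in a way that survives contraction: members with the same last vertex are
  nested in each other, as intervals with the same right end are.
\<close>
definition max_chains :: "('v \<Rightarrow> nat) \<Rightarrow> 'v set set \<Rightarrow> bool" where
  "max_chains r B \<longleftrightarrow>
     (\<forall>S\<in>B. \<forall>S'\<in>B. \<forall>x\<in>S \<inter> S'. (\<forall>y\<in>S \<union> S'. r y \<le> r x) \<longrightarrow> S \<subseteq> S' \<or> S' \<subseteq> S)"

text \<open>
  The parent of a vertex in a tree is its only earlier neighbour.  This property passes to restrictions but not to
  contractions; the recursion for the upper bound therefore uses the general bound for them.
\<close>
definition has_parents :: "('v \<Rightarrow> nat) \<Rightarrow> ('v \<Rightarrow> 'v) \<Rightarrow> 'v set set \<Rightarrow> bool" where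
  "has_parents r p B \<longleftrightarrow>
     (\<forall>S\<in>B. \<forall>x\<in>S. (\<forall>y\<in>S. r y \<le> r x) \<longrightarrow> S \<noteq> {x} \<longrightarrow> p x \<in> S - {x})"

lemma max_chainsD:
  assumes "max_chains r B" "S \<in> B" "S' \<in> B" "x \<in> S" "x \<in> S'" "\<And>y. y \<in> S \<union> S' \<Longrightarrow> r y \<le> r x"
  shows "S \<subseteq> S' \<or> S' \<subseteq> S"
  using assms unfolding max_chains_def by (metis IntI)

lemma has_parentsD:
  assumes "has_parents r p B" "S \<in> B" "x \<in> S" "\<And>y. y \<in> S \<Longrightarrow> r y \<le> r x" "S \<noteq> {x}"
  shows "p x \<in> S - {x}"
  using assms unfolding has_parents_def by metis

lemma max_chains_restrict: "max_chains r B \<Longrightarrow> max_chains r (restriction B T)"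
  unfolding max_chains_def restriction_def by blast

lemma has_parents_restrict: "has_parents r p B \<Longrightarrow> has_parents r p (restriction B T)"
  unfolding has_parents_def restriction_def by blast

text \<open>
  The initial segments of \<open>prefix_uncontract\<close> for \<open>U\<close> and \<open>U'\<close> both end in \<open>x\<close>, so they are
  comparable, whether or not they contain parts of \<open>T\<close>.
\<close>
lemma (in ordered_building_set) max_chains_contract:
  assumes T: "T \<in> B" and chain: "max_chains r B"
  shows "max_chains r (contraction V B T)"
  unfolding max_chains_def
proof (intro ballI impI)
  fix U U' x assume U: "U \<in> contraction V B T" "U' \<in> contraction V B T"
    and x: "x \<in> U \<inter> U'" and max: "\<forall>y\<in>U \<union> U'. r y \<le> r x"
  obtain A where A: "A \<in> B" "A - T = {y \<in> U. r y \<le> r x}" "\<And>y. y \<in> A \<Longrightarrow> r y \<le> r x" "x \<in> A"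
    by (rule prefix_uncontract[OF T U(1), of x]) (use x in blast)+
  obtain A' where A': "A' \<in> B" "A' - T = {y \<in> U'. r y \<le> r x}" "\<And>y. y \<in> A' \<Longrightarrow> r y \<le> r x" "x \<in> A'"
    by (rule prefix_uncontract[OF T U(2), of x]) (use x in blast)+
  have "A \<subseteq> A' \<or> A' \<subseteq> A"
    by (rule max_chainsD[OF chain A(1) A'(1) A(4) A'(4)]) (use A(3) A'(3) in auto)
  moreover have "A - T = U" "A' - T = U'" using A(2) A'(2) max by auto
  ultimately show "U \<subseteq> U' \<or> U' \<subseteq> U" by blast
qed

lemma (in deletion_step) links_card_path:
  assumes chain: "max_chains r B" and k: "k \<in> {1..m}"
  shows "card {T \<in> link_sets B V v. card T = k} = 1"
proof -
  obtain T where T: "T \<in> link_sets B V v" "card T = k" using link_of_card[OF k] .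
  have uniq: "T' = T" if T': "T' \<in> link_sets B V v" "card T' = k" for T'
  proof -
    note i = link_insert[OF T(1)] link_insert[OF T'(1)]
    have "insert v T \<subseteq> insert v T' \<or> insert v T' \<subseteq> insert v T"
      by (rule max_chainsD[OF chain i, of v]) (use last_max subset_V[OF i(1)] subset_V[OF i(2)] in auto)
    then have "T \<subseteq> T' \<or> T' \<subseteq> T" using link_subset[OF T(1)] link_subset[OF T'(1)] by blast
    moreover have "finite T" "finite T'" using finite_mem[OF i(1)] finite_mem[OF i(2)] by auto
    ultimately show ?thesis using T(2) T'(2) card_subset_eq by metis
  qed
  have "{T \<in> link_sets B V v. card T = k} \<subseteq> {T}"
  proof
    fix X assume "X \<in> {T \<in> link_sets B V v. card T = k}"
    then have "X = T" by (intro uniq) simp_all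
    then show "X \<in> {T}" by simp
  qed
  moreover have "T \<in> {T \<in> link_sets B V v. card T = k}" using T by simp
  ultimately have "{T \<in> link_sets B V v. card T = k} = {T}" by blast
  then show ?thesis by simp
qed

lemma card_subsets_through:
  assumes "finite V" "c \<in> V" "card V = Suc m" "k \<ge> 1"
  shows "card {T. T \<subseteq> V \<and> c \<in> T \<and> card T = k} = m choose (k - 1)"
proof -
  have "card {T. T \<subseteq> V \<and> c \<in> T \<and> card T = k} = card {X. X \<subseteq> V - {c} \<and> card X = k - 1}"
  proof (rule bij_betw_same_card[of "\<lambda>T. T - {c}"], rule bij_betwI[where g = "insert c"])
    show "insert c \<in> {X. X \<subseteq> V - {c} \<and> card X = k - 1} \<rightarrow> {T. T \<subseteq> V \<and> c \<in> T \<and> card T = k}"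
    proof
      fix X assume X: "X \<in> {X. X \<subseteq> V - {c} \<and> card X = k - 1}"
      then have "finite X" "c \<notin> X" using finite_subset[of X V] assms(1) by auto
      then show "insert c X \<in> {T. T \<subseteq> V \<and> c \<in> T \<and> card T = k}" using X assms by auto
    qed
  qed (use assms in auto)
  also have "\<dots> = m choose (k - 1)" using assms n_subsets[of "V - {c}" "k - 1"] by simp
  finally show ?thesis .
qed

text \<open>
  Since \<open>v\<close> is last in \<open>insert v T\<close>, its parent lies in \<open>T\<close>, which leaves \<open>k - 1\<close> elements of \<open>T\<close> to be chosen.
\<close>
lemma (in deletion_step) links_card_le_tree:
  assumes par: "has_parents r p B" and k: "k \<in> {1..m}"
  shows "card {T \<in> link_sets B V v. card T = k} \<le> m choose (k - 1)"
proof -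
  have T: "p v \<in> T \<and> T \<subseteq> V - {v}" if "T \<in> link_sets B V v" for T
  proof -
    note i = link_insert[OF that] link_subset[OF that]
    have "T \<noteq> {}" using link_card(1)[OF that] by auto
    then have "insert v T \<noteq> {v}" using i(2) by auto
    moreover have "r y \<le> r v" if "y \<in> insert v T" for y using last_max subset_V[OF i(1)] that by blast
    ultimately have "p v \<in> insert v T - {v}" using has_parentsD[OF par i(1)] by blast
    then show ?thesis using i by auto
  qed
  obtain T\<^sub>0 where "T\<^sub>0 \<in> link_sets B V v" using link_of_card[OF k] by metis
  then have "p v \<in> V - {v}" using T by blast
  then have "card {T. T \<subseteq> V - {v} \<and> p v \<in> T \<and> card T = k} = m choose (k - 1)"
    using finite_V card_V' k by (intro card_subsets_through) auto
  moreover have "card {T \<in> link_sets B V v. card T = k} \<le> card {T. T \<subseteq> V - {v} \<and> p v \<in> T \<and> card T = k}"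
    using T finite_V by (intro card_mono) (auto intro: finite_subset[of _ "Pow V"])
  ultimately show ?thesis by simp
qed

text \<open>
  Together with the axioms of a building set, this is the complete graph, and the following
  predicate is the star with centre \<open>c\<close>.
\<close>
definition all_subsets :: "'v set \<Rightarrow> 'v set set \<Rightarrow> bool" where
  "all_subsets V B \<longleftrightarrow> (\<forall>S. S \<noteq> {} \<longrightarrow> S \<subseteq> V \<longrightarrow> S \<in> B)"

definition all_through :: "'v \<Rightarrow> 'v set \<Rightarrow> 'v set set \<Rightarrow> bool" where
  "all_through c V B \<longleftrightarrow> c \<in> V \<and> (\<forall>S. c \<in> S \<longrightarrow> S \<subseteq> V \<longrightarrow> S \<in> B) \<and> (\<forall>S\<in>B. card S \<noteq> 1 \<longrightarrow> c \<in> S)"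

text \<open>
  If both factors depend only on the size of \<open>T\<close>, the recursion becomes a sum over sizes.
\<close>
lemma (in deletion_step) face_sum_by_card:
  fixes a t s d :: "'a::comm_ring_1"
  assumes s: "s = (a + t) * t" and d: "d = a + 2 * t"
    and V': "face_sum a t (V - {v}) B' = q"
    and T: "\<And>T. T \<in> link_sets B V v \<Longrightarrow> face_sum a t T (restriction B' T) = g (card T) \<and>
       face_sum a t (V - {v} - T) (contraction (V - {v}) B' T) = h (Suc m - card T)"
    and b: "\<And>k. k \<in> {1..m} \<Longrightarrow> card {T \<in> link_sets B V v. card T = k} = b k"
  shows "face_sum a t V B = d * q + s * (\<Sum>k=1..m. of_nat (b k) * (g k * h (Suc m - k)))"
proof -
  have "(\<Sum>T\<in>link_sets B V v. face_sum a t T (restriction B' T) *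
        face_sum a t (V - {v} - T) (contraction (V - {v}) B' T)) =
      (\<Sum>T\<in>link_sets B V v. g (card T) * h (Suc m - card T))"
    by (rule sum.cong[OF refl]) (use T in auto)
  also have "\<dots> = (\<Sum>k=1..m. of_nat (b k) * (g k * h (Suc m - k)))"
    unfolding sum_links_by_card[of "\<lambda>k. g k * h (Suc m - k)"] by (rule sum.cong[OF refl]) (use b in auto)
  finally show ?thesis using face_sum_step[of a t] V' s d by simp
qed

context
  fixes a t s d :: "'a::comm_ring_1"
  assumes s: "s = (a + t) * t" and d: "d = a + 2 * t"
begin

theorem face_sum_path:
  assumes "ordered_building_set V B r" "max_chains r B" "card V = Suc n"
  shows "face_sum a t V B = path_poly s d (Suc n)"
  using assms
proof (induction n arbitrary: V B rule: less_induct)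
  case (less n)
  interpret ordered_building_set V B r by fact
  show ?case
  proof (cases n)
    case 0
    then show ?thesis using face_sum_single accessible_building_set_axioms less by simp
  next
    case (Suc m)
    then obtain v where "deletion_step V B r v m" using deletion_step_exists less.prems(3) by metis
    then interpret D: deletion_step V B r v m .
    have chain: "max_chains r D.B'" using max_chains_restrict[OF less.prems(2)] .
    have "face_sum a t V B = d * path_poly s d (Suc m) +
       s * (\<Sum>k=1..m. of_nat 1 * (path_poly s d k * path_poly s d (Suc m - k)))"
    proof (rule D.face_sum_by_card[OF s d])
      show "face_sum a t (V - {v}) D.B' = path_poly s d (Suc m)"
        using less.IH[OF _ D.ordered_V' chain D.card_V'] Suc by simp
      show "card {T \<in> link_sets B V v. card T = k} = 1" if "k \<in> {1..m}" for k
        using D.links_card_path[OF less.prems(2) that] .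
      fix T assume T: "T \<in> link_sets B V v"
      obtain i j where ij: "card T = Suc i" "Suc m - card T = Suc j" "card (V - {v} - T) = Suc j" "i \<le> m" "j \<le> m"
        by (rule D.link_sizes[OF T])
      show "face_sum a t T (restriction D.B' T) = path_poly s d (card T) \<and>
         face_sum a t (V - {v} - T) (contraction (V - {v}) D.B' T) = path_poly s d (Suc m - card T)"
        unfolding ij(2) unfolding ij(1)
        using less.IH[OF _ D.link_ordered(1)[OF T] max_chains_restrict[OF chain] ij(1)]
          less.IH[OF _ D.link_ordered(2)[OF T]
            ordered_building_set.max_chains_contract[OF D.ordered_V' D.link_B'[OF T] chain] ij(3)] ij Suc
        by simp
    qed
    then show ?thesis using Suc by simp
  qed
qed

theorem face_sum_complete:
  assumes "ordered_building_set V B r" "all_subsets V B" "card V = Suc n"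
  shows "face_sum a t V B = complete_poly s d (Suc n)"
  using assms
proof (induction n arbitrary: V B rule: less_induct)
  case (less n)
  interpret ordered_building_set V B r by fact
  show ?case
  proof (cases n)
    case 0
    then show ?thesis using face_sum_single accessible_building_set_axioms less by simp
  next
    case (Suc m)
    then obtain v where "deletion_step V B r v m" using deletion_step_exists less.prems(3) by metis
    then interpret D: deletion_step V B r v m .
    have all: "all_subsets (V - {v}) D.B'"
      using less.prems(2) by (auto simp: all_subsets_def restriction_def)
    have "face_sum a t V B = d * complete_poly s d (Suc m) +
       s * (\<Sum>k=1..m. of_nat (Suc m choose k) * (complete_poly s d k * complete_poly s d (Suc m - k)))"
    proof (rule D.face_sum_by_card[OF s d])
      show "face_sum a t (V - {v}) D.B' = complete_poly s d (Suc m)"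
        using less.IH[OF _ D.ordered_V' all D.card_V'] Suc by simp
    next
      fix k assume k: "k \<in> {1..m}"
      have "{T \<in> link_sets B V v. card T = k} = {T. T \<subseteq> V - {v} \<and> card T = k}"
      proof (intro equalityI subsetI)
        fix T assume T: "T \<in> {T. T \<subseteq> V - {v} \<and> card T = k}"
        then have "T \<noteq> {}" "T \<noteq> V - {v}" using k D.card_V' by auto
        moreover have "T \<subseteq> V" "insert v T \<subseteq> V" using T D.last_mem by auto
        ultimately have "T \<in> B" "insert v T \<in> B" using less.prems(2) by (simp_all add: all_subsets_def)
        then show "T \<in> {T \<in> link_sets B V v. card T = k}"
          using T \<open>T \<noteq> V - {v}\<close> by (simp add: link_sets_def restriction_def)
      qed (simp add: link_sets_def restriction_def)
      then show "card {T \<in> link_sets B V v. card T = k} = Suc m choose k"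
        using n_subsets[of "V - {v}" k] finite_V D.card_V' by simp
    next
      fix T assume T: "T \<in> link_sets B V v"
      obtain i j where ij: "card T = Suc i" "Suc m - card T = Suc j" "card (V - {v} - T) = Suc j" "i \<le> m" "j \<le> m"
        by (rule D.link_sizes[OF T])
      have "all_subsets T (restriction D.B' T)" "all_subsets (V - {v} - T) (contraction (V - {v}) D.B' T)"
        using all D.link_subset[OF T] by (auto simp: all_subsets_def restriction_def contraction_def)
      then show "face_sum a t T (restriction D.B' T) = complete_poly s d (card T) \<and>
         face_sum a t (V - {v} - T) (contraction (V - {v}) D.B' T) = complete_poly s d (Suc m - card T)"
        unfolding ij(2) unfolding ij(1)
        using less.IH[OF _ D.link_ordered(1)[OF T] _ ij(1)] less.IH[OF _ D.link_ordered(2)[OF T] _ ij(3)] ij Suc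
        by simp
    qed
    then show ?thesis using Suc by simp
  qed
qed

text \<open>
  The sets \<open>T\<close> are those that contain the centre; restricting to them gives stars and
  contracting them gives complete graphs.  The centre has to come first in the order, since the last
  vertex is the one that is removed.
\<close>
theorem face_sum_star:
  assumes "ordered_building_set V B r" "all_through c V B" "card V = Suc n" "\<And>y. y \<in> V \<Longrightarrow> r c \<le> r y"
  shows "face_sum a t V B = star_poly s d (Suc n)"
  using assms
proof (induction n arbitrary: V B rule: less_induct)
  case (less n)
  interpret ordered_building_set V B r by fact
  show ?case
  proof (cases n)
    case 0
    then show ?thesis using face_sum_single accessible_building_set_axioms less by simp
  next
    case (Suc m)
    then obtain v where "deletion_step V B r v m" using deletion_step_exists less.prems(3) by metis
    then interpret D: deletion_step V B r v m .
    have "v \<noteq> c"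
    proof
      assume "v = c"
      then have "r y = r v" if "y \<in> V" for y using D.last_max[OF that] less.prems(4)[OF that] by simp
      then have "V = {v}" using inj_onD[OF inj_rank] D.last_mem by blast
      then show False using D.V_not_single by simp
    qed
    then have c: "c \<in> V - {v}" using less.prems(2) by (auto simp: all_through_def)
    have all: "all_through c T (restriction B T)" if "T \<subseteq> V" "c \<in> T" for T
      using less.prems(2) that by (auto simp: all_through_def restriction_def)
    have cT: "c \<in> T" if "T \<in> link_sets B V v" for T
    proof -
      have "finite T" "v \<notin> T" using D.link_subset[OF that] finite_V finite_subset by auto
      then have "card (insert v T) \<noteq> 1" using D.link_card(1)[OF that] by auto
      then show ?thesis using less.prems(2) D.link_insert[OF that] c by (auto simp: all_through_def)
    qed
    have "face_sum a t V B = d * star_poly s d (Suc m) +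
       s * (\<Sum>k=1..m. of_nat (m choose (k - 1)) * (star_poly s d k * complete_poly s d (Suc m - k)))"
    proof (rule D.face_sum_by_card[OF s d])
      show "face_sum a t (V - {v}) D.B' = star_poly s d (Suc m)"
        by (rule less.IH[OF _ D.ordered_V' all D.card_V']) (use c Suc less.prems(4) in auto)
    next
      fix k assume k: "k \<in> {1..m}"
      have "{T \<in> link_sets B V v. card T = k} = {T. T \<subseteq> V - {v} \<and> c \<in> T \<and> card T = k}"
      proof (intro equalityI subsetI)
        fix T assume "T \<in> {T \<in> link_sets B V v. card T = k}"
        then show "T \<in> {T. T \<subseteq> V - {v} \<and> c \<in> T \<and> card T = k}" using cT[of T] D.link_subset[of T] by auto
      next
        fix T assume T: "T \<in> {T. T \<subseteq> V - {v} \<and> c \<in> T \<and> card T = k}"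
        then have "T \<in> B" "insert v T \<in> B" using less.prems(2) D.last_mem by (auto simp: all_through_def)
        moreover have "T \<noteq> V - {v}" using T k D.card_V' by auto
        ultimately show "T \<in> {T \<in> link_sets B V v. card T = k}"
          using T by (auto simp: link_sets_def restriction_def)
      qed
      then show "card {T \<in> link_sets B V v. card T = k} = m choose (k - 1)"
        using card_subsets_through[of "V - {v}" c m k] finite_V D.card_V' c k by simp
    next
      fix T assume T: "T \<in> link_sets B V v"
      obtain i j where ij: "card T = Suc i" "Suc m - card T = Suc j" "card (V - {v} - T) = Suc j" "i \<le> m" "j \<le> m"
        by (rule D.link_sizes[OF T])
      have sub: "T \<subseteq> V - {v}" using D.link_subset[OF T] by auto
      have "restriction D.B' T = restriction B T" using sub by (auto simp: restriction_def)
      then have allT: "all_through c T (restriction D.B' T)" using all cT[OF T] sub by auto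
      have 1: "face_sum a t T (restriction D.B' T) = star_poly s d (Suc i)"
        by (rule less.IH[OF _ D.link_ordered(1)[OF T] allT ij(1)]) (use ij(4) Suc less.prems(4) sub in auto)
      have "all_subsets (V - {v} - T) (contraction (V - {v}) D.B' T)"
        unfolding all_subsets_def
      proof (intro allI impI)
        fix S assume S: "S \<noteq> {}" "S \<subseteq> V - {v} - T"
        have "c \<in> S \<union> T" "S \<union> T \<subseteq> V" "S \<union> T \<subseteq> V - {v}" using cT[OF T] S sub by auto
        then have "S \<union> T \<in> D.B'" using less.prems(2) by (simp add: all_through_def restriction_def)
        then show "S \<in> contraction (V - {v}) D.B' T" using S by (simp add: contraction_def)
      qed
      then have "face_sum a t (V - {v} - T) (contraction (V - {v}) D.B' T) = complete_poly s d (Suc j)"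
        using face_sum_complete[OF D.link_ordered(2)[OF T]] ij(3) by simp
      then show "face_sum a t T (restriction D.B' T) = star_poly s d (card T) \<and>
         face_sum a t (V - {v} - T) (contraction (V - {v}) D.B' T) = complete_poly s d (Suc m - card T)"
        using 1 unfolding ij(2) unfolding ij(1) by simp
    qed
    then show ?thesis using Suc by simp
  qed
qed

text \<open>
  Restrictions to \<open>T\<close> are again trees and are bounded by induction; contractions are bounded by the
  complete graph.
\<close>
theorem face_sum_tree_le_star:
  assumes "ordered_building_set V B r" "has_parents r p B" "card V = Suc n"
  shows "gamma_le s d n (face_sum a t V B) (star_poly s d (Suc n))"
  using assms
proof (induction n arbitrary: V B rule: less_induct)
  case (less n)
  interpret ordered_building_set V B r by fact
  show ?case
  proof (cases n)
    case 0
    then have "face_sum a t V B = 1" using face_sum_single accessible_building_set_axioms less by simp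
    then show ?thesis using 0 gamma_le_base by simp
  next
    case (Suc m)
    then obtain v where "deletion_step V B r v m" using deletion_step_exists less.prems(3) by metis
    then interpret D: deletion_step V B r v m .
    have par: "has_parents r p D.B'" using has_parents_restrict[OF less.prems(2)] .
    note IH = less.IH[OF _ D.ordered_V' par D.card_V']
    let ?f = "\<lambda>T. face_sum a t T (restriction D.B' T) *
      face_sum a t (V - {v} - T) (contraction (V - {v}) D.B' T)"
    have T: "gamma_le s d (m - 1) (?f T) (star_poly s d (card T) * complete_poly s d (Suc m - card T))"
      if "T \<in> link_sets B V v" for T
    proof -
      obtain i j where ij: "card T = Suc i" "Suc m - card T = Suc j" "card (V - {v} - T) = Suc j"
        "i \<le> m" "j \<le> m" "i + j = m - 1"
        by (rule D.link_sizes[OF \<open>T \<in> link_sets B V v\<close>])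
      show ?thesis unfolding ij(2) unfolding ij(1) ij(6)[symmetric]
        using less.IH[of i, OF _ D.link_ordered(1)[OF that] has_parents_restrict[OF par] ij(1)]
          face_sum_bounds[OF s d D.link_ordered(2)[OF that] ij(3)] ij(4) Suc
        by (intro gamma_le_mult) auto
    qed
    show ?thesis
      using gamma_le_recursion[OF IH D.links_sum_le[where f = ?f, OF T D.links_card_le_tree[OF less.prems(2)]]]
        D.no_links
      unfolding Suc D.face_sum_step s d by simp
  qed
qed

end

section \<open>From the cone to the four invariants\<close>

abbreviation sym_s :: "int poly poly" where "sym_s \<equiv> var_alpha * var_t"
abbreviation sym_d :: "int poly poly" where "sym_d \<equiv> var_alpha + var_t"

lemma var_alpha_power: "var_alpha ^ k = monom 1 k"
  by (simp add: var_alpha_def monom_altdef)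

lemma var_t_power: "var_t ^ k = monom (monom 1 k) 0"
  by (induction k) (simp_all add: var_t_def mult_monom monom_0 monom_Suc one_pCons)

lemma coeff_bivariate:
  "coeff (coeff (of_nat c * var_alpha ^ k * var_t ^ l) a) b = (if a = k \<and> b = l then int c else 0)"
proof -
  have "of_nat c = (monom (monom (int c) 0) 0 :: int poly poly)" by (simp add: of_nat_poly monom_0)
  then show ?thesis by (simp add: var_alpha_power var_t_power mult_monom)
qed

lemma coeff_sym_monom:
  "coeff (coeff (sym_s ^ i * sym_d ^ j) a) b =
     (if i \<le> a \<and> i \<le> b \<and> a + b = 2 * i + j then int (j choose (a - i)) else 0)"
proof -
  have "sym_s ^ i * sym_d ^ j =
      (\<Sum>k\<le>j. of_nat (j choose k) * var_alpha ^ (i + k) * var_t ^ (i + (j - k)))"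
    unfolding binomial_ring sum_distrib_left power_mult_distrib power_add
    by (intro sum.cong refl) (simp add: mult_ac)
  then have "coeff (coeff (sym_s ^ i * sym_d ^ j) a) b =
      (\<Sum>k\<le>j. if a = i + k \<and> b = i + (j - k) then int (j choose k) else 0)"
    by (simp only: coeff_sum coeff_bivariate)
  also have "\<dots> = (if i \<le> a \<and> i \<le> b \<and> a + b = 2 * i + j then int (j choose (a - i)) else 0)"
  proof (cases "i \<le> a \<and> i \<le> b \<and> a + b = 2 * i + j")
    case True
    have "(\<Sum>k\<le>j. if a = i + k \<and> b = i + (j - k) then int (j choose k) else 0) =
        (\<Sum>k\<le>j. if k = a - i then int (j choose k) else 0)"
      by (rule sum.cong) (use True in auto)
    also have "\<dots> = int (j choose (a - i))" using True by (subst sum.delta) auto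
    finally show ?thesis using True by simp
  next
    case False
    then show ?thesis by (subst sum.neutral) auto
  qed
  finally show ?thesis .
qed

lemma gamma_cone_coeff_nonneg:
  assumes "p \<in> gamma_cone sym_s sym_d n"
  shows "coeff (coeff p a) b \<ge> 0"
  using assms by induction (auto simp: coeff_sym_monom)

text \<open>
  The monomial \<open>(\<alpha> t)^i (\<alpha> + t)^j\<close> has the binomial coefficients of \<open>j\<close>, shifted so that they are
  symmetric about half of \<open>n\<close>; these increase up to the middle.
\<close>
lemma gamma_cone_coeff_unimodal:
  assumes "p \<in> gamma_cone sym_s sym_d n" "2 * Suc b \<le> n"
  shows "coeff (coeff p (n - b)) b \<le> coeff (coeff p (n - Suc b)) (Suc b)"
  using assms(1)
proof induction
  case (gamma_cone_step p i j)
  have "coeff (coeff (sym_s ^ i * sym_d ^ j) (n - b)) b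
      \<le> coeff (coeff (sym_s ^ i * sym_d ^ j) (n - Suc b)) (Suc b)"
  proof (cases "i \<le> b")
    case True
    have "j choose (n - b - i) = j choose (b - i)" "j choose (n - Suc b - i) = j choose Suc (b - i)"
      using gamma_cone_step(2) assms(2) True binomial_symmetric[of "b - i" j] binomial_symmetric[of "Suc (b - i)" j]
      by (auto simp: algebra_simps intro!: arg_cong[of _ _ "(choose) j"])
    moreover have "j choose (b - i) \<le> j choose Suc (b - i)"
      using gamma_cone_step(2) assms(2) True by (intro binomial_mono) auto
    ultimately show ?thesis using gamma_cone_step(2) assms(2) True by (auto simp: coeff_sym_monom)
  qed (auto simp: coeff_sym_monom)
  then show ?case using gamma_cone_step by simp
qed simp

lemma pcompose_power: "pcompose (p ^ k) q = pcompose p q ^ k"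
  by (induction k) (simp_all add: pcompose_mult pcompose_1)

text \<open>
  Substituting \<open>\<alpha> + t\<close> for \<open>\<alpha>\<close> turns \<open>H\<close> into \<open>F\<close> and maps the generators of the cone to polynomials
  with non-negative coefficients.
\<close>
lemma gamma_cone_compose_nonneg:
  assumes "p \<in> gamma_cone sym_s sym_d n"
  shows "coeff (coeff (pcompose p sym_d) a) b \<ge> 0"
proof -
  let ?nn = "\<lambda>p::int poly poly. \<forall>a b. coeff (coeff p a) b \<ge> 0"
  have mult: "?nn (p * q)" if "?nn p" "?nn q" for p q
    using that by (auto simp: coeff_mult coeff_sum intro!: sum_nonneg)
  have "?nn 1" by (auto simp: one_pCons coeff_pCons split: nat.splits)
  then have power: "?nn (p ^ k)" if "?nn p" for p k
    using that mult by (induction k) auto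
  have base: "?nn var_alpha" "?nn var_t"
    by (auto simp: var_alpha_def var_t_def coeff_pCons split: nat.splits)
  have add: "?nn (p + q)" if "?nn p" "?nn q" for p q using that by auto
  have "pcompose var_alpha sym_d = sym_d" "pcompose var_t sym_d = var_t"
    by (simp_all add: var_alpha_def var_t_def pcompose_pCons)
  then have comp: "pcompose (sym_s ^ i * sym_d ^ j) sym_d = (sym_d * var_t) ^ i * (sym_d + var_t) ^ j" for i j
    by (simp add: pcompose_mult pcompose_add pcompose_power)
  have "?nn (pcompose p sym_d)" using assms
  proof induction
    case (gamma_cone_step p i j)
    have "?nn ((sym_d * var_t) ^ i * (sym_d + var_t) ^ j)"
      by (intro mult power add base)
    then show ?case using gamma_cone_step comp by (simp add: pcompose_add)
  qed simp
  then show ?thesis by blast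
qed

definition gamma_expansion :: "nat \<Rightarrow> (nat \<Rightarrow> int) \<Rightarrow> int poly poly" where
  "gamma_expansion n c = (\<Sum>i\<le>n div 2. of_int (c i) * sym_s ^ i * sym_d ^ (n - 2 * i))"

lemma gamma_cone_expansion:
  assumes "p \<in> gamma_cone sym_s sym_d n"
  shows "\<exists>c. (\<forall>i. c i \<ge> 0) \<and> (\<forall>i>n div 2. c i = 0) \<and> p = gamma_expansion n c"
  using assms
proof induction
  case gamma_cone_zero
  show ?case by (rule exI[of _ "\<lambda>_. 0"]) (simp add: gamma_expansion_def)
next
  case (gamma_cone_step p i j)
  then obtain c where c: "\<forall>i. c i \<ge> 0" "\<forall>i>n div 2. c i = 0" "p = gamma_expansion n c" by blast
  have i: "i \<le> n div 2" "n - 2 * i = j" using gamma_cone_step(2) by auto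
  have "gamma_expansion n (\<lambda>k. c k + (if k = i then 1 else 0)) =
      gamma_expansion n c + (\<Sum>k\<le>n div 2. if k = i then sym_s ^ i * sym_d ^ j else 0)"
    unfolding gamma_expansion_def sum.distrib[symmetric]
    by (rule sum.cong) (auto simp: distrib_right i(2))
  also have "\<dots> = p + sym_s ^ i * sym_d ^ j" using i c by simp
  finally show ?case using c i
    by (intro exI[of _ "\<lambda>k. c k + (if k = i then 1 else 0)"]) auto
qed

text \<open>
  The coefficient of \<open>\<alpha>^(n - i) t^i\<close> is \<open>c i\<close> plus a combination of the earlier \<open>c k\<close>.
\<close>
lemma gamma_expansion_inj:
  assumes "gamma_expansion n c = gamma_expansion n c'" "i \<le> n div 2"
  shows "c i = c' i"
  using assms(2)
proof (induction i rule: less_induct)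
  case (less i)
  have co: "coeff (coeff (gamma_expansion n c) (n - i)) i =
      c i + (\<Sum>k<i. c k * int ((n - 2 * k) choose (n - i - k)))" for c
  proof -
    have "coeff (coeff (gamma_expansion n c) (n - i)) i =
        (\<Sum>k\<le>n div 2. c k * coeff (coeff (sym_s ^ k * sym_d ^ (n - 2 * k)) (n - i)) i)"
      by (simp add: gamma_expansion_def coeff_sum mult.assoc of_int_poly)
    also have "\<dots> = (\<Sum>k\<le>i. c k * int ((n - 2 * k) choose (n - i - k)))"
      using less.prems by (intro sum.mono_neutral_cong_right) (auto simp: coeff_sym_monom)
    also have "\<dots> = c i + (\<Sum>k<i. c k * int ((n - 2 * k) choose (n - i - k)))"
      using less.prems by (simp add: lessThan_Suc_atMost[symmetric] mult_2)
    finally show ?thesis .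
  qed
  have "(\<Sum>k<i. c k * int ((n - 2 * k) choose (n - i - k))) = (\<Sum>k<i. c' k * int ((n - 2 * k) choose (n - i - k)))"
    using less by (intro sum.cong) auto
  then show ?case using co[of c] co[of c'] assms(1) by simp
qed

lemma gamma_num_eq:
  assumes "pdim P = n" "H_poly P = gamma_expansion n c" "\<forall>i>n div 2. c i = 0"
  shows "gamma_num P = c"
  unfolding gamma_num_def assms(1)
proof (rule the_equality)
  show "(\<forall>i>n div 2. c i = 0) \<and> H_poly P =
      (\<Sum>i\<le>n div 2. of_int (c i) * sym_s ^ i * sym_d ^ (n - 2 * i))"
    using assms by (simp add: gamma_expansion_def)
  fix c' assume c': "(\<forall>i>n div 2. c' i = 0) \<and> H_poly P =
      (\<Sum>i\<le>n div 2. of_int (c' i) * sym_s ^ i * sym_d ^ (n - 2 * i))"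
  then have "gamma_expansion n c' = gamma_expansion n c" using assms by (simp add: gamma_expansion_def)
  then have "c' i = c i" for i
    using gamma_expansion_inj[of n c' c i] c' assms(3) by (cases "i \<le> n div 2") auto
  then show "c' = c" by blast
qed

lemma coeff_F_poly:
  assumes "i \<le> pdim P"
  shows "coeff (coeff (F_poly P) i) (pdim P - i) = int (f_num P i)"
proof -
  have "coeff (coeff (F_poly P) i) (pdim P - i) =
      (\<Sum>k\<le>pdim P. if i = k \<and> pdim P - i = pdim P - k then int (f_num P k) else 0)"
    by (simp only: F_poly_def coeff_sum coeff_bivariate)
  also have "\<dots> = (\<Sum>k\<le>pdim P. if k = i then int (f_num P k) else 0)" by (rule sum.cong) auto
  finally show ?thesis using assms by simp
qed

lemma F_poly_from_H_poly: "F_poly P = pcompose (H_poly P) sym_d"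
proof -
  have "pcompose (var_alpha - var_t) sym_d = var_alpha"
    by (simp add: pcompose_diff var_alpha_def var_t_def pcompose_pCons)
  then have "pcompose (H_poly P) sym_d = pcompose (F_poly P) var_alpha"
    by (simp add: H_poly_def pcompose_assoc[symmetric])
  then show ?thesis by (simp add: var_alpha_def pcompose_idR)
qed

text \<open>
  Each of the four invariants is additive in \<open>H\<close> except for \<open>g_num\<close> at 0, which is always 1.
  So it suffices that the invariants of an element of the cone are non-negative.
\<close>
theorem gamma_le_invariants:
  fixes P Q :: "'a::euclidean_space set"
  assumes dim: "pdim P = n" "pdim Q = n" and le: "gamma_le sym_s sym_d n (H_poly P) (H_poly Q)"
  shows "gamma_num P i \<le> gamma_num Q i"
    and "i \<le> n div 2 \<Longrightarrow> g_num P i \<le> g_num Q i"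
    and "h_num P i \<le> h_num Q i"
    and "i \<le> n \<Longrightarrow> f_num P i \<le> f_num Q i"
proof -
  let ?D = "H_poly Q - H_poly P"
  have D: "?D \<in> gamma_cone sym_s sym_d n" and HP: "H_poly P \<in> gamma_cone sym_s sym_d n"
    using le by (auto simp: gamma_le_def)
  obtain c where c: "\<forall>i>n div 2. c i = 0" "H_poly P = gamma_expansion n c"
    using gamma_cone_expansion[OF HP] by blast
  obtain e where e: "\<forall>i. e i \<ge> 0" "\<forall>i>n div 2. e i = 0" "?D = gamma_expansion n e"
    using gamma_cone_expansion[OF D] by blast
  have "gamma_expansion n (\<lambda>i. c i + e i) = gamma_expansion n c + gamma_expansion n e"
    by (simp add: gamma_expansion_def distrib_right sum.distrib)
  then have "H_poly Q = gamma_expansion n (\<lambda>i. c i + e i)" using c(2) e(3) by simp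
  then have "gamma_num Q = (\<lambda>i. c i + e i)" using gamma_num_eq[OF dim(2)] c e by simp
  moreover have "gamma_num P = c" using gamma_num_eq[OF dim(1)] c by simp
  ultimately show "gamma_num P i \<le> gamma_num Q i" using e(1) by simp
  show "h_num P i \<le> h_num Q i"
    using gamma_cone_coeff_nonneg[OF D, of "n - i" i] by (simp add: h_num_def dim)
  show "g_num P i \<le> g_num Q i" if "i \<le> n div 2"
  proof (cases i)
    case (Suc b)
    then have "2 * Suc b \<le> n" using that by auto
    then show ?thesis
      using gamma_cone_coeff_unimodal[OF D, of b] Suc by (simp add: g_num_def h_num_def dim)
  qed (simp add: g_num_def)
  assume "i \<le> n"
  then show "f_num P i \<le> f_num Q i"
    using gamma_cone_compose_nonneg[OF D, of i "n - i"] coeff_F_poly[of i P] coeff_F_poly[of i Q]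
    by (simp add: pcompose_diff F_poly_from_H_poly dim)
qed

section \<open>The faces of the Minkowski sum\<close>

locale nestohedron = accessible_building_set V B for V :: "'v set" and B +
  fixes e :: "'v \<Rightarrow> 'a::euclidean_space"
  assumes e_bij: "bij_betw e V Basis"
begin

definition minkowski_sum :: "'a set" where
  "minkowski_sum = (\<Sum>S\<in>B. convex hull (e ` S))"

definition argmax :: "('v \<Rightarrow> real) \<Rightarrow> 'v set \<Rightarrow> 'v set" where
  "argmax w S = {i \<in> S. \<forall>j\<in>S. w j \<le> w i}"

text \<open>
  With \<open>M S = argmax w S\<close> this is the face on which the functional with weights \<open>w\<close> is maximal.
\<close>
definition face_for :: "('v set \<Rightarrow> 'v set) \<Rightarrow> 'a set" where
  "face_for M = (\<Sum>S\<in>B. convex hull (e ` M S))"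

text \<open>
  The members of \<open>nest_of w\<close> are the connected components of the sublevel sets of \<open>w\<close>.
\<close>
definition nest_of :: "('v \<Rightarrow> real) \<Rightarrow> 'v set set" where
  "nest_of w = {S \<in> B. \<forall>S'\<in>B. S \<subset> S' \<longrightarrow> (\<exists>u\<in>S'. \<forall>v\<in>S. w v < w u)}"

text \<open>
  For \<open>S\<close> in \<open>N\<close> this is what is left of \<open>S\<close> after removal of the smaller members of \<open>N\<close>.
\<close>
definition block :: "'v set set \<Rightarrow> 'v set \<Rightarrow> 'v set" where
  "block N S = {i \<in> S. \<forall>T\<in>N. i \<in> T \<longrightarrow> S \<subseteq> T}"

text \<open>
  The hyperplane of an inequality that is valid on the whole Minkowski sum: each summand inside \<open>S\<close> adds 1 to the
  coordinate sum over \<open>S\<close>, and no summand makes it smaller.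
\<close>
definition tight :: "'v set \<Rightarrow> 'a set" where
  "tight S = {x. (\<Sum>v\<in>S. x \<bullet> e v) = real (card {S' \<in> B. S' \<subseteq> S})}"

lemma e_inner: "u \<in> V \<Longrightarrow> v \<in> V \<Longrightarrow> e u \<bullet> e v = (if u = v then 1 else 0)"
  by (simp add: inner_Basis bij_betw_apply[OF e_bij] inj_on_eq_iff[OF bij_betw_imp_inj_on[OF e_bij]])

lemma sum_e: "(\<Sum>v\<in>V. (x \<bullet> e v) *\<^sub>R e v) = x"
  using euclidean_representation[of x] sum.reindex_bij_betw[OF e_bij, of "\<lambda>b. (x \<bullet> b) *\<^sub>R b"] by simp

lemma weighted_inner: "u \<in> V \<Longrightarrow> (\<Sum>v\<in>V. w v *\<^sub>R e v) \<bullet> e u = w u"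
  using finite_V by (simp add: inner_sum_left e_inner if_distrib[of "\<lambda>x. _ * x"] cong: if_cong)

lemma mem_face_for: "x \<in> face_for M \<longleftrightarrow> (\<exists>y. x = sum y B \<and> (\<forall>S\<in>B. y S \<in> convex hull (e ` M S)))"
  unfolding face_for_def by (subst set_sum_alt[OF finite_B]) blast

lemma minkowski_sum_eq: "minkowski_sum = face_for (\<lambda>S. S)"
  by (simp add: minkowski_sum_def face_for_def)

lemma mem_simplex:
  assumes "S \<subseteq> V"
  shows "x \<in> convex hull (e ` S) \<longleftrightarrow>
    (\<forall>v\<in>V. 0 \<le> x \<bullet> e v) \<and> (\<forall>v\<in>V - S. x \<bullet> e v = 0) \<and> (\<Sum>v\<in>S. x \<bullet> e v) = 1"
proof
  let ?R = "{x. (\<forall>v\<in>V. 0 \<le> x \<bullet> e v) \<and> (\<forall>v\<in>V - S. x \<bullet> e v = 0) \<and> (\<Sum>v\<in>S. x \<bullet> e v) = 1}"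
  have fin: "finite S" using assms finite_V finite_subset by blast
  assume "x \<in> convex hull (e ` S)"
  moreover have "convex hull (e ` S) \<subseteq> ?R"
  proof (rule hull_minimal)
    show "e ` S \<subseteq> ?R"
    proof
      fix y assume "y \<in> e ` S"
      then obtain u where u: "u \<in> S" "y = e u" by auto
      have "(\<Sum>v\<in>S. e u \<bullet> e v) = (\<Sum>v\<in>S. if u = v then 1 else 0)"
        by (intro sum.cong refl e_inner) (use u assms in auto)
      then have "(\<Sum>v\<in>S. e u \<bullet> e v) = 1" using fin u by simp
      moreover have "u \<in> V" using u assms by auto
      ultimately show "y \<in> ?R" using u by (auto simp: e_inner)
    qed
    show "convex ?R"
      by (rule convexI) (auto simp: inner_add_left sum.distrib sum_distrib_left[symmetric])
  qed
  ultimately show "(\<forall>v\<in>V. 0 \<le> x \<bullet> e v) \<and> (\<forall>v\<in>V - S. x \<bullet> e v = 0) \<and> (\<Sum>v\<in>S. x \<bullet> e v) = 1" by blast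
next
  assume r: "(\<forall>v\<in>V. 0 \<le> x \<bullet> e v) \<and> (\<forall>v\<in>V - S. x \<bullet> e v = 0) \<and> (\<Sum>v\<in>S. x \<bullet> e v) = 1"
  have fin: "finite S" using assms finite_V finite_subset by blast
  have "(\<Sum>v\<in>V. (x \<bullet> e v) *\<^sub>R e v) = (\<Sum>v\<in>S. (x \<bullet> e v) *\<^sub>R e v)"
    using r assms finite_V by (intro sum.mono_neutral_right) auto
  then have x: "x = (\<Sum>v\<in>S. (x \<bullet> e v) *\<^sub>R e v)" using sum_e[of x] by simp
  have "(\<Sum>v\<in>S. (x \<bullet> e v) *\<^sub>R e v) \<in> convex hull (e ` S)"
    using r assms by (intro convex_sum[OF fin convex_convex_hull]) (auto intro: hull_inc)
  then show "x \<in> convex hull (e ` S)" using x by simp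
qed

lemma argmax_subset: "argmax w S \<subseteq> S"
  by (auto simp: argmax_def)

lemma argmax_nonempty:
  assumes "S \<in> B"
  shows "argmax w S \<noteq> {}"
proof -
  have "finite (w ` S)" "w ` S \<noteq> {}" using finite_mem nonempty assms by auto
  then have "Max (w ` S) \<in> w ` S" by (rule Max_in)
  then obtain i where i: "i \<in> S" "Max (w ` S) = w i" by blast
  have "w j \<le> w i" if "j \<in> S" for j
    unfolding i(2)[symmetric] using \<open>finite (w ` S)\<close> that by simp
  then show ?thesis using i(1) by (auto simp: argmax_def)
qed

text \<open>
  On the simplex the functional is a weighted mean of the weights of its vertices.
\<close>
lemma simplex_support:
  assumes S: "S \<in> B" and w: "\<And>v. v \<in> V \<Longrightarrow> w v = a \<bullet> e v" and x: "x \<in> convex hull (e ` S)"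
  shows "a \<bullet> x \<le> Max (w ` S)" and "a \<bullet> x = Max (w ` S) \<longleftrightarrow> x \<in> convex hull (e ` argmax w S)"
proof -
  have SV: "S \<subseteq> V" using subset_V S by blast
  have fin: "finite S" using finite_mem S .
  let ?m = "Max (w ` S)"
  have r: "\<And>v. v \<in> V \<Longrightarrow> 0 \<le> x \<bullet> e v" "\<And>v. v \<in> V - S \<Longrightarrow> x \<bullet> e v = 0" "(\<Sum>v\<in>S. x \<bullet> e v) = 1"
    using x mem_simplex[OF SV] by auto
  have "a \<bullet> x = a \<bullet> (\<Sum>v\<in>V. (x \<bullet> e v) *\<^sub>R e v)" using sum_e[of x] by simp
  also have "\<dots> = (\<Sum>v\<in>V. (x \<bullet> e v) * w v)" using w by (simp add: inner_sum_right)
  also have "\<dots> = (\<Sum>v\<in>S. (x \<bullet> e v) * w v)"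
    using r(2) SV finite_V by (intro sum.mono_neutral_right) auto
  finally have ax: "a \<bullet> x = (\<Sum>v\<in>S. (x \<bullet> e v) * w v)" .
  have "?m = (\<Sum>v\<in>S. (x \<bullet> e v) * ?m)" using r(3) by (simp add: sum_distrib_right[symmetric])
  then have diff: "?m - a \<bullet> x = (\<Sum>v\<in>S. (x \<bullet> e v) * (?m - w v))"
    unfolding ax by (simp add: sum_subtractf right_diff_distrib)
  have nn: "0 \<le> (x \<bullet> e v) * (?m - w v)" if "v \<in> S" for v
    using r(1) that SV fin by (intro mult_nonneg_nonneg) auto
  show "a \<bullet> x \<le> ?m" using diff sum_nonneg[of S "\<lambda>v. (x \<bullet> e v) * (?m - w v)"] nn by simp
  have am: "v \<in> argmax w S \<longleftrightarrow> v \<in> S \<and> w v = ?m" for v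
  proof
    assume "v \<in> argmax w S"
    then show "v \<in> S \<and> w v = ?m" using fin by (auto simp: argmax_def intro!: Max_eqI[symmetric])
  qed (use fin in \<open>auto simp: argmax_def\<close>)
  have "a \<bullet> x = ?m \<longleftrightarrow> (\<Sum>v\<in>S. (x \<bullet> e v) * (?m - w v)) = 0" using diff by auto
  also have "\<dots> \<longleftrightarrow> (\<forall>v\<in>S. (x \<bullet> e v) * (?m - w v) = 0)"
    using sum_nonneg_eq_0_iff[OF fin nn] by simp
  also have "\<dots> \<longleftrightarrow> (\<forall>v\<in>S - argmax w S. x \<bullet> e v = 0)" using am by auto
  also have "\<dots> \<longleftrightarrow> x \<in> convex hull (e ` argmax w S)"
  proof
    assume z: "\<forall>v\<in>S - argmax w S. x \<bullet> e v = 0"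
    then have "(\<Sum>v\<in>argmax w S. x \<bullet> e v) = (\<Sum>v\<in>S. x \<bullet> e v)"
      using fin argmax_subset by (intro sum.mono_neutral_left) auto
    moreover have "\<forall>v\<in>V - argmax w S. x \<bullet> e v = 0" using z r(2) by auto
    moreover have "argmax w S \<subseteq> V" using SV argmax_subset[of w S] by auto
    ultimately show "x \<in> convex hull (e ` argmax w S)" using r by (simp add: mem_simplex)
  next
    have "argmax w S \<subseteq> V" using SV argmax_subset[of w S] by auto
    moreover assume "x \<in> convex hull (e ` argmax w S)"
    ultimately show "\<forall>v\<in>S - argmax w S. x \<bullet> e v = 0" using mem_simplex SV by auto
  qed
  finally show "a \<bullet> x = ?m \<longleftrightarrow> x \<in> convex hull (e ` argmax w S)" .
qed

lemma polytope_minkowski_sum: "polytope minkowski_sum"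
proof -
  have "minkowski_sum = convex hull (\<Sum>S\<in>B. e ` S)" by (simp add: minkowski_sum_def convex_hull_set_sum)
  moreover have "finite (\<Sum>S\<in>B. e ` S)"
    by (rule finite_set_sum) (use finite_mem in auto)
  ultimately show ?thesis by (simp add: polytope_convex_hull)
qed

lemma face_for_argmax:
  assumes w: "\<And>v. v \<in> V \<Longrightarrow> w v = a \<bullet> e v"
  shows "minkowski_sum \<subseteq> {x. a \<bullet> x \<le> (\<Sum>S\<in>B. Max (w ` S))}"
    and "face_for (argmax w) = minkowski_sum \<inter> {x. a \<bullet> x = (\<Sum>S\<in>B. Max (w ` S))}"
proof -
  show le: "minkowski_sum \<subseteq> {x. a \<bullet> x \<le> (\<Sum>S\<in>B. Max (w ` S))}"
    using simplex_support(1)[OF _ w]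
    by (auto simp: minkowski_sum_eq mem_face_for inner_sum_right intro!: sum_mono)
  have sub: "convex hull (e ` argmax w S) \<subseteq> convex hull (e ` S)" for S
    using argmax_subset by (intro hull_mono image_mono)
  have iff: "a \<bullet> sum y B = (\<Sum>S\<in>B. Max (w ` S)) \<longleftrightarrow> (\<forall>S\<in>B. y S \<in> convex hull (e ` argmax w S))"
    if y: "\<forall>S\<in>B. y S \<in> convex hull (e ` S)" for y
  proof -
    have "a \<bullet> sum y B = (\<Sum>S\<in>B. Max (w ` S)) \<longleftrightarrow> (\<Sum>S\<in>B. Max (w ` S) - a \<bullet> y S) = 0"
      by (auto simp: inner_sum_right sum_subtractf)
    also have "\<dots> \<longleftrightarrow> (\<forall>S\<in>B. Max (w ` S) - a \<bullet> y S = 0)"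
      using simplex_support(1)[OF _ w] y by (intro sum_nonneg_eq_0_iff finite_B) auto
    also have "\<dots> \<longleftrightarrow> (\<forall>S\<in>B. a \<bullet> y S = Max (w ` S))" by auto
    also have "\<dots> \<longleftrightarrow> (\<forall>S\<in>B. y S \<in> convex hull (e ` argmax w S))"
      using simplex_support(2)[OF _ w] y by auto
    finally show ?thesis .
  qed
  show "face_for (argmax w) = minkowski_sum \<inter> {x. a \<bullet> x = (\<Sum>S\<in>B. Max (w ` S))}"
  proof (intro equalityI subsetI)
    fix x assume "x \<in> face_for (argmax w)"
    then obtain y where y: "x = sum y B" "\<forall>S\<in>B. y S \<in> convex hull (e ` argmax w S)"
      by (auto simp: mem_face_for)
    then have y': "\<forall>S\<in>B. y S \<in> convex hull (e ` S)" using sub by blast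
    then show "x \<in> minkowski_sum \<inter> {x. a \<bullet> x = (\<Sum>S\<in>B. Max (w ` S))}"
      using iff[OF y'] y by (auto simp: minkowski_sum_eq mem_face_for)
  next
    fix x assume x: "x \<in> minkowski_sum \<inter> {x. a \<bullet> x = (\<Sum>S\<in>B. Max (w ` S))}"
    then obtain y where y: "x = sum y B" "\<forall>S\<in>B. y S \<in> convex hull (e ` S)"
      by (auto simp: minkowski_sum_eq mem_face_for)
    then show "x \<in> face_for (argmax w)" using iff[OF y(2)] x by (auto simp: mem_face_for)
  qed
qed

lemma vertex_mem_face:
  assumes "\<And>S. S \<in> B \<Longrightarrow> \<sigma> S \<in> M S"
  shows "(\<Sum>S\<in>B. e (\<sigma> S)) \<in> face_for M"
  using assms by (auto simp: mem_face_for intro!: exI[of _ "\<lambda>S. e (\<sigma> S)"] hull_inc)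

lemma face_for_nonempty:
  assumes "\<And>S. S \<in> B \<Longrightarrow> M S \<noteq> {}"
  shows "face_for M \<noteq> {}"
proof -
  have "(\<Sum>S\<in>B. e (SOME i. i \<in> M S)) \<in> face_for M"
    by (rule vertex_mem_face) (use assms in \<open>simp add: some_in_eq\<close>)
  then show ?thesis by blast
qed

text \<open>
  Faces of polytopes are exposed, so that each of them is the set of maximisers of a functional.
\<close>
theorem faces_eq: "{F. F face_of minkowski_sum \<and> F \<noteq> {}} = range (\<lambda>w. face_for (argmax w))"
proof (intro equalityI subsetI)
  fix F assume "F \<in> {F. F face_of minkowski_sum \<and> F \<noteq> {}}"
  then have F: "F face_of minkowski_sum" "F \<noteq> {}" by auto
  then have "F exposed_face_of minkowski_sum"
    using exposed_face_of_polyhedron polytope_imp_polyhedron[OF polytope_minkowski_sum] by blast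
  then obtain a b where ab: "minkowski_sum \<subseteq> {x. a \<bullet> x \<le> b}" "F = minkowski_sum \<inter> {x. a \<bullet> x = b}"
    unfolding exposed_face_of_def by blast
  define w where "w = (\<lambda>v. a \<bullet> e v)"
  note fa = face_for_argmax[of w a, unfolded w_def, OF refl, folded w_def]
  obtain z where z: "z \<in> face_for (argmax w)" using face_for_nonempty[of "argmax w", OF argmax_nonempty] by (meson all_not_in_conv)
  obtain x where x: "x \<in> F" using F(2) by blast
  have "z \<in> minkowski_sum" "a \<bullet> z = (\<Sum>S\<in>B. Max (w ` S))" using z unfolding fa(2) by simp_all
  then have "(\<Sum>S\<in>B. Max (w ` S)) \<le> b" using subsetD[OF ab(1)] by fastforce
  moreover have "x \<in> minkowski_sum" "a \<bullet> x = b" using x unfolding ab(2) by simp_all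
  then have "b \<le> (\<Sum>S\<in>B. Max (w ` S))" using subsetD[OF fa(1)] by fastforce
  ultimately have "F = face_for (argmax w)" using ab(2) fa(2) by simp
  then show "F \<in> range (\<lambda>w. face_for (argmax w))" by blast
next
  fix F assume "F \<in> range (\<lambda>w. face_for (argmax w))"
  then obtain w where F: "F = face_for (argmax w)" by blast
  define a where "a = (\<Sum>v\<in>V. w v *\<^sub>R e v)"
  have w: "w v = a \<bullet> e v" if "v \<in> V" for v using weighted_inner[OF that] by (simp add: a_def)
  have "(minkowski_sum \<inter> {x. a \<bullet> x = (\<Sum>S\<in>B. Max (w ` S))}) face_of minkowski_sum"
    using face_for_argmax(1)[OF w] polytope_imp_convex[OF polytope_minkowski_sum]
    by (intro face_of_Int_supporting_hyperplane_le) auto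
  then show "F \<in> {F. F face_of minkowski_sum \<and> F \<noteq> {}}"
    using F face_for_argmax(2)[OF w] face_for_nonempty[of "argmax w", OF argmax_nonempty] by simp
qed

text \<open>
  So the face depends only on the nested set of \<open>w\<close>.  If \<open>i\<close> is not maximal in \<open>S\<close>, the component of \<open>i\<close> in the
  sublevel set \<open>{v. w v \<le> w i}\<close> is a member that contains \<open>i\<close> but not all of \<open>S\<close>.
\<close>
lemma argmax_eq_block:
  assumes S: "S \<in> B"
  shows "argmax w S = block (nest_of w) S"
proof (intro equalityI subsetI)
  fix i assume i: "i \<in> argmax w S"
  have "S \<subseteq> T" if T: "T \<in> nest_of w" "i \<in> T" for T
  proof (rule ccontr)
    assume n: "\<not> S \<subseteq> T"
    have TB: "T \<in> B" using T by (auto simp: nest_of_def)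
    have "S \<union> T \<in> B" using S TB i T(2) by (intro union_mem) (auto simp: argmax_def)
    moreover have "T \<subset> S \<union> T" using n by auto
    ultimately obtain u where u: "u \<in> S \<union> T" "\<forall>v\<in>T. w v < w u" using T(1) unfolding nest_of_def by blast
    then have "u \<in> S" by auto
    then show False using u T(2) i by (fastforce simp: argmax_def)
  qed
  then show "i \<in> block (nest_of w) S" using i by (auto simp: block_def argmax_def)
next
  fix i assume i: "i \<in> block (nest_of w) S"
  show "i \<in> argmax w S"
  proof (rule ccontr)
    assume "i \<notin> argmax w S"
    then obtain u where u: "u \<in> S" "w i < w u" using i by (auto simp: argmax_def block_def)
    let ?C = "{T \<in> B. i \<in> T \<and> (\<forall>v\<in>T. w v \<le> w i)}"
    have "i \<in> V" using i subset_V[OF S] by (auto simp: block_def)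
    then have "{i} \<in> ?C" using singleton_mem by auto
    then have "\<exists>T\<in>?C. \<forall>T'\<in>?C. T \<subseteq> T' \<longrightarrow> T = T'"
      using finite_B by (intro finite_has_maximal) auto
    then obtain T where TC: "T \<in> ?C" and Tmax: "\<forall>T'\<in>?C. T \<subseteq> T' \<longrightarrow> T = T'" by (rule bexE)
    then have T: "T \<in> B" "i \<in> T" "\<forall>v\<in>T. w v \<le> w i" by simp_all
    have "T \<in> nest_of w" unfolding nest_of_def
    proof (intro CollectI conjI ballI impI T(1))
      fix S' assume S': "S' \<in> B" "T \<subset> S'"
      have "S' \<notin> ?C"
      proof
        assume "S' \<in> ?C"
        from bspec[OF Tmax this] show False using S'(2) by blast
      qed
      moreover have "i \<in> S'" using S' T(2) by blast
      ultimately have "\<not> (\<forall>v\<in>S'. w v \<le> w i)" using S'(1) by simp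
      then obtain u where "u \<in> S'" "w i < w u" by (meson not_le)
      then show "\<exists>u\<in>S'. \<forall>v\<in>T. w v < w u" using T(3) by (meson le_less_trans)
    qed
    then have "S \<subseteq> T" using i T(2) by (auto simp: block_def)
    then show False using u T(3) by force
  qed
qed

lemma nest_of_nested: "nest_of w \<in> nested_sets V B"
proof (rule nested_setsI)
  show "nest_of w \<subseteq> B" by (auto simp: nest_of_def)
  show "V \<in> nest_of w" using top_mem subset_V by (auto simp: nest_of_def)
  fix S T assume S: "S \<in> nest_of w" "T \<in> nest_of w" "S \<union> T \<in> B"
  show "S \<subseteq> T \<or> T \<subseteq> S"
  proof (rule ccontr)
    assume "\<not> ?thesis"
    then have "S \<subset> S \<union> T" "T \<subset> S \<union> T" by auto
    moreover have "\<exists>u\<in>S'. \<forall>v\<in>R. w v < w u" if "R \<in> nest_of w" "S' \<in> B" "R \<subset> S'" for R S'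
      using that by (simp add: nest_of_def)
    ultimately obtain u u' where u: "u \<in> S \<union> T" "\<forall>v\<in>S. w v < w u" "u' \<in> S \<union> T" "\<forall>v\<in>T. w v < w u'"
      using S by metis
    then have "u \<in> T" "u' \<in> S" by auto
    then show False using u by (meson less_asym)
  qed
qed

lemma least_above:
  assumes N: "N \<in> nested_sets V B" and i: "i \<in> V"
  shows "\<exists>T\<in>N. i \<in> T \<and> (\<forall>T'\<in>N. i \<in> T' \<longrightarrow> T \<subseteq> T')"
proof -
  let ?C = "{T \<in> N. i \<in> T}"
  have "V \<in> ?C" using nested_setsD(2)[OF N] i by simp
  then have "\<exists>T\<in>?C. \<forall>T'\<in>?C. T' \<subseteq> T \<longrightarrow> T = T'"
    using finite_nested[OF N] by (intro finite_has_minimal) auto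
  then obtain T where TC: "T \<in> ?C" and Tmin: "\<forall>T'\<in>?C. T' \<subseteq> T \<longrightarrow> T = T'" by (rule bexE)
  then have T: "T \<in> N" "i \<in> T" by simp_all
  have "T \<subseteq> T'" if "T' \<in> N" "i \<in> T'" for T'
  proof -
    have "T \<subseteq> T' \<or> T' \<subseteq> T" by (rule nested_comparable[OF N]) (use T that in auto)
    then show ?thesis using Tmin that by auto
  qed
  then show ?thesis using T by blast
qed

text \<open>
  A weight that decreases with the number of members through a vertex works.  By \<open>nested_witness\<close>
  the maximum of \<open>w\<close> over \<open>S\<close> is minus the number of members that contain all of \<open>S\<close>.
\<close>
lemma nest_of_surj:
  assumes N: "N \<in> nested_sets V B"
  shows "\<exists>w. nest_of w = N"
proof -
  define w where "w = (\<lambda>v. - real (card {T \<in> N. v \<in> T}))"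
  have finN: "finite N" using finite_nested[OF N] .
  have NB: "\<And>S. S \<in> N \<Longrightarrow> S \<in> B" using nested_setsD(1)[OF N] by auto
  have wit: "\<exists>i\<in>S. {T \<in> N. i \<in> T} = {T \<in> N. S \<subseteq> T}" if S: "S \<in> B" for S
  proof -
    obtain i where i: "i \<in> S" "\<And>T. T \<in> N \<Longrightarrow> i \<in> T \<Longrightarrow> S \<subseteq> T" using nested_witness[OF N S] by blast
    then have "{T \<in> N. i \<in> T} = {T \<in> N. S \<subseteq> T}" by auto
    then show ?thesis using i(1) by blast
  qed
  have le: "w v \<le> - real (card {T \<in> N. S \<subseteq> T})" if "v \<in> S" for v S
    unfolding w_def using finN that by (auto intro!: card_mono)
  have "S \<in> nest_of w" if S: "S \<in> N" for S
    unfolding nest_of_def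
  proof (intro CollectI conjI ballI impI NB[OF S])
    fix S' assume S': "S' \<in> B" "S \<subset> S'"
    obtain u where u: "u \<in> S'" "{T \<in> N. u \<in> T} = {T \<in> N. S' \<subseteq> T}" using wit[OF S'(1)] by blast
    have "{T \<in> N. S' \<subseteq> T} \<subset> {T \<in> N. S \<subseteq> T}" using S S'(2) by blast
    then have "card {T \<in> N. S' \<subseteq> T} < card {T \<in> N. S \<subseteq> T}" using finN by (intro psubset_card_mono) auto
    then have "- real (card {T \<in> N. S \<subseteq> T}) < w u" by (simp add: w_def u(2))
    then show "\<exists>u\<in>S'. \<forall>v\<in>S. w v < w u" using u(1) le[of _ S] by (meson le_less_trans)
  qed
  moreover have "S \<in> N" if S: "S \<in> nest_of w" for S
  proof (rule ccontr)
    assume n: "S \<notin> N"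
    have SB: "S \<in> B" using S by (auto simp: nest_of_def)
    obtain i where i: "i \<in> S" "{T \<in> N. i \<in> T} = {T \<in> N. S \<subseteq> T}" using wit[OF SB] by blast
    obtain T where T: "T \<in> N" "i \<in> T" "\<And>T'. T' \<in> N \<Longrightarrow> i \<in> T' \<Longrightarrow> T \<subseteq> T'"
      using least_above[OF N, of i] i(1) subset_V[OF SB] by blast
    have "S \<subset> T" using T(1,2) i(2) n by blast
    then obtain u where u: "u \<in> T" "\<forall>v\<in>S. w v < w u" using S NB[OF T(1)] unfolding nest_of_def by blast
    have "{T \<in> N. i \<in> T} \<subseteq> {T \<in> N. u \<in> T}" using T(3) u(1) by blast
    then have "card {T \<in> N. i \<in> T} \<le> card {T \<in> N. u \<in> T}" using finN by (intro card_mono) auto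
    then have "w u \<le> w i" by (simp add: w_def)
    then show False using u i(1) by force
  qed
  ultimately show ?thesis by blast
qed

lemma face_for_cong: "(\<And>S. S \<in> B \<Longrightarrow> M S = M' S) \<Longrightarrow> face_for M = face_for M'"
  unfolding face_for_def by (rule sum.cong) auto

lemma face_for_block: "face_for (argmax w) = face_for (block (nest_of w))"
  by (rule face_for_cong) (rule argmax_eq_block)

text \<open>
  Each summand inside \<open>S\<close> contributes 1 to the coordinate sum over \<open>S\<close>, and the others contribute
  nothing.
\<close>
lemma coordinate_sum_face:
  assumes M: "\<And>S. S \<in> B \<Longrightarrow> M S \<subseteq> S" and S: "S \<in> B"
    and dis: "\<And>S'. S' \<in> B \<Longrightarrow> \<not> S' \<subseteq> S \<Longrightarrow> M S' \<inter> S = {}" and x: "x \<in> face_for M"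
  shows "(\<Sum>v\<in>S. x \<bullet> e v) = real (card {S' \<in> B. S' \<subseteq> S})"
proof -
  obtain y where y: "x = sum y B" "\<And>S'. S' \<in> B \<Longrightarrow> y S' \<in> convex hull (e ` M S')"
    using x by (auto simp: mem_face_for)
  have MV: "M S' \<subseteq> V" if "S' \<in> B" for S' using M[OF that] subset_V[OF that] by auto
  have inner: "(\<Sum>v\<in>S. y S' \<bullet> e v) = (if S' \<subseteq> S then 1 else 0)" if S': "S' \<in> B" for S'
  proof -
    note m = y(2)[OF S', unfolded mem_simplex[OF MV[OF S']]]
    show ?thesis
    proof (cases "S' \<subseteq> S")
      case True
      have "(\<Sum>v\<in>S. y S' \<bullet> e v) = (\<Sum>v\<in>M S'. y S' \<bullet> e v)"
        using m True M[OF S'] finite_mem[OF S] subset_V[OF S] by (intro sum.mono_neutral_right) auto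
      then show ?thesis using m True by simp
    next
      case False
      then have "\<forall>v\<in>S. y S' \<bullet> e v = 0" using m dis[OF S' False] subset_V[OF S] by blast
      then show ?thesis using False by simp
    qed
  qed
  have "(\<Sum>v\<in>S. x \<bullet> e v) = (\<Sum>S'\<in>B. \<Sum>v\<in>S. y S' \<bullet> e v)"
    unfolding y(1) inner_sum_left by (rule sum.swap)
  also have "\<dots> = (\<Sum>S'\<in>B. if S' \<subseteq> S then 1 else 0)" using inner by simp
  also have "\<dots> = real (card {S' \<in> B. S' \<subseteq> S})"
    using finite_B by (simp add: sum.If_cases Int_def)
  finally show ?thesis .
qed

text \<open>
  Conversely the face determines the nested set, namely by the facet inequalities that are
  tight on it.  If \<open>S\<close> is not a member, some larger \<open>R\<close> has a
  maximiser in \<open>S\<close>, and a vertex of the face that chooses it for \<open>R\<close> violates tightness.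
\<close>
theorem nest_of_from_face:
  "nest_of w = {S \<in> B. face_for (argmax w) \<subseteq> tight S}"
proof (intro equalityI subsetI)
  fix S assume S: "S \<in> nest_of w"
  have SB: "S \<in> B" using S by (auto simp: nest_of_def)
  have "argmax w S' \<inter> S = {}" if S': "S' \<in> B" "\<not> S' \<subseteq> S" for S'
    using S S'(2) unfolding argmax_eq_block[OF S'(1)] by (auto simp: block_def)
  then show "S \<in> {S \<in> B. face_for (argmax w) \<subseteq> tight S}"
    using coordinate_sum_face[of "argmax w" S] argmax_subset SB by (auto simp: tight_def)
next
  fix S assume "S \<in> {S \<in> B. face_for (argmax w) \<subseteq> tight S}"
  then have SB: "S \<in> B" and eq: "\<And>x. x \<in> face_for (argmax w) \<Longrightarrow> (\<Sum>v\<in>S. x \<bullet> e v) = real (card {S' \<in> B. S' \<subseteq> S})"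
    by (auto simp: tight_def)
  show "S \<in> nest_of w"
  proof (rule ccontr)
    assume "S \<notin> nest_of w"
    then obtain R where R: "R \<in> B" "S \<subset> R" "\<And>u. u \<in> R \<Longrightarrow> \<exists>v\<in>S. w u \<le> w v"
      using SB by (auto simp: nest_of_def not_less)
    obtain i where i: "i \<in> argmax w S" using argmax_nonempty[OF SB] by blast
    have "i \<in> argmax w R" using i R by (force simp: argmax_def)
    \<comment> \<open>The vertex of the face that takes \<open>i\<close> from \<open>R\<close>.\<close>
    define \<sigma> where "\<sigma> = (\<lambda>S'. if S' = R then i else SOME i. i \<in> argmax w S')"
    have \<sigma>: "\<sigma> S' \<in> argmax w S'" if "S' \<in> B" for S'
      using argmax_nonempty[OF that] \<open>i \<in> argmax w R\<close> by (auto simp: \<sigma>_def some_in_eq)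
    have \<sigma>V: "\<sigma> S' \<in> V" if "S' \<in> B" for S' using \<sigma>[OF that] argmax_subset subset_V[OF that] by blast
    have "(\<Sum>v\<in>S. (\<Sum>S'\<in>B. e (\<sigma> S')) \<bullet> e v) = (\<Sum>S'\<in>B. \<Sum>v\<in>S. e (\<sigma> S') \<bullet> e v)"
      unfolding inner_sum_left by (rule sum.swap)
    also have "\<dots> = (\<Sum>S'\<in>B. if \<sigma> S' \<in> S then 1 else 0)"
    proof (rule sum.cong[OF refl])
      fix S' assume S': "S' \<in> B"
      have "(\<Sum>v\<in>S. e (\<sigma> S') \<bullet> e v) = (\<Sum>v\<in>S. if \<sigma> S' = v then 1 else 0)"
        by (rule sum.cong) (use \<sigma>V[OF S'] subset_V[OF SB] e_inner in auto)
      then show "(\<Sum>v\<in>S. e (\<sigma> S') \<bullet> e v) = (if \<sigma> S' \<in> S then 1 else 0)"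
        using finite_mem[OF SB] by simp
    qed
    also have "\<dots> = real (card {S' \<in> B. \<sigma> S' \<in> S})" using finite_B by (simp add: sum.If_cases Int_def)
    finally have "real (card {S' \<in> B. \<sigma> S' \<in> S}) = real (card {S' \<in> B. S' \<subseteq> S})"
      using eq[OF vertex_mem_face[of \<sigma> "argmax w", OF \<sigma>]] by simp
    moreover have "{S' \<in> B. S' \<subseteq> S} \<subset> {S' \<in> B. \<sigma> S' \<in> S}"
    proof
      show "{S' \<in> B. S' \<subseteq> S} \<subseteq> {S' \<in> B. \<sigma> S' \<in> S}" using \<sigma> argmax_subset by blast
      have "\<sigma> R \<in> S" using i by (simp add: \<sigma>_def argmax_def)
      then show "{S' \<in> B. S' \<subseteq> S} \<noteq> {S' \<in> B. \<sigma> S' \<in> S}" using R by blast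
    qed
    then have "card {S' \<in> B. S' \<subseteq> S} < card {S' \<in> B. \<sigma> S' \<in> S}"
      using finite_B by (intro psubset_card_mono) auto
    ultimately show False by simp
  qed
qed

text \<open>
  The blocks of the members of \<open>N\<close> partition \<open>V\<close>, and the maximisers in any \<open>S\<close> lie in a single block.  So the
  directions of the face are spanned by the differences \<open>e i - e j\<close> with \<open>i\<close> and \<open>j\<close> in the same block.
  Fixing a representative in every block gives a basis with \<open>|V| - |N|\<close> elements.
\<close>
theorem aff_dim_face:
  assumes N: "N \<in> nested_sets V B"
  shows "aff_dim (face_for (block N)) = int (card V - card N)"
proof -
  \<comment> \<open>Two vertices are in the same block iff \<open>K\<close> agrees on them; \<open>\<tau>\<close> picks the representative.\<close>
  define K where "K = (\<lambda>i. {T \<in> N. i \<in> T})"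
  define \<tau> where "\<tau> = (\<lambda>i. SOME j. j \<in> V \<and> K j = K i)"
  have \<tau>: "\<tau> i \<in> V \<and> K (\<tau> i) = K i" if "i \<in> V" for i
    unfolding \<tau>_def by (rule someI[of "\<lambda>j. j \<in> V \<and> K j = K i" i]) (use that in simp)
  have \<tau>_cong: "\<tau> i = \<tau> j" if "K i = K j" for i j using that by (simp add: \<tau>_def)
  have \<tau>_idem: "\<tau> (\<tau> i) = \<tau> i" if "i \<in> V" for i using \<tau>[OF that] \<tau>_cong by blast
  have K_block: "K i = {T \<in> N. S \<subseteq> T}" if "i \<in> block N S" for i S
    using that by (auto simp: K_def block_def)
  have block_ne: "block N S \<noteq> {}" if "S \<in> B" for S
    using nested_witness[OF N that] by (auto simp: block_def)
  have NB: "\<And>S. S \<in> N \<Longrightarrow> S \<in> B" using nested_setsD(1)[OF N] by auto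
  have in_block: "\<exists>T\<in>N. \<forall>j\<in>V. K j = K i \<longrightarrow> j \<in> block N T" if "i \<in> V" for i
  proof -
    obtain T where T: "T \<in> N" "i \<in> T" "\<And>T'. T' \<in> N \<Longrightarrow> i \<in> T' \<Longrightarrow> T \<subseteq> T'"
      using least_above[OF N \<open>i \<in> V\<close>] by blast
    have "j \<in> block N T" if "K j = K i" for j
      using that T unfolding K_def block_def by blast
    then show ?thesis using T(1) by blast
  qed
  define f where "f = (\<lambda>i. e i - e (\<tau> i))"
  define I where "I = {i \<in> V. \<tau> i \<noteq> i}"
  have finI: "finite I" using finite_V by (simp add: I_def)
  have f_inner: "f i \<bullet> e j = (if i = j then 1 else 0)" if "i \<in> I" "j \<in> I" for i j
  proof -
    have "\<tau> i \<noteq> j" using \<tau>_idem[of i] that by (auto simp: I_def)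
    then show ?thesis using that \<tau>[of i] by (simp add: f_def I_def inner_diff_left e_inner)
  qed
  have f_inj: "inj_on f I"
    by (rule inj_onI) (metis f_inner zero_neq_one)
  have indep: "independent (f ` I)"
    unfolding independent_explicit
  proof (intro conjI allI impI ballI)
    show "finite (f ` I)" using finI by simp
    fix c v assume s: "(\<Sum>v\<in>f ` I. c v *\<^sub>R v) = 0" and "v \<in> f ` I"
    then obtain j where j: "j \<in> I" "v = f j" by blast
    have "0 = (\<Sum>i\<in>I. c (f i) *\<^sub>R f i) \<bullet> e j" using s by (simp add: sum.reindex[OF f_inj])
    also have "\<dots> = (\<Sum>i\<in>I. if i = j then c (f i) else 0)"
      unfolding inner_sum_left by (rule sum.cong) (use f_inner j in auto)
    also have "\<dots> = c v" using finI j by simp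
    finally show "c v = 0" by simp
  qed
  have card_I: "card I = card V - card N"
  proof -
    define g where "g = (\<lambda>S. SOME j. j \<in> V \<and> K j = {T \<in> N. S \<subseteq> T})"
    have "bij_betw g N (\<tau> ` V)"
    proof (rule bij_betw_imageI)
      have r: "g S \<in> V \<and>
          K (g S) = {T \<in> N. S \<subseteq> T}" if S: "S \<in> N" for S
      proof -
        obtain i where i: "i \<in> block N S" using block_ne[OF NB[OF S]] by blast
        then have "i \<in> V" using subset_V[OF NB[OF S]] by (auto simp: block_def)
        then show ?thesis using K_block[OF i] unfolding g_def
          by (intro someI[of "\<lambda>j. j \<in> V \<and> K j = {T \<in> N. S \<subseteq> T}" i]) simp
      qed
      show "inj_on g N"
      proof (rule inj_onI)
        fix S S' assume S: "S \<in> N" "S' \<in> N"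
          and "g S = g S'"
        then have "{T \<in> N. S \<subseteq> T} = {T \<in> N. S' \<subseteq> T}" using r by metis
        then show "S = S'" using S by blast
      qed
      show "g ` N = \<tau> ` V"
      proof (intro equalityI subsetI)
        fix j assume "j \<in> g ` N"
        then obtain S where S: "S \<in> N" "j = g S" by blast
        then have j: "j \<in> V" "K j = {T \<in> N. S \<subseteq> T}" using r by auto
        then have "j = \<tau> j" using S(2) by (simp add: \<tau>_def g_def)
        then show "j \<in> \<tau> ` V" using j by blast
      next
        fix j assume "j \<in> \<tau> ` V"
        then obtain i where i: "i \<in> V" "j = \<tau> i" by blast
        obtain T where T: "T \<in> N" "i \<in> block N T" using in_block[OF i(1)] i(1) by blast
        then have "j = g T" using i(2) K_block[OF T(2)] by (simp add: \<tau>_def g_def)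
        then show "j \<in> g ` N" using T(1) by blast
      qed
    qed
    then have "card N = card (\<tau> ` V)" by (rule bij_betw_same_card)
    moreover have "I = V - \<tau> ` V"
    proof (intro equalityI subsetI)
      fix i assume i: "i \<in> I"
      have "i \<noteq> \<tau> j" if "j \<in> V" for j using i \<tau>_idem[OF that] by (auto simp: I_def)
      then show "i \<in> V - \<tau> ` V" using i by (auto simp: I_def)
    next
      fix i assume i: "i \<in> V - \<tau> ` V"
      then have "\<tau> i \<noteq> i" by (metis DiffE imageI)
      then show "i \<in> I" using i by (simp add: I_def)
    qed
    moreover have "\<tau> ` V \<subseteq> V" using \<tau> by blast
    ultimately show ?thesis using finite_V finite_subset by (simp add: card_Diff_subset)
  qed
  obtain z where z: "z \<in> face_for (block N)" using face_for_nonempty[of "block N", OF block_ne] by (meson all_not_in_conv)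
  let ?D = "(\<lambda>x. - z + x) ` face_for (block N)"
  have f_span: "f i \<in> span (f ` I)" if "i \<in> V" for i
  proof (cases "i \<in> I")
    case False
    then have "f i = 0" using that by (simp add: f_def I_def)
    then show ?thesis by (simp add: span_zero)
  qed (simp add: span_base)
  have hull_span: "x - e (\<tau> i) \<in> span (f ` I)"
    if S: "S \<in> B" and x: "x \<in> convex hull (e ` block N S)" and i: "i \<in> block N S" for x S i
  proof -
    have sub: "block N S \<subseteq> V" using subset_V[OF S] by (auto simp: block_def)
    note m = x[unfolded mem_simplex[OF sub]]
    have "(\<Sum>v\<in>V. (x \<bullet> e v) *\<^sub>R e v) = (\<Sum>v\<in>block N S. (x \<bullet> e v) *\<^sub>R e v)"
      using m sub finite_V by (intro sum.mono_neutral_right) auto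
    then have "x - e (\<tau> i) = (\<Sum>v\<in>block N S. (x \<bullet> e v) *\<^sub>R e v) - (\<Sum>v\<in>block N S. x \<bullet> e v) *\<^sub>R e (\<tau> i)"
      using m sum_e[of x] by simp
    also have "\<dots> = (\<Sum>v\<in>block N S. (x \<bullet> e v) *\<^sub>R (e v - e (\<tau> i)))"
      unfolding scaleR_diff_right sum_subtractf scaleR_sum_left ..
    also have "\<dots> = (\<Sum>v\<in>block N S. (x \<bullet> e v) *\<^sub>R f v)"
    proof (rule sum.cong[OF refl])
      fix v assume "v \<in> block N S"
      then have "\<tau> v = \<tau> i" using K_block i by (intro \<tau>_cong) simp
      then show "(x \<bullet> e v) *\<^sub>R (e v - e (\<tau> i)) = (x \<bullet> e v) *\<^sub>R f v" by (simp add: f_def)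
    qed
    also have "\<dots> \<in> span (f ` I)"
      using f_span sub by (intro span_sum span_scale) auto
    finally show ?thesis .
  qed
  have "?D \<subseteq> span (f ` I)"
  proof
    fix d assume "d \<in> ?D"
    then obtain x where x: "x \<in> face_for (block N)" "d = x - z" by auto
    obtain y where y: "x = sum y B" "\<forall>S\<in>B. y S \<in> convex hull (e ` block N S)" using x(1) by (auto simp: mem_face_for)
    obtain y' where y': "z = sum y' B" "\<forall>S\<in>B. y' S \<in> convex hull (e ` block N S)" using z by (auto simp: mem_face_for)
    have "d = (\<Sum>S\<in>B. y S - y' S)" using x y y' by (simp add: sum_subtractf)
    moreover have "y S - y' S \<in> span (f ` I)" if S: "S \<in> B" for S
    proof -
      obtain i where i: "i \<in> block N S" using block_ne[OF S] by blast
      have "(y S - e (\<tau> i)) - (y' S - e (\<tau> i)) \<in> span (f ` I)"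
        by (rule span_diff[OF hull_span[OF S _ i] hull_span[OF S _ i]]) (use y y' S in auto)
      then show ?thesis by simp
    qed
    ultimately show "d \<in> span (f ` I)" by (simp add: span_sum)
  qed
  moreover have "f ` I \<subseteq> span ?D"
  proof
    fix d assume "d \<in> f ` I"
    then obtain i where i: "i \<in> V" "d = e i - e (\<tau> i)" by (auto simp: f_def I_def)
    obtain T where T: "T \<in> N" "i \<in> block N T" "\<tau> i \<in> block N T"
      using in_block[OF i(1)] i(1) \<tau>[OF i(1)] by metis
    have TB: "T \<in> B" using NB T by blast
    \<comment> \<open>Two vertices of the face that differ only in the choice from the simplex of \<open>T\<close>.\<close>
    define \<sigma> where "\<sigma> = (\<lambda>k S. if S = T then k else SOME k. k \<in> block N S)"
    have mem: "(\<Sum>S\<in>B. e (\<sigma> k S)) \<in> face_for (block N)" if "k \<in> block N T" for k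
      by (rule vertex_mem_face) (use that block_ne in \<open>auto simp: \<sigma>_def some_in_eq\<close>)
    have "(\<Sum>S\<in>B. e (\<sigma> i S)) - (\<Sum>S\<in>B. e (\<sigma> (\<tau> i) S)) = (\<Sum>S\<in>B. if S = T then e i - e (\<tau> i) else 0)"
      unfolding sum_subtractf[symmetric] by (rule sum.cong) (auto simp: \<sigma>_def)
    also have "\<dots> = d" using finite_B TB i by simp
    finally have d: "d = (- z + (\<Sum>S\<in>B. e (\<sigma> i S))) - (- z + (\<Sum>S\<in>B. e (\<sigma> (\<tau> i) S)))" by simp
    show "d \<in> span ?D" unfolding d
      by (intro span_diff span_base imageI mem T)
  qed
  ultimately have "span ?D = span (f ` I)" by (simp add: span_eq)
  then have "dim ?D = dim (f ` I)" by (metis dim_span)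
  also have "\<dots> = card I" using indep f_inj by (simp add: dim_eq_card_independent card_image)
  finally have "dim ?D = card V - card N" using card_I by simp
  moreover have "aff_dim (face_for (block N)) = int (dim ?D)"
    by (rule aff_dim_eq_dim) (simp add: hull_inc z)
  ultimately show ?thesis by simp
qed

theorem f_num_minkowski_sum: "f_num minkowski_sum i = card {N \<in> nested_sets V B. card V - card N = i}"
proof -
  have "{F. F face_of minkowski_sum \<and> aff_dim F = int i} =
      (\<lambda>N. face_for (block N)) ` {N \<in> nested_sets V B. card V - card N = i}"
  proof (intro equalityI subsetI)
    fix F assume F: "F \<in> {F. F face_of minkowski_sum \<and> aff_dim F = int i}"
    then have "F \<noteq> {}" by auto
    then obtain w where w: "F = face_for (argmax w)" using faces_eq F by blast
    then have "F = face_for (block (nest_of w))" using face_for_block by simp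
    moreover have "card V - card (nest_of w) = i"
      using F aff_dim_face[OF nest_of_nested, of w] calculation by simp
    ultimately show "F \<in> (\<lambda>N. face_for (block N)) ` {N \<in> nested_sets V B. card V - card N = i}"
      using nest_of_nested by blast
  next
    fix F assume "F \<in> (\<lambda>N. face_for (block N)) ` {N \<in> nested_sets V B. card V - card N = i}"
    then obtain N where N: "N \<in> nested_sets V B" "card V - card N = i" "F = face_for (block N)" by blast
    obtain w where w: "nest_of w = N" using nest_of_surj[OF N(1)] by blast
    have "F = face_for (argmax w)" using N w face_for_block[of w] by simp
    then have "F face_of minkowski_sum" using faces_eq by blast
    then show "F \<in> {F. F face_of minkowski_sum \<and> aff_dim F = int i}" using aff_dim_face[OF N(1)] N by simp
  qed
  moreover have "inj_on (\<lambda>N. face_for (block N)) (nested_sets V B)"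
  proof (rule inj_onI)
    fix N N' assume N: "N \<in> nested_sets V B" "N' \<in> nested_sets V B" and eq: "face_for (block N) = face_for (block N')"
    obtain w w' where w: "nest_of w = N" "nest_of w' = N'" using nest_of_surj N by metis
    then have "face_for (argmax w) = face_for (argmax w')" using eq face_for_block by simp
    then show "N = N'" using nest_of_from_face[of w] nest_of_from_face[of w'] w by simp
  qed
  ultimately show ?thesis unfolding f_num_def
    by (simp add: card_image inj_on_subset)
qed

lemma pdim_minkowski_sum: "pdim minkowski_sum = card V - 1"
proof -
  have N: "{V} \<in> nested_sets V B" using top_mem by (auto simp: nested_sets_def)
  have "minkowski_sum = face_for (block {V})"
    unfolding minkowski_sum_eq by (rule face_for_cong) (use subset_V in \<open>auto simp: block_def\<close>)
  then show ?thesis using aff_dim_face[OF N] by (simp add: pdim_def)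
qed

theorem H_poly_minkowski_sum: "H_poly minkowski_sum = face_sum (var_alpha - var_t) var_t V B"
proof -
  have c: "1 \<le> card N" "card N \<le> card V" if "N \<in> nested_sets V B" for N
    using card_nested_le[OF that] finite_nested[OF that] nested_setsD(2)[OF that]
    by (auto simp: Suc_le_eq card_gt_0_iff)
  have "face_sum var_alpha var_t V B =
      (\<Sum>i\<le>card V - 1. \<Sum>N\<in>{N \<in> nested_sets V B. card V - card N = i}. var_alpha ^ (card V - card N) * var_t ^ (card N - 1))"
    unfolding face_sum_def
    by (rule sum.group[symmetric]) (use finite_nested_sets c in \<open>auto intro: diff_le_mono2\<close>)
  also have "\<dots> = F_poly minkowski_sum"
    unfolding F_poly_def pdim_minkowski_sum
  proof (rule sum.cong[OF refl])
    fix i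
    have "(\<Sum>N\<in>{N \<in> nested_sets V B. card V - card N = i}. var_alpha ^ (card V - card N) * var_t ^ (card N - 1)) =
       (\<Sum>N\<in>{N \<in> nested_sets V B. card V - card N = i}. var_alpha ^ i * var_t ^ (card V - 1 - i))"
    proof (rule sum.cong[OF refl])
      fix N assume N: "N \<in> {N \<in> nested_sets V B. card V - card N = i}"
      then have "card V - 1 - i = card N - 1" using c[of N] by auto
      then show "var_alpha ^ (card V - card N) * var_t ^ (card N - 1) = var_alpha ^ i * var_t ^ (card V - 1 - i)"
        using N by simp
    qed
    then show "(\<Sum>N\<in>{N \<in> nested_sets V B. card V - card N = i}. var_alpha ^ (card V - card N) * var_t ^ (card N - 1)) =
       of_nat (f_num minkowski_sum i) * var_alpha ^ i * var_t ^ (card V - 1 - i)"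
      by (simp add: f_num_minkowski_sum)
  qed
  finally have F: "F_poly minkowski_sum = face_sum var_alpha var_t V B" by simp
  have "pcompose var_alpha (var_alpha - var_t) = var_alpha - var_t" "pcompose var_t (var_alpha - var_t) = var_t"
    by (simp_all add: var_alpha_def var_t_def pcompose_pCons)
  then show ?thesis
    by (simp add: H_poly_def F face_sum_def pcompose_sum pcompose_mult pcompose_power)
qed

end

section \<open>Trees, paths and stars as building sets\<close>

abbreviation edge_rel :: "'v set set \<Rightarrow> ('v \<times> 'v) set" where
  "edge_rel E \<equiv> {(x, y). {x, y} \<in> E}"

abbreviation conn :: "'v set set \<Rightarrow> 'v set \<Rightarrow> bool" where
  "conn E S \<equiv> connected_graph S (induced_edges E S)"

lemma induced_edge_iff: "{x, y} \<in> induced_edges E S \<longleftrightarrow> {x, y} \<in> E \<and> x \<in> S \<and> y \<in> S"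
  by (auto simp: induced_edges_def)

lemma reach_mono:
  "(x, y) \<in> (edge_rel (induced_edges E S))\<^sup>* \<Longrightarrow> S \<subseteq> S' \<Longrightarrow> (x, y) \<in> (edge_rel (induced_edges E S'))\<^sup>*"
  by (erule rtrancl_mono[THEN subsetD, rotated]) (auto simp: induced_edges_def)

lemma reach_sym: "(x, y) \<in> (edge_rel E)\<^sup>* \<Longrightarrow> (y, x) \<in> (edge_rel E)\<^sup>*"
  by (rule symD[OF sym_rtrancl]) (auto simp: sym_def insert_commute)

lemma connected_graphI:
  assumes "y \<in> S" "\<And>u. u \<in> S \<Longrightarrow> (y, u) \<in> (edge_rel E)\<^sup>*"
  shows "connected_graph S E"
  unfolding connected_graph_def
proof (intro conjI ballI)
  fix u v assume "u \<in> S" "v \<in> S"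
  then show "(u, v) \<in> (edge_rel E)\<^sup>*"
    using rtrancl_trans[OF reach_sym[OF assms(2)] assms(2)] by blast
qed (use assms in blast)

lemma connD: "conn E S \<Longrightarrow> u \<in> S \<Longrightarrow> v \<in> S \<Longrightarrow> (u, v) \<in> (edge_rel (induced_edges E S))\<^sup>*"
  by (auto simp: connected_graph_def)

lemma conn_union:
  assumes "conn E S" "conn E T" "x \<in> S" "x \<in> T"
  shows "conn E (S \<union> T)"
proof (rule connected_graphI)
  show "x \<in> S \<union> T" using assms by simp
  fix u assume "u \<in> S \<union> T"
  then show "(x, u) \<in> (edge_rel (induced_edges E (S \<union> T)))\<^sup>*"
    using connD[OF assms(1,3)] connD[OF assms(2,4)] reach_mono[of x u E S "S \<union> T"] reach_mono[of x u E T "S \<union> T"]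
    by auto
qed

lemma conn_singleton: "conn E {v}"
  by (rule connected_graphI[of v]) auto

lemma conn_edge: "{y, z} \<in> E \<Longrightarrow> conn E {y, z}"
  by (rule connected_graphI[of y]) (auto simp: induced_edges_def)

lemma conn_insert:
  assumes "conn E S" "y \<in> S" "{y, z} \<in> E"
  shows "conn E (insert z S)"
proof -
  have "conn E (S \<union> {y, z})" using conn_union[OF assms(1) conn_edge[OF assms(3)] assms(2)] by simp
  moreover have "S \<union> {y, z} = insert z S" using assms(2) by auto
  ultimately show ?thesis by simp
qed

lemma crossing_edge:
  assumes "(a, b) \<in> r\<^sup>*" "a \<in> S" "b \<notin> S"
  shows "\<exists>y z. (y, z) \<in> r \<and> y \<in> S \<and> z \<notin> S"
  using assms by (induction rule: rtrancl_induct) auto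

lemma conn_grow:
  assumes "conn E S" "conn E S'" "S \<subset> S'"
  shows "\<exists>y\<in>S. \<exists>z\<in>S' - S. {y, z} \<in> E"
proof -
  obtain a where a: "a \<in> S" using assms(1) by (auto simp: connected_graph_def)
  obtain b where b: "b \<in> S'" "b \<notin> S" using assms(3) by auto
  have "(a, b) \<in> (edge_rel (induced_edges E S'))\<^sup>*" using connD[OF assms(2)] a b assms(3) by blast
  then obtain y z where "{y, z} \<in> induced_edges E S'" "y \<in> S" "z \<notin> S"
    using crossing_edge[OF _ a b(2)] by blast
  then show ?thesis by (auto simp: induced_edge_iff)
qed

lemma induced_edges_all: "simple_graph V E \<Longrightarrow> induced_edges E V = E"
  by (auto simp: simple_graph_def induced_edges_def)

lemma mem_graphical: "S \<in> graphical_building_set V E \<longleftrightarrow> S \<subseteq> V \<and> conn E S"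
  by (auto simp: graphical_building_set_def connected_graph_def)

theorem graphical_accessible:
  assumes "simple_graph V E" "connected_graph V E"
  shows "accessible_building_set V (graphical_building_set V E)"
proof
  show "finite V" using assms by (simp add: simple_graph_def)
  show "V \<in> graphical_building_set V E" using assms by (simp add: mem_graphical induced_edges_all)
  show "{v} \<in> graphical_building_set V E" if "v \<in> V" for v
    using that by (simp add: mem_graphical conn_singleton)
next
  fix S T assume "S \<in> graphical_building_set V E" "T \<in> graphical_building_set V E" "S \<inter> T \<noteq> {}"
  then show "S \<union> T \<in> graphical_building_set V E" using conn_union[where E = E and S = S and T = T] by (auto simp: mem_graphical)
next
  fix S S' assume S: "S \<in> graphical_building_set V E" "S' \<in> graphical_building_set V E" "S \<subset> S'"
  then obtain y z where "y \<in> S" "z \<in> S' - S" "{y, z} \<in> E" using conn_grow[where E = E and S = S and S' = S'] by (auto simp: mem_graphical)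
  then show "\<exists>u\<in>S' - S. insert u S \<in> graphical_building_set V E"
    using S conn_insert[where E = E and S = S and y = y and z = z] by (auto simp: mem_graphical)
qed (auto simp: mem_graphical connected_graph_def)

text \<open>
  A walk through \<open>m\<close> enters and leaves it by \<open>q\<close>, so the detour can be cut off.
\<close>
lemma conn_remove_leaf:
  assumes S: "conn E S" "m \<in> S" "S \<noteq> {m}" and leaf: "\<And>u. u \<in> S \<Longrightarrow> u \<noteq> m \<Longrightarrow> {u, m} \<in> E \<Longrightarrow> u = q"
    and loop: "{m} \<notin> E"
  shows "conn E (S - {m})"
proof -
  obtain y where y: "y \<in> S" "y \<noteq> m" using S(2,3) by auto
  have *: "(u \<noteq> m \<longrightarrow> (y, u) \<in> (edge_rel (induced_edges E (S - {m})))\<^sup>*) \<and>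
      (u = m \<longrightarrow> (y, q) \<in> (edge_rel (induced_edges E (S - {m})))\<^sup>*)"
    if "(y, u) \<in> (edge_rel (induced_edges E S))\<^sup>*" for u
    using that
  proof (induction rule: rtrancl_induct)
    case base
    show ?case using y by simp
  next
    case (step u u')
    then have e: "{u, u'} \<in> E" "u \<in> S" "u' \<in> S" by (auto simp: induced_edge_iff)
    show ?case
    proof (cases "u' = m")
      case True
      then have "u \<noteq> m" using e(1) loop by auto
      then have "u = q" using leaf[OF e(2)] e(1) True by simp
      then show ?thesis using step.IH True \<open>u \<noteq> m\<close> by simp
    next
      case u': False
      show ?thesis
      proof (cases "u = m")
        case True
        then have "u' = q" using leaf[OF e(3) u'] e(1) by (simp add: insert_commute)
        then show ?thesis using step.IH True u' by simp
      next
        case False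
        then have "(u, u') \<in> edge_rel (induced_edges E (S - {m}))" using e u' by (simp add: induced_edge_iff)
        then show ?thesis using step.IH False u' by (auto intro: rtrancl_into_rtrancl)
      qed
    qed
  qed
  show ?thesis
    by (rule connected_graphI[of y]) (use y * connD[OF S(1)] in auto)
qed

text \<open>
  A tree whose vertices are listed so that each of them has at most one earlier neighbour.  The axioms do
  not mention cycles, which makes them easy to check for the path and the star.
\<close>
locale parent_ordered_graph =
  fixes V :: "'v set" and E :: "'v set set" and r :: "'v \<Rightarrow> nat" and p :: "'v \<Rightarrow> 'v"
  assumes simple: "simple_graph V E" and connected: "connected_graph V E"
    and inj_r: "inj_on r V"
    and parent: "{u, v} \<in> E \<Longrightarrow> r u < r v \<Longrightarrow> u = p v"
begin

lemma no_loop: "{m} \<notin> E"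
  using simple by (force simp: simple_graph_def)

sublocale accessible_building_set V "graphical_building_set V E"
  using graphical_accessible simple connected .

lemma neighbour_of_max:
  assumes S: "S \<subseteq> V" "m \<in> S" "\<And>y. y \<in> S \<Longrightarrow> r y \<le> r m" and u: "u \<in> S" "u \<noteq> m" "{u, m} \<in> E"
  shows "u = p m"
proof -
  have "r u \<noteq> r m" using inj_onD[OF inj_r, of u m] S(1,2) u(1,2) by blast
  then have "r u < r m" using S(3)[OF u(1)] by simp
  then show ?thesis using parent u(3) by blast
qed

text \<open>
  The last vertex of a connected set is a leaf of it and can be removed; repeat until \<open>x\<close> is last.
\<close>
lemma prefix_connected:
  assumes "S \<in> graphical_building_set V E" "x \<in> S"
  shows "{y \<in> S. r y \<le> r x} \<in> graphical_building_set V E"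
  using assms
proof (induction "card S" arbitrary: S rule: less_induct)
  case less
  have fin: "finite S" using finite_mem less by blast
  show ?case
  proof (cases "\<forall>y\<in>S. r y \<le> r x")
    case True
    then have "{y \<in> S. r y \<le> r x} = S" by auto
    then show ?thesis using less by simp
  next
    case False
    have "finite (r ` S)" "r ` S \<noteq> {}" using fin less by auto
    then have "Max (r ` S) \<in> r ` S" by (rule Max_in)
    then obtain m where m: "m \<in> S" "r m = Max (r ` S)" by auto
    have max: "r y \<le> r m" if "y \<in> S" for y using m(2) that fin by simp
    have xm: "r x < r m" using False max by (meson le_less_trans not_le order.trans)
    have SV: "S \<subseteq> V" "conn E S" using less by (auto simp: mem_graphical)
    have "conn E (S - {m})"
      by (rule conn_remove_leaf[OF SV(2) m(1), of "p m"])
        (use neighbour_of_max[OF SV(1) m(1) max] no_loop less xm in auto)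
    then have "S - {m} \<in> graphical_building_set V E" using SV by (auto simp: mem_graphical)
    moreover have "card (S - {m}) < card S" using fin m(1) by (rule card_Diff1_less)
    moreover have "x \<in> S - {m}" using less xm by auto
    ultimately have "{y \<in> S - {m}. r y \<le> r x} \<in> graphical_building_set V E" using less.hyps by blast
    moreover have "{y \<in> S - {m}. r y \<le> r x} = {y \<in> S. r y \<le> r x}" using xm by auto
    ultimately show ?thesis by simp
  qed
qed

theorem graphical_ordered: "ordered_building_set V (graphical_building_set V E) r"
  by unfold_locales (use inj_r prefix_connected in auto)

theorem graphical_has_parents: "has_parents r p (graphical_building_set V E)"
  unfolding has_parents_def
proof (intro ballI impI)
  fix S x assume S: "S \<in> graphical_building_set V E" "x \<in> S" and max: "\<forall>y\<in>S. r y \<le> r x" and ne: "S \<noteq> {x}"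
  have SV: "S \<subseteq> V" "conn E S" using S by (auto simp: mem_graphical)
  have "{x} \<subset> S" using S ne by auto
  then obtain z where z: "z \<in> S - {x}" "{x, z} \<in> E" using conn_grow[OF conn_singleton SV(2)] by blast
  have "z = p x"
    by (rule neighbour_of_max[OF SV(1) S(2)]) (use max z in \<open>auto simp: insert_commute\<close>)
  then show "p x \<in> S - {x}" using z by simp
qed

end

lemma simple_path_exists:
  assumes "(a, b) \<in> (edge_rel (induced_edges E S))\<^sup>*" "a \<in> S"
  shows "\<exists>vs. vs \<noteq> [] \<and> hd vs = a \<and> last vs = b \<and> distinct vs \<and> set vs \<subseteq> S \<and> successively (\<lambda>x y. {x, y} \<in> E) vs"
  using assms(1)
proof (induction rule: rtrancl_induct)
  case base
  show ?case by (rule exI[of _ "[a]"]) (use assms(2) in auto)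
next
  case (step b b')
  then obtain vs where vs: "vs \<noteq> []" "hd vs = a" "last vs = b" "distinct vs" "set vs \<subseteq> S"
    "successively (\<lambda>x y. {x, y} \<in> E) vs" by blast
  have e: "{b, b'} \<in> E" "b' \<in> S" using step by (auto simp: induced_edge_iff)
  show ?case
  proof (cases "b' \<in> set vs")
    case True
    then obtain xs ys where xs: "vs = xs @ b' # ys" by (meson split_list)
    have "successively (\<lambda>x y. {x, y} \<in> E) (xs @ [b'])"
      using vs(6) by (auto simp: xs successively_append_iff)
    then show ?thesis using vs by (intro exI[of _ "xs @ [b']"]) (cases xs; auto simp: xs)
  next
    case False
    have "successively (\<lambda>x y. {x, y} \<in> E) (vs @ [b'])"
      using vs e by (simp add: successively_append_iff)
    then show ?thesis using vs e False by (intro exI[of _ "vs @ [b']"]) auto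
  qed
qed

text \<open>
  A simple path from \<open>u\<close> to \<open>u'\<close> inside \<open>C\<close> is closed up by \<open>z\<close>.
\<close>
lemma two_neighbours_cycle:
  assumes C: "conn E C" "u \<in> C" "u' \<in> C" "u \<noteq> u'" and z: "z \<notin> C" "{u, z} \<in> E" "{u', z} \<in> E"
  shows "\<exists>vs. is_cycle E vs"
proof -
  obtain vs where vs: "vs \<noteq> []" "hd vs = u" "last vs = u'" "distinct vs" "set vs \<subseteq> C"
    "successively (\<lambda>x y. {x, y} \<in> E) vs"
    using simple_path_exists[OF connD[OF C(1,2,3)] C(2)] by blast
  have len: "length vs \<ge> 2" using vs C(4) by (cases vs; cases "tl vs") auto
  have suc: "successively (\<lambda>x y. {x, y} \<in> E) (vs @ [z])" using vs z by (simp add: successively_append_iff)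
  have "is_cycle E (vs @ [z])"
    unfolding is_cycle_def
  proof (intro conjI allI impI)
    show "3 \<le> length (vs @ [z])" using len by simp
    show "distinct (vs @ [z])" using vs z by auto
    fix i assume i: "i < length (vs @ [z])"
    show "{(vs @ [z]) ! i, (vs @ [z]) ! (Suc i mod length (vs @ [z]))} \<in> E"
    proof (cases "Suc i < length (vs @ [z])")
      case True
      then show ?thesis using suc by (simp add: successively_conv_nth)
    next
      case False
      then have "i = length vs" using i by simp
      moreover have "(vs @ [z]) ! 0 = u" using vs by (cases vs) auto
      ultimately show ?thesis using z(2) by (simp add: insert_commute)
    qed
  qed
  then show ?thesis by blast
qed

text \<open>
  The vertices are added one at a time, keeping the set \<open>C\<close> of those added connected.  A new vertex with
  two neighbours in \<open>C\<close> would close a cycle.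
\<close>
theorem tree_parent_order:
  fixes V :: "'v set"
  assumes "tree V E"
  shows "\<exists>r p. parent_ordered_graph V E r p"
proof -
  have simple: "simple_graph V E" and connected: "connected_graph V E" and acyc: "\<nexists>vs. is_cycle E vs"
    using assms by (auto simp: tree_def)
  have finV: "finite V" using simple by (simp add: simple_graph_def)
  have connV: "conn E V" using connected simple by (simp add: induced_edges_all)
  define one_earlier where "one_earlier = (\<lambda>C (r :: 'v \<Rightarrow> nat). \<forall>v\<in>C. \<forall>u\<in>C. \<forall>u'\<in>C.
    {u, v} \<in> E \<longrightarrow> {u', v} \<in> E \<longrightarrow> r u < r v \<longrightarrow> r u' < r v \<longrightarrow> u = u')"
  have chain: "Suc k \<le> card V \<Longrightarrow> \<exists>C r. C \<subseteq> V \<and> conn E C \<and> card C = Suc k \<and> inj_on r C \<and> r ` C \<subseteq> {..k} \<and>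
     one_earlier C r" for k
  proof (induction k)
    case 0
    obtain v where "v \<in> V" using connected by (auto simp: connected_graph_def)
    then show ?case by (intro exI[of _ "{v}"] exI[of _ "\<lambda>_. 0"]) (auto simp: conn_singleton one_earlier_def)
  next
    case (Suc k)
    then obtain C r where C: "C \<subseteq> V" "conn E C" "card C = Suc k" "inj_on r C" "r ` C \<subseteq> {..k}"
      and un: "one_earlier C r"
      by auto
    have "C \<subset> V" using C Suc by auto
    then obtain y z where yz: "y \<in> C" "z \<in> V - C" "{y, z} \<in> E" using conn_grow[OF C(2) connV] by blast
    have finC: "finite C" using C(1) finV finite_subset by blast
    let ?r = "r(z := Suc k)"
    have rC: "?r v = r v" "r v \<le> k" if "v \<in> C" for v using that yz C(5) by auto
    show ?case
    proof (intro exI[of _ "insert z C"] exI[of _ ?r] conjI)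
      show "insert z C \<subseteq> V" using yz C by auto
      show "conn E (insert z C)" using conn_insert[OF C(2) yz(1,3)] .
      show "card (insert z C) = Suc (Suc k)" using finC yz C by simp
      show "inj_on ?r (insert z C)"
      proof (rule inj_onI)
        fix a b assume ab: "a \<in> insert z C" "b \<in> insert z C" "?r a = ?r b"
        show "a = b"
        proof (cases "a = z \<or> b = z")
          case True
          then show ?thesis using ab rC(2)[of a] rC(2)[of b] by (auto split: if_splits)
        next
          case False
          then show ?thesis using ab inj_onD[OF C(4), of a b] by auto
        qed
      qed
      show "?r ` insert z C \<subseteq> {..Suc k}"
      proof
        fix x assume "x \<in> ?r ` insert z C"
        then obtain a where "a \<in> insert z C" "x = ?r a" by blast
        then show "x \<in> {..Suc k}" using rC(2)[of a] by (cases "a = z") auto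
      qed
      show "one_earlier (insert z C) ?r"
        unfolding one_earlier_def
      proof (intro ballI impI)
        fix v u u' assume v: "v \<in> insert z C" "u \<in> insert z C" "u' \<in> insert z C"
          and e: "{u, v} \<in> E" "{u', v} \<in> E" and lt: "?r u < ?r v" "?r u' < ?r v"
        have bound: "?r x \<le> Suc k" if "x \<in> insert z C" for x using rC(2)[of x] that by (cases "x = z") auto
        have uz: "u \<noteq> z" "u' \<noteq> z" using less_le_trans[OF lt(1) bound[OF v(1)]] less_le_trans[OF lt(2) bound[OF v(1)]] by auto
        then have uC: "u \<in> C" "u' \<in> C" using v by auto
        show "u = u'"
        proof (cases "v = z")
          case True
          then show ?thesis using two_neighbours_cycle[OF C(2) uC] acyc e yz(2) by blast
        next
          case False
          then have "v \<in> C" using v by simp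
          then show ?thesis using un uC e lt rC(1) unfolding one_earlier_def by metis
        qed
      qed
    qed
  qed
  have "card V > 0" using finV connected by (auto simp: card_gt_0_iff connected_graph_def)
  then have eq: "Suc (card V - 1) = card V" by simp
  obtain C r where "C \<subseteq> V \<and> conn E C \<and> card C = card V \<and> inj_on r C \<and> r ` C \<subseteq> {..card V - 1} \<and> one_earlier C r"
    using chain[of "card V - 1", unfolded eq, OF order_refl] by (elim exE)
  then have C: "C \<subseteq> V" "card C = card V" "inj_on r C" and un: "one_earlier C r" by simp_all
  have CV: "C = V" using C finV card_subset_eq by blast
  define p where "p = (\<lambda>v. SOME u. {u, v} \<in> E \<and> r u < r v)"
  have "parent_ordered_graph V E r p"
  proof
    show "simple_graph V E" "connected_graph V E" "inj_on r V" using simple connected C CV by auto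
    fix u v assume uv: "{u, v} \<in> E" "r u < r v"
    then have p: "{p v, v} \<in> E \<and> r (p v) < r v"
      unfolding p_def by (intro someI[of "\<lambda>u. {u, v} \<in> E \<and> r u < r v" u]) simp
    have "{u, v} \<subseteq> V" "{p v, v} \<subseteq> V" using uv p simple by (auto simp: simple_graph_def)
    then show "u = p v" using un uv p CV unfolding one_earlier_def by blast
  qed
  then show ?thesis by blast
qed

lemma connected_by_parents:
  fixes q :: "nat \<Rightarrow> nat"
  assumes "\<And>v. 1 < v \<Longrightarrow> v \<le> n + 1 \<Longrightarrow> {q v, v} \<in> E \<and> 1 \<le> q v \<and> q v < v"
  shows "connected_graph {1..n + 1} E"
proof (rule connected_graphI[of 1])
  fix u assume "u \<in> {1..n + 1}"
  then show "(1, u) \<in> (edge_rel E)\<^sup>*"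
  proof (induction u rule: less_induct)
    case (less u)
    show ?case
    proof (cases "u = 1")
      case False
      then have q: "{q u, u} \<in> E \<and> 1 \<le> q u \<and> q u < u" using assms[of u] less.prems by auto
      then have "(1, q u) \<in> (edge_rel E)\<^sup>*" using less by auto
      then show ?thesis using q by (auto intro: rtrancl_into_rtrancl)
    qed simp
  qed
qed simp

interpretation path: parent_ordered_graph "{1..n + 1}" "path_edges n" "\<lambda>v. v" "\<lambda>v. v - 1" for n
proof
  show "simple_graph {1..n + 1} (path_edges n)" by (auto simp: simple_graph_def path_edges_def)
  show "connected_graph {1..n + 1} (path_edges n)"
  proof (rule connected_by_parents[of _ "\<lambda>v. v - 1"])
    fix v :: nat assume "1 < v" "v \<le> n + 1"
    then have v: "{v - 1, v} = {v - 1, v - 1 + 1}" "v - 1 \<in> {1..n}" by auto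
    then have "{v - 1, v} \<in> path_edges n" unfolding path_edges_def by blast
    then show "{v - 1, v} \<in> path_edges n \<and> 1 \<le> v - 1 \<and> v - 1 < v" using v(2) by auto
  qed
qed (auto simp: path_edges_def doubleton_eq_iff)

interpretation star: parent_ordered_graph "{1..n + 1}" "star_edges n" "\<lambda>v. v" "\<lambda>v. 1" for n
proof
  show "simple_graph {1..n + 1} (star_edges n)" by (auto simp: simple_graph_def star_edges_def)
  show "connected_graph {1..n + 1} (star_edges n)"
    by (rule connected_by_parents[of _ "\<lambda>v. 1"]) (auto simp: star_edges_def)
qed (auto simp: star_edges_def doubleton_eq_iff)

text \<open>
  The initial segment of \<open>S\<close> up to \<open>k + 1\<close> is connected and contains an earlier vertex, so it contains the
  parent of \<open>k + 1\<close>.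
\<close>
lemma path_interval:
  assumes S: "S \<in> graphical_building_set {1..n + 1} (path_edges n)" "y \<in> S" "x \<in> S" and j: "y \<le> j" "j \<le> x"
  shows "j \<in> S"
  using j(2,1)
proof (induction j rule: inc_induct)
  case base
  show ?case using S by simp
next
  case (step k)
  have "{s \<in> S. s \<le> Suc k} \<in> graphical_building_set {1..n + 1} (path_edges n)"
    using path.prefix_connected[OF S(1), of "Suc k"] step by simp
  moreover have "Suc k \<in> {s \<in> S. s \<le> Suc k}" using step by simp
  moreover have "y \<in> {s \<in> S. s \<le> Suc k}" "y \<noteq> Suc k" using S(2) step by simp_all
  then have "{s \<in> S. s \<le> Suc k} \<noteq> {Suc k}" by blast
  ultimately have "Suc k - 1 \<in> {s \<in> S. s \<le> Suc k} - {Suc k}"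
    by (intro has_parentsD[OF path.graphical_has_parents]) auto
  then show ?case by simp
qed

lemma path_max_chains: "max_chains (\<lambda>v. v) (graphical_building_set {1..n + 1} (path_edges n))"
  unfolding max_chains_def
proof (intro ballI impI)
  fix S S' x
  assume S: "S \<in> graphical_building_set {1..n + 1} (path_edges n)" "S' \<in> graphical_building_set {1..n + 1} (path_edges n)"
    and x: "x \<in> S \<inter> S'" and max: "\<forall>y\<in>S \<union> S'. y \<le> x"
  show "S \<subseteq> S' \<or> S' \<subseteq> S"
  proof (rule ccontr)
    assume "\<not> ?thesis"
    then obtain a b where ab: "a \<in> S" "a \<notin> S'" "b \<in> S'" "b \<notin> S" by blast
    then show False
      using path_interval[OF S(1) ab(1), of x b] path_interval[OF S(2) ab(3), of x a] x max by (cases "a \<le> b") auto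
  qed
qed

lemma star_all_through: "all_through 1 {1..n + 1} (graphical_building_set {1..n + 1} (star_edges n))"
  unfolding all_through_def
proof (intro conjI allI ballI impI)
  fix S :: "nat set" assume S: "1 \<in> S" "S \<subseteq> {1..n + 1}"
  have "conn (star_edges n) S"
  proof (rule connected_graphI[OF S(1)])
    fix u assume u: "u \<in> S"
    show "(1, u) \<in> (edge_rel (induced_edges (star_edges n) S))\<^sup>*"
    proof (cases "u = 1")
      case False
      then have "u \<in> {2..n + 1}" using u S by force
      then have "{1, u} \<in> star_edges n" by (auto simp: star_edges_def)
      then show ?thesis using u S by (intro r_into_rtrancl) (simp add: induced_edge_iff)
    qed simp
  qed
  then show "S \<in> graphical_building_set {1..n + 1} (star_edges n)" using S by (simp add: mem_graphical)
next
  fix S assume S: "S \<in> graphical_building_set {1..n + 1} (star_edges n)" "card S \<noteq> 1"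
  have "Max S \<in> S" using star.finite_mem[OF S(1)] star.nonempty[OF S(1)] by simp
  moreover have "S \<noteq> {Max S}" using S(2) by (metis card_1_singleton_iff One_nat_def)
  ultimately have "1 \<in> S - {Max S}"
    using has_parentsD[OF star.graphical_has_parents S(1)] star.finite_mem[OF S(1)] by simp
  then show "1 \<in> S" by simp
qed simp

theorem theorem7:
  fixes n :: nat
    and e :: "nat \<Rightarrow> real ^ 'm"
    and E :: "nat set set"
  assumes "n \<ge> 1"
    and "CARD('m) = n + 1"
    and "bij_betw e {1..n + 1} Basis"
    and "tree {1..n + 1} E"
  defines "P \<equiv> graph_associahedron e {1..n + 1} E"
    and "As \<equiv> associahedron e n"
    and "St \<equiv> stellohedron e n"
  shows "(\<forall>i\<le>n div 2. gamma_num As i \<le> gamma_num P i \<and> gamma_num P i \<le> gamma_num St i) \<and>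
         (\<forall>i\<le>n div 2. g_num As i \<le> g_num P i \<and> g_num P i \<le> g_num St i) \<and>
         (\<forall>i\<le>n. h_num As i \<le> h_num P i \<and> h_num P i \<le> h_num St i) \<and>
         (\<forall>i\<le>n. f_num As i \<le> f_num P i \<and> f_num P i \<le> f_num St i)"
proof -
  let ?V = "{1..n + 1} :: nat set"
  let ?H = "\<lambda>E'. face_sum (var_alpha - var_t) var_t ?V (graphical_building_set ?V E')"
  have card: "card ?V = Suc n" by simp
  have s: "sym_s = (var_alpha - var_t + var_t) * var_t" and d: "sym_d = var_alpha - var_t + 2 * var_t"
    by (simp_all add: algebra_simps)
  have poly: "pdim (graph_associahedron e ?V E') = n \<and> H_poly (graph_associahedron e ?V E') = ?H E'"
    if "accessible_building_set ?V (graphical_building_set ?V E')" for E'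
  proof -
    interpret accessible_building_set ?V "graphical_building_set ?V E'" by fact
    interpret nestohedron ?V "graphical_building_set ?V E'" e by unfold_locales fact
    have "minkowski_sum = graph_associahedron e ?V E'" by (simp only: minkowski_sum_def graph_associahedron_def)
    then show ?thesis using pdim_minkowski_sum H_poly_minkowski_sum card by simp
  qed
  obtain r p where "parent_ordered_graph ?V E r p" using tree_parent_order[OF assms(4)] by blast
  then interpret T: parent_ordered_graph ?V E r p .
  have P: "pdim P = n" "H_poly P = ?H E" using poly[OF T.accessible_building_set_axioms] by (auto simp: P_def)
  have As: "pdim As = n" "H_poly As = path_poly sym_s sym_d (Suc n)"
    using poly[OF path.accessible_building_set_axioms] face_sum_path[OF s d path.graphical_ordered path_max_chains card]
    by (auto simp: As_def associahedron_def)
  have St: "pdim St = n" "H_poly St = star_poly sym_s sym_d (Suc n)"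
    using poly[OF star.accessible_building_set_axioms] face_sum_star[OF s d star.graphical_ordered star_all_through card]
    by (auto simp: St_def stellohedron_def)
  have "gamma_le sym_s sym_d n (H_poly As) (H_poly P)"
    using face_sum_bounds[OF s d T.graphical_ordered card] As P by simp
  note low = gamma_le_invariants[OF As(1) P(1) this]
  have "gamma_le sym_s sym_d n (H_poly P) (H_poly St)"
    using face_sum_tree_le_star[OF s d T.graphical_ordered T.graphical_has_parents card] St P by simp
  note high = gamma_le_invariants[OF P(1) St(1) this]
  show ?thesis using low high by blast
qed

end
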